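(* Let $\mathcal{F}$ and $\mathcal{G}$ be the characteristic functions $\mathcal{F}(x)=\mathbb{E}(e^{ixX})$, $\mathcal{G}(x)=\mathbb{E}(e^{ixY})$, $x\in\mathbb{R}$, of the limit random variables $X,Y$ of the continuous-time urn process started from one red ball and one black ball respectively (defined in the context). Then $(\mathcal{F},\mathcal{G})$ is the unique solution (as a pair of differentiable functions $\mathbb{R}\to\mathbb{C}$) of the differential system $$\begin{cases}\mathcal{F}(x)+mx\,\mathcal{F}'(x)=\mathcal{F}(x)^{a+1}\mathcal{G}(x)^{b},\\ \mathcal{G}(x)+mx\,\mathcal{G}'(x)=\mathcal{F}(x)^{c}\mathcal{G}(x)^{d+1},\end{cases}$$ that satisfies, as $x\to0$, $$\mathcal{F}(x)=1+i\frac{b}{S}x+O(x^2),\qquad \mathcal{G}(x)=1-i\frac{c}{S}x+O(x^2).$$ Moreover, with $\kappa=\left(\frac{S}{m(S-m)}\right)^{1/m}>0$, they are given by the formulae $$\forall x>0\qquad\begin{cases}\mathcal{F}(x)=\kappa\, e^{-\frac{i\pi}{2m}}\,x^{-\frac1m}\,J_{m,S,b}\!\left(C_0(m,S,b)+\dfrac{\kappa^S e^{-\frac{i\pi S}{2m}}}{S}\,x^{-\frac Sm}\right),\\[2mm] \mathcal{G}(x)=\kappa\, e^{\frac{i\pi}{2m}}\,x^{-\frac1m}\,J_{m,S,c}\!\left(C_0(m,S,c)+\dfrac{\kappa^S e^{\frac{i\pi S}{2m}}}{S}\,x^{-\frac Sm}\right),\end{cases}$$ and $$\forall x\in\mathbb{R}\qquad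 \mathcal{F}(-x)=\overline{\mathcal{F}(x)},\qquad \mathcal{G}(-x)=\overline{\mathcal{G}(x)}.$$
   Context: Standing assumptions (balanced, large, nontriangular urn): $m,S,b$ are integers with $m+2\le S\le 2m-1$ and $1\le b\le S-m-1$; put $a=S-b$, $c=S-m-b$, $d=m+b$ (so $a+b=c+d=S$; note that $1\le c\le S-m-1$ too). Urn. For $(\alpha,\beta)\in\mathbb{N}^2\setminus\{(0,0)\}$, $(U^{CT}_{(\alpha,\beta)}(t))_{t\ge0}$ is the Markov jump process on $\mathbb{N}^2\setminus\{(0,0)\}$ started at $(\alpha,\beta)$ which, from $(x,y)$ ($x$ red, $y$ black balls), jumps to $(x+a,y+b)$ at rate $x$ and to $(x+c,y+d)$ at rate $y$. With $u_2(x,y)=\frac1S(bx-cy)$, $X=\lim_{t\to\infty}e^{-mt}u_2(U^{CT}_{(1,0)}(t))$ and $Y=\lim_{t\to\infty}e^{-mt}u_2(U^{CT}_{(0,1)}(t))$ (limits a.s. and in every $L^p$, $p\ge1$). Functions $I$, $J$ and constant $C_0$. Let $\beta\in\{b,c\}$. Let $\mathbb{H}=\{z:\Im z>0\}$, $\overline{\mathbb{H}}=\{z:\Im z<0\}$, $\mathcal{S}_m=\{z\in\mathbb{C}\setminus\{0\}:-\frac{\pi}{m}<\arg z<\frac{\pi}{m}\}$. For $z\in\mathcal{S}_m$, $$I_{m,S,\beta}(z)=\int_{[z,z\infty)}(1+u^m)^{\beta/m}\frac{du}{u^{S+1}}=\frac{1}{z^S}\int_1^{+\infty}[1+(tz)^m]^{\beta/m}\frac{dt}{t^{S+1}},$$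 where $[z,z\infty)=\{tz:t\ge1\}$ and $m$th roots are principal determinations. The function $I_{m,S,\beta}$ maps $\mathcal{S}_m\cap\mathbb{H}$ biholomorphically onto an open set containing the lower half-plane $\overline{\mathbb{H}}$. The function $J_{m,S,\beta}:\mathbb{C}\setminus(-\infty,0]\to\mathcal{S}_m$ is the unique continuous function such that, for $z\in\overline{\mathbb{H}}$, $J_{m,S,\beta}(z)$ is the point of $\mathcal{S}_m\cap\mathbb{H}$ whose image by $I_{m,S,\beta}$ is $z$, and, for $z\in\mathbb{H}$, $J_{m,S,\beta}(z)=\overline{J_{m,S,\beta}(\overline z)}$. Finally $$C_0(m,S,\beta)=\sum_{n\ge0}\binom{\beta/m}{n}\left(\frac{1}{S-\beta+mn}+\frac{1}{mn-S}\right),$$ with generalized binomial coefficients; it is a negative real number. *)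

theory Defs
  imports "HOL-Probability.Probability" "HOL-Library.Landau_Symbols"
begin

definition total_rate :: "('s \<Rightarrow> 's \<Rightarrow> real) \<Rightarrow> 's \<Rightarrow> real" where
  "total_rate q x = (\<Sum>\<^sub>\<infinity>y. q x y)"

text \<open>
  Jump chain and holding time description of a Markov jump process with jump rates \<open>q\<close> and no
  absorbing state, started at \<open>s\<close>: \<open>Z\<close> is the sequence of visited states and \<open>\<tau> i\<close> is the time spent
  in \<open>Z i\<close>.  The third condition gives the joint law of \<open>(Z, \<tau>)\<close>: the jump chain has transition
  probabilities \<open>q x y / total_rate q x\<close> and, given the chain, the holding times are independent
  and exponential with parameters \<open>total_rate q (Z i)\<close>.  Only times \<open>t \<ge> 0\<close> matter, and \<open>U\<close> is
  not constrained after a possible explosion time (the urn process below does not explode).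
\<close>
definition markov_jump_process ::
  "'w measure \<Rightarrow> ('s::countable \<Rightarrow> 's \<Rightarrow> real) \<Rightarrow> 's \<Rightarrow> (real \<Rightarrow> 'w \<Rightarrow> 's) \<Rightarrow> bool" where
  "markov_jump_process M q s U \<longleftrightarrow>
     prob_space M \<and>
     (\<forall>t\<ge>0. U t \<in> measurable M (count_space UNIV)) \<and>
     (\<exists>(Z :: nat \<Rightarrow> 'w \<Rightarrow> 's) (\<tau> :: nat \<Rightarrow> 'w \<Rightarrow> real).
        (\<forall>i. Z i \<in> measurable M (count_space UNIV)) \<and>
        (\<forall>i. \<tau> i \<in> borel_measurable M) \<and>
        (\<forall>n z t. (\<forall>i<n. 0 \<le> t i) \<longrightarrow>
           measure M {\<omega> \<in> space M. (\<forall>i\<le>n. Z i \<omega> = z i) \<and> (\<forall>i<n. t i < \<tau> i \<omega>)} =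
           (if z 0 = s then 1 else 0) *
           (\<Prod>i<n. q (z i) (z (Suc i)) / total_rate q (z i) * exp (- total_rate q (z i) * t i))) \<and>
        (AE \<omega> in M. \<forall>n t. (\<Sum>i<n. \<tau> i \<omega>) \<le> t \<and> t < (\<Sum>i<Suc n. \<tau> i \<omega>) \<longrightarrow> U t \<omega> = Z n \<omega>))"

text \<open>A state \<open>(x, y)\<close> consists of \<open>x\<close> red and \<open>y\<close> black balls.\<close>
definition urn_rate :: "nat \<Rightarrow> nat \<Rightarrow> nat \<Rightarrow> nat \<Rightarrow> nat \<times> nat \<Rightarrow> nat \<times> nat \<Rightarrow> real" where
  "urn_rate a b c d = (\<lambda>(x, y) s.
     (if s = (x + a, y + b) then real x else 0) + (if s = (x + c, y + d) then real y else 0))"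

lemma total_rate_urn_rate: "total_rate (urn_rate a b c d) (x, y) = real x + real y"
proof -
  let ?A = "{(x + a, y + b), (x + c, y + d)}"
  have "total_rate (urn_rate a b c d) (x, y) = infsum (urn_rate a b c d (x, y)) ?A"
    unfolding total_rate_def by (rule infsum_cong_neutral) (auto simp: urn_rate_def)
  also have "\<dots> = sum (urn_rate a b c d (x, y)) ?A"
    by (rule infsum_finite) simp
  also have "\<dots> = real x + real y"
    by (cases "(x + a, y + b) = (x + c, y + d)") (auto simp: urn_rate_def)
  finally show ?thesis .
qed

definition u2 :: "nat \<Rightarrow> nat \<Rightarrow> nat \<Rightarrow> nat \<times> nat \<Rightarrow> real" where
  "u2 S b c = (\<lambda>(x, y). (real b * real x - real c * real y) / real S)"

definition sector :: "nat \<Rightarrow> complex set" where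
  "sector m = {z. z \<noteq> 0 \<and> - (pi / real m) < Arg z \<and> Arg z < pi / real m}"

text \<open>For \<open>z \<in> sector m\<close> this is the integral of \<open>(1 + u ^ m) powr (\<beta> / m) / u ^ (S + 1)\<close> over the
  half-line \<open>{t z | t \<ge> 1}\<close>, parametrised by \<open>t\<close>.\<close>
definition I_fun :: "nat \<Rightarrow> nat \<Rightarrow> nat \<Rightarrow> complex \<Rightarrow> complex" where
  "I_fun m S \<beta> z = 1 / z ^ S *
     (LINT t:{1..}|lborel. (1 + (complex_of_real t * z) ^ m) powr (of_nat \<beta> / of_nat m)
                           / complex_of_real t ^ (S + 1))"

text \<open>The conditions determine the function on the slit plane \<open>- \<real>\<^sub>\<le>\<^sub>0\<close>; the choice
  operator only fixes irrelevant values on the slit.\<close>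
definition J_fun :: "nat \<Rightarrow> nat \<Rightarrow> nat \<Rightarrow> complex \<Rightarrow> complex" where
  "J_fun m S \<beta> = (SOME J.
     continuous_on (- \<real>\<^sub>\<le>\<^sub>0) J \<and>
     J ` (- \<real>\<^sub>\<le>\<^sub>0) \<subseteq> sector m \<and>
     (\<forall>z. Im z < 0 \<longrightarrow> J z \<in> sector m \<and> Im (J z) > 0 \<and> I_fun m S \<beta> (J z) = z) \<and>
     (\<forall>z. Im z > 0 \<longrightarrow> J z = cnj (J (cnj z))))"

definition C0 :: "nat \<Rightarrow> nat \<Rightarrow> nat \<Rightarrow> real" where
  "C0 m S \<beta> = (\<Sum>n. ((real \<beta> / real m) gchoose n) *
     (1 / (real S - real \<beta> + real m * real n) + 1 / (real m * real n - real S)))"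

definition urn_system_solution ::
  "nat \<Rightarrow> nat \<Rightarrow> nat \<Rightarrow> nat \<Rightarrow> nat \<Rightarrow> nat \<Rightarrow> (real \<Rightarrow> complex) \<Rightarrow> (real \<Rightarrow> complex) \<Rightarrow> bool" where
  "urn_system_solution m S a b c d F G \<longleftrightarrow>
     (\<forall>x. F differentiable at x) \<and> (\<forall>x. G differentiable at x) \<and>
     (\<forall>x. F x + of_nat m * of_real x * vector_derivative F (at x) = F x ^ (a + 1) * G x ^ b) \<and>
     (\<forall>x. G x + of_nat m * of_real x * vector_derivative G (at x) = F x ^ c * G x ^ (d + 1)) \<and>
     (\<lambda>x. F x - (1 + \<i> * (of_nat b / of_nat S) * of_real x)) \<in> O[at 0](\<lambda>x. of_real (x ^ 2)) \<and>
     (\<lambda>x. G x - (1 - \<i> * (of_nat c / of_nat S) * of_real x)) \<in> O[at 0](\<lambda>x. of_real (x ^ 2))"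

end

theory Submission
  imports Defs "HOL-Complex_Analysis.Complex_Analysis"
begin

text \<open>
  The proof has a probabilistic and an analytic half, which meet in the differential system.

  Every draw adds \<open>S\<close> balls, so the total jump rate after \<open>n\<close> jumps from a single ball is
  \<open>1 + n S\<close>, whatever the colours drawn.  Hence the holding times are independent of the jump
  chain, and the number of jumps up to time \<open>t\<close> has an explicit negative binomial law
  (\<open>yule_pmf\<close>).  Means of functions of the jump chain are normalised iterates of the off-diagonal part
  \<open>urn_gen\<close> of the generator.  On a multiplicative function \<open>h\<close> this operator obeys the Leibniz
  rule (\<open>urn_gen_leibniz\<close>), so the mean of \<open>h\<close> at time \<open>t\<close>, as a function of the initial state, is
  multiplicative too; this is the branching property, and it closes the backward equation to a
  system for the two one-ball means (\<open>urn_mean_deriv\<close>, \<open>expectation_U\<close>).  For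
  \<open>h = exp (i \<theta> u2)\<close> with \<open>\<theta> = x exp (- m t)\<close> the limit \<open>t \<rightarrow> \<infinity>\<close> turns it into the system for
  \<open>F\<close> and \<open>G\<close> (\<open>self_similar_limit_ode\<close>).  The expansions at \<open>0\<close> hold because the martingale
  \<open>exp (- m T n) * u2 (Z n)\<close> along the jump times \<open>T n\<close> is bounded in \<open>L\<^sup>2\<close>; this uses
  \<open>S < 2 m\<close> (\<open>gen_u2_square_bounded\<close>).

  The formulae are proved for an arbitrary solution, so they also give uniqueness.  The system has
  the first integral \<open>(F powr (-m) - G powr (-m)) / x\<close>, which the expansions determine.  It
  eliminates \<open>F\<close>: the function \<open>v(x) = i \<kappa>\<^sup>m / (x G(x)\<^sup>m)\<close> satisfies
  \<open>1 + v(x) = i \<kappa>\<^sup>m / (x F(x)\<^sup>m)\<close>, and the system becomes the statement that \<open>\<Psi> (v(x))\<close> moves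
  along an explicit half-line, where \<open>\<Psi>\<close> is the primitive vanishing at \<open>0\<close> of
  \<open>(1 + v) powr (c / m) * v powr (b / m) / m\<close>.  This \<open>\<Psi>\<close> is a Schwarz-Christoffel map of the upper
  half-plane.  It is injective, because the argument of its derivative stays in an interval of length
  less than \<open>\<pi>\<close>, and its image contains the upper half-plane.  In the variable \<open>v = z powr (-m)\<close> it
  is the function \<open>I_fun\<close> (\<open>I_fun_eq\<close>), so that \<open>J_fun\<close> is the root of order \<open>-m\<close> of its inverse
  (\<open>J_fun_eq_root_K\<close>).  The starting point of the half-line is found by comparing the expansions of
  \<open>\<Psi>\<close> at \<open>0\<close> and at \<open>\<infinity>\<close>, which produces the constant \<open>C0\<close> (\<open>\<Psi>_series_infinity\<close>).  As long as
  \<open>v\<close> has not left the upper half-plane, \<open>v(x)\<close> equals the inverse of \<open>\<Psi>\<close> at the moving point, and this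
  inverse has values inside the half-plane; therefore \<open>v\<close> never leaves it (\<open>v_upper\<close>).  This gives
  the formula for \<open>G\<close>.  Exchanging the colours and conjugating gives the one for \<open>F\<close>, and
  the reflection \<open>x \<mapsto> - x\<close> covers the negative axis.
\<close>

section \<open>The generator of the urn and its iterates\<close>

text \<open>
  The off-diagonal part of the generator of the jump process.
\<close>
definition urn_gen ::
  "nat \<Rightarrow> nat \<Rightarrow> nat \<Rightarrow> nat \<Rightarrow> (nat \<times> nat \<Rightarrow> 'a::comm_ring_1) \<Rightarrow> nat \<times> nat \<Rightarrow> 'a" where
  "urn_gen a b c d h = (\<lambda>(x, y). of_nat x * h (x + a, y + b) + of_nat y * h (x + c, y + d))"

text \<open>
  Pascal's rule in the shape of the induction step of the Leibniz rule.
\<close>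
lemma binomial_convolution_Suc:
  fixes A B :: "nat \<Rightarrow> 'a::comm_ring_1"
  shows "(\<Sum>k\<le>Suc n. of_nat (Suc n choose k) * A k * B (Suc n - k)) =
    (\<Sum>k\<le>n. of_nat (n choose k) * A (Suc k) * B (n - k)) +
    (\<Sum>k\<le>n. of_nat (n choose k) * A k * B (Suc n - k))"
proof -
  have "(\<Sum>k\<le>Suc n. of_nat (Suc n choose k) * A k * B (Suc n - k)) =
     A 0 * B (Suc n) + (\<Sum>k\<le>n. of_nat (Suc n choose Suc k) * A (Suc k) * B (n - k))"
    by (subst sum.atMost_Suc_shift) simp
  also have "(\<Sum>k\<le>n. of_nat (Suc n choose Suc k) * A (Suc k) * B (n - k)) =
     (\<Sum>k\<le>n. of_nat (n choose k) * A (Suc k) * B (n - k)) +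
     (\<Sum>k\<le>n. of_nat (n choose Suc k) * A (Suc k) * B (n - k))"
    by (simp add: algebra_simps sum.distrib)
  also have "A 0 * B (Suc n) + (\<dots>) = (\<Sum>k\<le>n. of_nat (n choose k) * A (Suc k) * B (n - k)) +
     (\<Sum>k\<le>Suc n. of_nat (n choose k) * A k * B (Suc n - k))"
    by (subst sum.atMost_Suc_shift[where n = n and g = "\<lambda>k. of_nat (n choose k) * A k * B (Suc n - k)"]) (simp add: algebra_simps)
  also have "(\<Sum>k\<le>Suc n. of_nat (n choose k) * A k * B (Suc n - k)) =
     (\<Sum>k\<le>n. of_nat (n choose k) * A k * B (Suc n - k))"
    by (simp add: binomial_eq_0)
  finally show ?thesis .
qed

text \<open>
  The rates are linear in the state, so a step of a union of two urns is a step of one of them.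
  For multiplicative \<open>h\<close> this makes the operator a derivation with respect to the
  addition of states; it is the branching property of the urn.
\<close>
lemma urn_gen_leibniz:
  assumes h: "\<And>x y x' y'. h (x + x', y + y') = h (x, y) * h (x', y')"
  shows "(urn_gen a b c d ^^ n) h (x + x', y + y') =
    (\<Sum>k\<le>n. of_nat (n choose k) * (urn_gen a b c d ^^ k) h (x, y) * (urn_gen a b c d ^^ (n - k)) h (x', y'))"
proof (induction n arbitrary: x y x' y')
  case 0
  then show ?case by (simp add: h)
next
  case (Suc n)
  let ?W = "\<lambda>n. (urn_gen a b c d ^^ n) h"
  have "?W (Suc n) (x + x', y + y') =
     of_nat x * ?W n ((x + a) + x', (y + b) + y') + of_nat y * ?W n ((x + c) + x', (y + d) + y') +
     (of_nat x' * ?W n (x + (x' + a), y + (y' + b)) + of_nat y' * ?W n (x + (x' + c), y + (y' + d)))"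
    by (simp add: urn_gen_def algebra_simps)
  also have "\<dots> = (\<Sum>k\<le>n. of_nat (n choose k) * ?W (Suc k) (x, y) * ?W (n - k) (x', y')) +
    (\<Sum>k\<le>n. of_nat (n choose k) * ?W k (x, y) * ?W (Suc (n - k)) (x', y'))"
    unfolding Suc sum_distrib_left
    by (simp add: sum.distrib[symmetric] urn_gen_def algebra_simps)
  also have "(\<Sum>k\<le>n. of_nat (n choose k) * ?W k (x, y) * ?W (Suc (n - k)) (x', y')) =
     (\<Sum>k\<le>n. of_nat (n choose k) * ?W k (x, y) * ?W (Suc n - k) (x', y'))"
    by (intro sum.cong) (simp_all add: Suc_diff_le del: funpow.simps)
  finally show ?case
    using binomial_convolution_Suc[of n "\<lambda>k. ?W k (x, y)" "\<lambda>k. ?W k (x', y')"] by simp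
qed

locale balanced_urn =
  fixes a b c d S :: nat
  assumes S_pos: "0 < S" and ab: "a + b = S" and cd: "c + d = S"
begin

definition gen :: "nat \<Rightarrow> (nat \<times> nat \<Rightarrow> 'a::comm_ring_1) \<Rightarrow> nat \<times> nat \<Rightarrow> 'a" where
  "gen n = urn_gen a b c d ^^ n"

lemma gen_0 [simp]: "gen 0 h = h"
  by (simp add: gen_def)

lemma gen_Suc: "gen (Suc n) h (x, y) = of_nat x * gen n h (x + a, y + b) + of_nat y * gen n h (x + c, y + d)"
  by (simp add: gen_def urn_gen_def)

text \<open>
  The product is the common value, for all paths with \<open>n\<close> draws, of the product of
  the total rates met on the way.
\<close>
lemma norm_gen_le:
  fixes h :: "nat \<times> nat \<Rightarrow> complex"
  assumes h: "\<And>s. norm (h s) \<le> 1"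
  shows "norm (gen n h (x, y)) \<le> (\<Prod>i<n. real (x + y + i * S))"
proof (induction n arbitrary: x y)
  case 0
  then show ?case by (simp add: h)
next
  case (Suc n)
  have ab': "(x + a) + (y + b) + i * S = x + y + Suc i * S"
    and cd': "(x + c) + (y + d) + i * S = x + y + Suc i * S" for i
    using ab cd by simp_all
  have "norm (gen (Suc n) h (x, y)) \<le> real x * norm (gen n h (x + a, y + b)) + real y * norm (gen n h (x + c, y + d))"
    unfolding gen_Suc by (rule norm_triangle_le) (simp add: norm_mult)
  also have "\<dots> \<le> real x * (\<Prod>i<n. real (x + y + Suc i * S)) + real y * (\<Prod>i<n. real (x + y + Suc i * S))"
    using Suc[of "x + a" "y + b"] Suc[of "x + c" "y + d"] unfolding ab' cd'
    by (intro add_mono mult_left_mono) simp_all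
  also have "\<dots> = (\<Prod>i<Suc n. real (x + y + i * S))"
    by (subst prod.lessThan_Suc_shift) (simp add: algebra_simps)
  finally show ?case .
qed

lemma prod_rates_pochhammer:
  "(\<Prod>i<n. real (k + i * S)) = real S ^ n * pochhammer (real k / real S) n"
proof (induction n)
  case (Suc n)
  then show ?case using S_pos by (simp add: pochhammer_Suc field_simps)
qed simp

text \<open>
  Up to the time change \<open>u = (1 - exp (- S t)) / S\<close> and the factor
  \<open>exp (- k t)\<close>, where \<open>k\<close> is the initial number of balls, this is
  the mean of \<open>h\<close> at time \<open>t\<close>.
\<close>
definition egf :: "(nat \<times> nat \<Rightarrow> complex) \<Rightarrow> nat \<times> nat \<Rightarrow> complex \<Rightarrow> complex" where
  "egf h s u = (\<Sum>n. gen n h s / fact n * u ^ n)"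

text \<open>
  The terms are dominated by those of the binomial series of
  \<open>(1 - S u) powr (- k / S)\<close>, with \<open>k\<close> the initial number of
  balls.
\<close>
lemma summable_norm_egf:
  fixes u :: complex
  assumes h: "\<And>s. norm (h s) \<le> 1" and u: "norm u < 1 / real S"
  shows "summable (\<lambda>n. norm (gen n h (x, y) / fact n * u ^ n))"
proof (rule summable_comparison_test')
  let ?q = "real (x + y) / real S"
  have "norm (- (real S * norm u)) < 1"
    using u S_pos by (simp add: field_simps)
  from summable_gbinomial[OF this, of "- ?q"]
  show "summable (\<lambda>n. ((- ?q) gchoose n) * (- (real S * norm u)) ^ n)" .
  fix n
  have "norm (norm (gen n h (x, y) / fact n * u ^ n)) = norm (gen n h (x, y)) / fact n * norm u ^ n"
    by (simp add: norm_mult norm_divide norm_power)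
  also have "\<dots> \<le> (\<Prod>i<n. real (x + y + i * S)) / fact n * norm u ^ n"
    by (intro mult_right_mono divide_right_mono norm_gen_le h) simp_all
  also have "\<dots> = ((- ?q) gchoose n) * (- (real S * norm u)) ^ n"
  proof -
    have "(- 1) ^ n * (- 1) ^ n = (1::real)"
      by (simp flip: power_mult_distrib)
    then have "((- ?q) gchoose n) * (- (real S * norm u)) ^ n = pochhammer ?q n / fact n * (real S * norm u) ^ n"
      unfolding gbinomial_pochhammer power_minus[of "real S * norm u"] by simp
    then show ?thesis
      unfolding prod_rates_pochhammer by (simp add: power_mult_distrib)
  qed
  finally show "norm (norm (gen n h (x, y) / fact n * u ^ n)) \<le> ((- ?q) gchoose n) * (- (real S * norm u)) ^ n" .
qed

text \<open>
  The Leibniz rule says that the coefficients form a Cauchy product.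
\<close>
lemma egf_add:
  assumes h: "\<And>s. norm (h s) \<le> 1" and u: "norm u < 1 / real S"
    and hom: "\<And>x y x' y'. h (x + x', y + y') = h (x, y) * h (x', y')"
  shows "egf h (x + x', y + y') u = egf h (x, y) u * egf h (x', y') u"
proof -
  have "egf h (x, y) u * egf h (x', y') u =
    (\<Sum>n. \<Sum>k\<le>n. (gen k h (x, y) / fact k * u ^ k) * (gen (n - k) h (x', y') / fact (n - k) * u ^ (n - k)))"
    unfolding egf_def using summable_norm_egf[of h u] h u by (intro Cauchy_product) auto
  also have "(\<lambda>n. \<Sum>k\<le>n. (gen k h (x, y) / fact k * u ^ k) * (gen (n - k) h (x', y') / fact (n - k) * u ^ (n - k)))
    = (\<lambda>n. gen n h (x + x', y + y') / fact n * u ^ n)"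
  proof
    fix n
    show "(\<Sum>k\<le>n. (gen k h (x, y) / fact k * u ^ k) * (gen (n - k) h (x', y') / fact (n - k) * u ^ (n - k)))
      = gen n h (x + x', y + y') / fact n * u ^ n"
      unfolding gen_def urn_gen_leibniz[of h, OF hom] sum_divide_distrib sum_distrib_right
    proof (intro sum.cong refl)
      fix k assume "k \<in> {..n}"
      then have k: "k \<le> n" by simp
      have "(of_nat (n choose k) :: complex) = fact n / (fact k * fact (n - k))"
        by (rule binomial_fact[OF k])
      moreover have "u ^ n = u ^ k * u ^ (n - k)"
        using k by (simp flip: power_add)
      ultimately show "(urn_gen a b c d ^^ k) h (x, y) / fact k * u ^ k * ((urn_gen a b c d ^^ (n - k)) h (x', y') / fact (n - k) * u ^ (n - k)) =
        of_nat (n choose k) * (urn_gen a b c d ^^ k) h (x, y) * (urn_gen a b c d ^^ (n - k)) h (x', y') / fact n * u ^ n"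
        by simp
    qed
  qed
  finally show ?thesis by (simp add: egf_def)
qed

lemma egf_eq_power:
  assumes h: "\<And>s. norm (h s) \<le> 1" and u: "norm u < 1 / real S"
    and hom: "\<And>x y x' y'. h (x + x', y + y') = h (x, y) * h (x', y')" and h0: "h (0, 0) = 1"
  shows "egf h (x, y) u = egf h (1, 0) u ^ x * egf h (0, 1) u ^ y"
proof -
  have z: "gen n h (0, 0) = (if n = 0 then 1 else 0)" for n
    by (cases n) (simp_all add: gen_Suc h0)
  have "(\<lambda>n. gen n h (0, 0) / fact n * u ^ n) = (\<lambda>n. if n = 0 then 1 else 0)"
    by (simp add: z fun_eq_iff)
  then have "(\<lambda>n. gen n h (0, 0) / fact n * u ^ n) sums 1"
    using sums_single[of 0 "\<lambda>_. 1::complex"] by simp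
  then have e0: "egf h (0, 0) u = 1"
    by (simp add: egf_def sums_iff)
  have ex: "egf h (x, 0) u = egf h (1, 0) u ^ x" for x
  proof (induction x)
    case (Suc x)
    have "egf h (1 + x, 0 + 0) u = egf h (1, 0) u * egf h (x, 0) u"
      by (rule egf_add[OF h u hom])
    then show ?case using Suc by simp
  qed (simp add: e0)
  have ey: "egf h (0, y) u = egf h (0, 1) u ^ y" for y
  proof (induction y)
    case (Suc y)
    have "egf h (0 + 0, 1 + y) u = egf h (0, 1) u * egf h (0, y) u"
      by (rule egf_add[OF h u hom])
    then show ?case using Suc by simp
  qed (simp add: e0)
  show ?thesis using egf_add[OF h u hom, of x 0 0 y] ex[of x] ey[of y] by simp
qed

text \<open>
  Differentiation shifts the coefficients by one, and \<open>gen_Suc\<close> reads the shifted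
  coefficient as a first step from the initial state.
\<close>
lemma egf_deriv:
  assumes h: "\<And>s. norm (h s) \<le> 1" and u: "norm u < 1 / real S"
  shows "(egf h (x, y) has_field_derivative
     (of_nat x * egf h (x + a, y + b) u + of_nat y * egf h (x + c, y + d) u)) (at u)"
proof -
  obtain r where r: "norm u < r" "r < 1 / real S" using dense[OF u] by blast
  have r0: "0 < r" using r(1) norm_ge_zero[of u] by linarith
  have "norm (of_real r :: complex) < 1 / real S" using r r0 by simp
  from summable_norm_cancel[OF summable_norm_egf[of h, OF h this, of x y]]
  have "DERIV (\<lambda>u. \<Sum>n. gen n h (x, y) / fact n * u ^ n) u :> (\<Sum>n. diffs (\<lambda>n. gen n h (x, y) / fact n) n * u ^ n)"
    by (rule termdiffs_strong) (use r r0 in simp)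
  moreover have "(\<lambda>n. diffs (\<lambda>n. gen n h (x, y) / fact n) n * u ^ n) =
     (\<lambda>n. of_nat x * (gen n h (x + a, y + b) / fact n * u ^ n) + of_nat y * (gen n h (x + c, y + d) / fact n * u ^ n))"
  proof
    fix n
    have "diffs (\<lambda>n. gen n h (x, y) / fact n) n = gen (Suc n) h (x, y) / fact n"
      unfolding diffs_def fact_Suc of_nat_mult by (simp del: of_nat_Suc)
    then show "diffs (\<lambda>n. gen n h (x, y) / fact n) n * u ^ n =
       of_nat x * (gen n h (x + a, y + b) / fact n * u ^ n) + of_nat y * (gen n h (x + c, y + d) / fact n * u ^ n)"
      by (simp only: gen_Suc add_divide_distrib ring_distribs times_divide_eq_right mult.assoc times_divide_eq_left)
  qed
  moreover have "(\<Sum>n. of_nat x * (gen n h (x + a, y + b) / fact n * u ^ n) + of_nat y * (gen n h (x + c, y + d) / fact n * u ^ n))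
    = of_nat x * egf h (x + a, y + b) u + of_nat y * egf h (x + c, y + d) u"
    unfolding egf_def using summable_norm_cancel[OF summable_norm_egf[of h, OF h u]]
    by (subst suminf_add[symmetric]) (auto simp: suminf_mult intro!: summable_mult simp del: times_divide_eq_left times_divide_eq_right)
  moreover have "egf h (x, y) = (\<lambda>u. \<Sum>n. gen n h (x, y) / fact n * u ^ n)"
    by (simp add: egf_def fun_eq_iff)
  ultimately show ?thesis by simp
qed

text \<open>
  The mean of \<open>h\<close> at time \<open>t\<close> for the urn process started at the given
  state, in terms of the generator alone; the link with the process is
  \<open>expectation_U\<close> below.
\<close>
definition urn_mean :: "(nat \<times> nat \<Rightarrow> complex) \<Rightarrow> nat \<times> nat \<Rightarrow> real \<Rightarrow> complex" where
  "urn_mean h = (\<lambda>(x, y) t. of_real (exp (- real (x + y) * t)) *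
     egf h (x, y) (of_real ((1 - exp (- real S * t)) / real S)))"

lemma urn_time_less:
  assumes "0 \<le> t"
  shows "norm (of_real ((1 - exp (- real S * t)) / real S) :: complex) < 1 / real S"
proof -
  have "exp (- real S * t) \<le> 1" using assms by simp
  then have "\<bar>1 - exp (- real S * t)\<bar> < 1" using exp_gt_zero[of "- real S * t"] by linarith
  then show ?thesis
    unfolding norm_of_real abs_divide using S_pos by (simp add: divide_strict_right_mono)
qed

lemma urn_mean_eq_power:
  assumes h: "\<And>s. norm (h s) \<le> 1" and t: "0 \<le> t"
    and hom: "\<And>x y x' y'. h (x + x', y + y') = h (x, y) * h (x', y')" and h0: "h (0, 0) = 1"
  shows "urn_mean h (x, y) t = urn_mean h (1, 0) t ^ x * urn_mean h (0, 1) t ^ y"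
proof -
  have "exp (- t) ^ k = exp (real k * - t)" for k
    by (rule exp_of_nat_mult[symmetric])
  moreover have "- real (x + y) * t = real x * - t + real y * - t"
    by (simp add: algebra_simps)
  ultimately have "exp (- real (x + y) * t) = exp (- t) ^ x * exp (- t) ^ y"
    by (simp only: exp_add)
  then show ?thesis
    using egf_eq_power[of h, OF h urn_time_less[OF t] hom h0, of x y]
    by (simp add: urn_mean_def power_mult_distrib)
qed

text \<open>
  The backward equation, closed by multiplicativity: after its first jump a single red ball has
  become \<open>a + 1\<close> red and \<open>b\<close> black balls, which evolve
  independently.
\<close>
lemma urn_mean_deriv:
  assumes h: "\<And>s. norm (h s) \<le> 1" and t: "0 \<le> t"
    and hom: "\<And>x y x' y'. h (x + x', y + y') = h (x, y) * h (x', y')" and h0: "h (0, 0) = 1"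
  shows "(urn_mean h (1, 0) has_vector_derivative
      (urn_mean h (1, 0) t ^ (a + 1) * urn_mean h (0, 1) t ^ b - urn_mean h (1, 0) t)) (at t)"
    and "(urn_mean h (0, 1) has_vector_derivative
      (urn_mean h (1, 0) t ^ c * urn_mean h (0, 1) t ^ (d + 1) - urn_mean h (0, 1) t)) (at t)"
proof -
  let ?u = "\<lambda>t. (1 - exp (- real S * t)) / real S"
  have u': "((\<lambda>t. of_real (?u t) :: complex) has_vector_derivative of_real (exp (- real S * t))) (at t)"
    by (rule has_vector_derivative_of_real)
      (use S_pos in \<open>auto intro!: derivative_eq_intros simp: field_simps\<close>)
  have deriv: "(urn_mean h (x, y) has_vector_derivative
      of_nat x * urn_mean h (x + a, y + b) t + of_nat y * urn_mean h (x + c, y + d) t - of_nat (x + y) * urn_mean h (x, y) t) (at t)" for x y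
  proof -
    have e: "((\<lambda>t. of_real (exp (- real (x + y) * t)) :: complex) has_vector_derivative
        of_real (- real (x + y) * exp (- real (x + y) * t))) (at t)"
      by (rule has_vector_derivative_of_real) (auto intro!: derivative_eq_intros)
    have p: "((\<lambda>t. egf h (x, y) (of_real (?u t))) has_vector_derivative
        of_real (exp (- real S * t)) * (of_nat x * egf h (x + a, y + b) (?u t) + of_nat y * egf h (x + c, y + d) (?u t))) (at t)"
      using field_vector_diff_chain_at[OF u' egf_deriv[of h, OF h urn_time_less[OF t]]] by (simp add: o_def)
    have abS: "exp (- real (x + a + (y + b)) * t) = exp (- real (x + y) * t) * exp (- real S * t)"
      and cdS: "exp (- real (x + c + (y + d)) * t) = exp (- real (x + y) * t) * exp (- real S * t)"
    proof -
      have "real (x + a + (y + b)) = real (x + y) + real S" "real (x + c + (y + d)) = real (x + y) + real S"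
        using ab cd by linarith+
      then show "exp (- real (x + a + (y + b)) * t) = exp (- real (x + y) * t) * exp (- real S * t)"
        "exp (- real (x + c + (y + d)) * t) = exp (- real (x + y) * t) * exp (- real S * t)"
        by (simp_all only: minus_add_distrib ring_distribs exp_add)
    qed
    have "(urn_mean h (x, y) has_vector_derivative
       of_real (exp (- real (x + y) * t)) * (of_real (exp (- real S * t)) * (of_nat x * egf h (x + a, y + b) (?u t) + of_nat y * egf h (x + c, y + d) (?u t)))
       + of_real (- real (x + y) * exp (- real (x + y) * t)) * egf h (x, y) (of_real (?u t))) (at t)"
      using has_vector_derivative_mult[OF e p] by (simp add: urn_mean_def)
    then show ?thesis
      unfolding urn_mean_def split abS cdS by (simp add: algebra_simps)
  qed
  show "(urn_mean h (1, 0) has_vector_derivative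
      (urn_mean h (1, 0) t ^ (a + 1) * urn_mean h (0, 1) t ^ b - urn_mean h (1, 0) t)) (at t)"
    using deriv[of 1 0] urn_mean_eq_power[of h, OF h t hom h0, of "1 + a" b] by simp
  show "(urn_mean h (0, 1) has_vector_derivative
      (urn_mean h (1, 0) t ^ c * urn_mean h (0, 1) t ^ (d + 1) - urn_mean h (0, 1) t)) (at t)"
    using deriv[of 0 1] urn_mean_eq_power[of h, OF h t hom h0, of c "1 + d"] by simp
qed

end

section \<open>Independent exponential clocks\<close>

lemma has_bochner_integral_exponential_density:
  assumes "0 < l"
  shows "has_bochner_integral lborel (exponential_density l) 1"
proof -
  interpret D: prob_space "density lborel (\<lambda>x. ennreal (exponential_density l x))"
    by (rule prob_space_exponential_density[OF assms])
  have "(\<integral>\<^sup>+x. ennreal (exponential_density l x) \<partial>lborel) = ennreal 1"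
    using D.emeasure_space_1 by (simp add: emeasure_density)
  then show ?thesis
    using exponential_density_nonneg[OF assms] by (intro has_bochner_integral_nn_integral) auto
qed

text \<open>
  The joint law of the holding times is known through tails at nonnegative times only;
  positivity and independence are consequences.
\<close>
locale exponential_clocks = prob_space Q for Q :: "'w measure" +
  fixes \<tau> :: "nat \<Rightarrow> 'w \<Rightarrow> real" and r :: "nat \<Rightarrow> real" and n :: nat
  assumes rv: "\<And>i. \<tau> i \<in> borel_measurable Q"
    and r_pos: "\<And>i. 0 < r i"
    and tails: "\<And>t. (\<And>i. i < n \<Longrightarrow> 0 \<le> t i) \<Longrightarrow>
      prob {\<omega> \<in> space Q. \<forall>i<n. t i < \<tau> i \<omega>} = (\<Prod>i<n. exp (- r i * t i))"
begin

lemma AE_clocks_pos: "AE \<omega> in Q. \<forall>i<n. 0 < \<tau> i \<omega>"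
proof -
  have "prob {\<omega> \<in> space Q. \<forall>i<n. 0 < \<tau> i \<omega>} = 1"
    using tails[of "\<lambda>_. 0"] by simp
  then show ?thesis
    using rv by (subst (asm) prob_Collect_eq_1) (auto intro!: measurable)
qed

lemma clock_tail:
  assumes "j < n" "0 \<le> t"
  shows "prob {\<omega> \<in> space Q. t < \<tau> j \<omega>} = exp (- r j * t)"
proof -
  have "prob {\<omega> \<in> space Q. t < \<tau> j \<omega>} = prob {\<omega> \<in> space Q. \<forall>i<n. (if i = j then t else 0) < \<tau> i \<omega>}"
    using AE_clocks_pos rv assms by (intro finite_measure_eq_AE) auto
  also have "\<dots> = (\<Prod>i<n. exp (- r i * (if i = j then t else 0)))"
    using assms by (intro tails) auto
  also have "\<dots> = (\<Prod>i<n. if i = j then exp (- r j * t) else 1)"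
    by (intro prod.cong) auto
  also have "\<dots> = exp (- r j * t)"
    using assms by simp
  finally show ?thesis .
qed

lemma clock_exponential:
  assumes "j < n"
  shows "distributed Q lborel (\<tau> j) (exponential_density (r j))"
proof (subst exponential_distributed_iff[OF r_pos], intro conjI allI impI rv)
  fix t :: real assume t: "0 \<le> t"
  have "{\<omega> \<in> space Q. \<tau> j \<omega> \<le> t} = space Q - {\<omega> \<in> space Q. t < \<tau> j \<omega>}"
    by auto
  moreover have "{\<omega> \<in> space Q. t < \<tau> j \<omega>} \<in> sets Q"
    using rv by measurable
  ultimately show "prob {\<omega> \<in> space Q. \<tau> j \<omega> \<le> t} = 1 - exp (- t * r j)"
    using clock_tail[OF assms t] by (simp add: prob_compl mult.commute)
qed

text \<open>
  The variables are almost surely positive, so a half-line with arbitrary end point, or the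
  whole line, agrees almost surely with a half-line that starts at some
  \<open>t \<ge> 0\<close>. These sets form a generating system that is stable under
  intersections.
\<close>
lemma clocks_indep:
  assumes "0 < n"
  shows "indep_vars (\<lambda>_. borel) \<tau> {..<n}"
proof -
  define E :: "real set set" where "E = insert UNIV (range (\<lambda>a. {a<..}))"
  have E_form: "\<exists>t\<ge>0. \<forall>x>0. x \<in> A \<longleftrightarrow> t < x" if "A \<in> E" for A
  proof (cases "A = UNIV")
    case True
    then show ?thesis by (intro exI[of _ 0]) auto
  next
    case False
    with that obtain s where "A = {s<..}" by (auto simp: E_def)
    then show ?thesis by (intro exI[of _ "max s 0"]) auto
  qed
  have "indep_vars (\<lambda>_. borel) \<tau> {..<n} \<longleftrightarrow>
    (\<forall>A\<in>(\<Pi> i\<in>{..<n}. E). prob (\<Inter>j\<in>{..<n}. \<tau> j -` A j \<inter> space Q) = (\<Prod>j\<in>{..<n}. prob (\<tau> j -` A j \<inter> space Q)))"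
  proof (rule indep_vars_finite)
    have "sigma_sets UNIV (range (\<lambda>a::real. {a<..})) = sigma_sets UNIV E"
      unfolding E_def by (intro sigma_sets_eqI) (auto intro: sigma_sets_top)
    then show "sets borel = sigma_sets (space borel) E"
      by (simp add: borel_Ioi[where ?'a = real])
    show "Int_stable E"
    proof (rule Int_stableI)
      fix A B assume "A \<in> E" "B \<in> E"
      moreover have "{a<..} \<inter> {b<..} = {max a b<..}" for a b :: real
        by auto
      ultimately show "A \<inter> B \<in> E" by (auto simp: E_def)
    qed
  qed (use assms rv in \<open>auto simp: E_def\<close>)
  moreover have "prob (\<Inter>j\<in>{..<n}. \<tau> j -` A j \<inter> space Q) = (\<Prod>j\<in>{..<n}. prob (\<tau> j -` A j \<inter> space Q))"
    if A: "A \<in> (\<Pi> i\<in>{..<n}. E)" for A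
  proof -
    have "\<forall>i\<in>{..<n}. \<exists>t\<ge>0. \<forall>x>0. x \<in> A i \<longleftrightarrow> t < x"
      using A E_form by auto
    then obtain t where t: "\<And>i. i < n \<Longrightarrow> 0 \<le> t i" "\<And>i x. i < n \<Longrightarrow> 0 < x \<Longrightarrow> x \<in> A i \<longleftrightarrow> t i < x"
      by (metis lessThan_iff)
    have Am: "A i \<in> sets borel" if "i < n" for i
    proof -
      have "A i \<in> E" using A that by blast
      moreover have "E \<subseteq> sets borel" unfolding E_def by auto
      ultimately show ?thesis by blast
    qed
    have pre: "\<tau> j -` A j \<inter> space Q \<in> sets Q" if "j < n" for j
      using rv Am[OF that] by (rule measurable_sets)
    have 1: "prob (\<tau> j -` A j \<inter> space Q) = exp (- r j * t j)" if "j < n" for j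
    proof -
      have "prob (\<tau> j -` A j \<inter> space Q) = prob {\<omega> \<in> space Q. t j < \<tau> j \<omega>}"
        using AE_clocks_pos rv pre[OF that] that t by (intro finite_measure_eq_AE) auto
      then show ?thesis using clock_tail[OF that] t that by simp
    qed
    have "prob (\<Inter>j\<in>{..<n}. \<tau> j -` A j \<inter> space Q) = prob {\<omega> \<in> space Q. \<forall>i<n. t i < \<tau> i \<omega>}"
    proof (rule finite_measure_eq_AE)
      show "AE \<omega> in Q. \<omega> \<in> (\<Inter>j\<in>{..<n}. \<tau> j -` A j \<inter> space Q) \<longleftrightarrow> \<omega> \<in> {\<omega> \<in> space Q. \<forall>i<n. t i < \<tau> i \<omega>}"
        using AE_clocks_pos AE_space by eventually_elim (use t assms in auto)
      show "(\<Inter>j\<in>{..<n}. \<tau> j -` A j \<inter> space Q) \<in> sets Q"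
        using assms pre by (intro sets.finite_INT) auto
      show "{\<omega> \<in> space Q. \<forall>i<n. t i < \<tau> i \<omega>} \<in> sets Q"
        using rv by measurable
    qed
    then show ?thesis using 1 t by (simp add: tails)
  qed
  ultimately show ?thesis by blast
qed

lemma laplace_sum_clocks:
  assumes "0 \<le> \<theta>"
  shows "expectation (\<lambda>\<omega>. exp (- \<theta> * (\<Sum>i<n. \<tau> i \<omega>))) = (\<Prod>i<n. r i / (r i + \<theta>))"
proof (cases "n = 0")
  case True
  then show ?thesis by (simp add: prob_space)
next
  case False
  have one: "has_bochner_integral Q (\<lambda>\<omega>. exp (- \<theta> * \<tau> i \<omega>)) (r i / (r i + \<theta>))" if "i < n" for i
  proof -
    have rt: "0 < r i + \<theta>" using r_pos[of i] assms by simp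
    have "has_bochner_integral lborel (\<lambda>x. (r i / (r i + \<theta>)) * exponential_density (r i + \<theta>) x) (r i / (r i + \<theta>))"
      using has_bochner_integral_mult_right[OF has_bochner_integral_exponential_density[OF rt], of "r i / (r i + \<theta>)"] by simp
    moreover have "(r i / (r i + \<theta>)) * exponential_density (r i + \<theta>) x = exponential_density (r i) x * exp (- \<theta> * x)" for x
    proof -
      have "exp (- x * (r i + \<theta>)) = exp (- x * r i) * exp (- \<theta> * x)"
        unfolding exp_add[symmetric] by (simp add: algebra_simps)
      then show ?thesis using rt by (simp add: exponential_density_def)
    qed
    ultimately have hb: "has_bochner_integral lborel (\<lambda>x. exponential_density (r i) x * exp (- \<theta> * x)) (r i / (r i + \<theta>))"
      by simp
    have D: "distributed Q lborel (\<tau> i) (exponential_density (r i))"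
      using clock_exponential[OF that] .
    have nonneg: "\<And>x. x \<in> space lborel \<Longrightarrow> 0 \<le> exponential_density (r i) x"
      using exponential_density_nonneg[OF r_pos] by simp
    have "integrable Q (\<lambda>\<omega>. exp (- \<theta> * \<tau> i \<omega>))"
      using distributed_integrable[OF D, of "\<lambda>x. exp (- \<theta> * x)"] hb nonneg by (auto simp: has_bochner_integral_iff)
    moreover have "expectation (\<lambda>\<omega>. exp (- \<theta> * \<tau> i \<omega>)) = r i / (r i + \<theta>)"
      using distributed_integral[OF D, of "\<lambda>x. exp (- \<theta> * x)"] hb nonneg by (auto simp: has_bochner_integral_iff)
    ultimately show ?thesis by (simp add: has_bochner_integral_iff)
  qed
  have ind: "indep_vars (\<lambda>_. borel) (\<lambda>i \<omega>. exp (- \<theta> * \<tau> i \<omega>)) {..<n}"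
    using indep_vars_compose2[OF clocks_indep, of "\<lambda>_ x. exp (- \<theta> * x)" "\<lambda>_. borel"] False by simp
  have "expectation (\<lambda>\<omega>. \<Prod>i<n. exp (- \<theta> * \<tau> i \<omega>)) = (\<Prod>i<n. expectation (\<lambda>\<omega>. exp (- \<theta> * \<tau> i \<omega>)))"
    using one ind by (intro indep_vars_lebesgue_integral) (auto simp: has_bochner_integral_iff)
  moreover have "(\<Prod>i<n. exp (- \<theta> * \<tau> i \<omega>)) = exp (- \<theta> * (\<Sum>i<n. \<tau> i \<omega>))" for \<omega>
    by (simp add: exp_sum sum_distrib_left)
  ultimately show ?thesis using one by (simp add: has_bochner_integral_iff)
qed

end

text \<open>
  The law at time \<open>t\<close> of a pure birth process with rates \<open>1 + n S\<close>,
  a negative binomial distribution.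
\<close>
definition yule_pmf :: "nat \<Rightarrow> nat \<Rightarrow> real \<Rightarrow> real" where
  "yule_pmf S n t = (\<Prod>i<n. real (1 + i * S)) / (real S ^ n * fact n) * exp (- t) * (1 - exp (- real S * t)) ^ n"

lemma yule_pmf_nonneg: "0 \<le> t \<Longrightarrow> 0 \<le> yule_pmf S n t"
  unfolding yule_pmf_def by (intro mult_nonneg_nonneg divide_nonneg_nonneg prod_nonneg zero_le_power) auto

lemma yule_pmf_Suc_coeff:
  assumes "0 < S"
  shows "(\<Prod>i<Suc n. real (1 + i * S)) / (real S ^ Suc n * fact (Suc n)) * (real (Suc n) * real S) =
    real (1 + n * S) * ((\<Prod>i<n. real (1 + i * S)) / (real S ^ n * fact n))"
  using assms by (simp add: divide_simps del: of_nat_Suc)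

text \<open>
  By the forward equations
  \<open>p' n = r (n - 1) * p (n - 1) - r n * p n\<close> the derivative of a
  partial sum telescopes.
\<close>
lemma yule_pmf_deriv:
  assumes "0 < S"
  shows "((\<lambda>t. 1 - (\<Sum>k<Suc n. yule_pmf S k t)) has_real_derivative real (1 + n * S) * yule_pmf S n t) (at t)"
proof (induction n)
  case 0
  show ?case by (auto simp: yule_pmf_def intro!: derivative_eq_intros)
next
  case (Suc n)
  define C where "C k = (\<Prod>i<k. real (1 + i * S)) / (real S ^ k * fact k)" for k
  have C: "C (Suc n) * (real (Suc n) * real S) = real (1 + n * S) * C n"
    unfolding C_def by (rule yule_pmf_Suc_coeff[OF assms])
  let ?q = "1 - exp (- real S * t)"
  have "((\<lambda>t. C (Suc n) * exp (- t) * (1 - exp (- real S * t)) ^ Suc n) has_real_derivative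
     - (C (Suc n) * exp (- t) * ?q ^ Suc n) + C (Suc n) * (real (Suc n) * real S) * exp (- t) * ?q ^ n * (1 - ?q)) (at t)"
    by (rule derivative_eq_intros refl | simp add: algebra_simps)+
  then have "(yule_pmf S (Suc n) has_real_derivative real (1 + n * S) * yule_pmf S n t - real (1 + Suc n * S) * yule_pmf S (Suc n) t) (at t)"
  proof (rule has_field_derivative_cong_ev[THEN iffD1, rotated -1])
    have "- (C (Suc n) * exp (- t) * ?q ^ Suc n) + C (Suc n) * (real (Suc n) * real S) * exp (- t) * ?q ^ n * (1 - ?q)
      = C (Suc n) * (real (Suc n) * real S) * (exp (- t) * ?q ^ n) - (1 + real (Suc n) * real S) * (C (Suc n) * exp (- t) * ?q ^ Suc n)"
      by (simp add: algebra_simps)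
    also have "\<dots> = real (1 + n * S) * yule_pmf S n t - real (1 + Suc n * S) * yule_pmf S (Suc n) t"
    proof -
      have y: "yule_pmf S k t = C k * exp (- t) * ?q ^ k" for k
        by (simp add: yule_pmf_def C_def)
      show ?thesis unfolding C y by (simp add: algebra_simps)
    qed
    finally show "- (C (Suc n) * exp (- t) * ?q ^ Suc n) + C (Suc n) * (real (Suc n) * real S) * exp (- t) * ?q ^ n * (1 - ?q)
      = real (1 + n * S) * yule_pmf S n t - real (1 + Suc n * S) * yule_pmf S (Suc n) t" .
  qed (auto simp: yule_pmf_def C_def)
  from DERIV_diff[OF Suc this] show ?case by (simp add: algebra_simps)
qed

locale yule_clocks = exponential_clocks Q \<tau> "\<lambda>i. real (1 + i * S)" n
  for Q :: "'w measure" and \<tau> and S n :: nat +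
  assumes S_pos: "0 < S"
begin

text \<open>
  The jump number \<open>k + 1\<close> happens at rate \<open>r = 1 + k S\<close> out of
  state \<open>k\<close>, hence its time has density \<open>r\<close> times the probability of
  state \<open>k\<close>. In the convolution the factor \<open>exp (S y) - 1\<close> is a
  primitive of the remaining exponential, up to the factor \<open>S\<close>.
\<close>
lemma sum_clocks_density:
  "Suc k \<le> n \<Longrightarrow> distributed Q lborel (\<lambda>\<omega>. \<Sum>i<Suc k. \<tau> i \<omega>)
    (\<lambda>t. ennreal (if 0 \<le> t then real (1 + k * S) * yule_pmf S k t else 0))"
proof (induction k)
  case 0
  have "(\<lambda>t. ennreal (exponential_density (real (1 + 0 * S)) t)) =
     (\<lambda>t. ennreal (if 0 \<le> t then real (1 + 0 * S) * yule_pmf S 0 t else 0))"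
    by (auto simp: exponential_density_def yule_pmf_def fun_eq_iff)
  then show ?case using clock_exponential[of 0] 0 by simp
next
  case (Suc k)
  let ?g = "\<lambda>t. if 0 \<le> t then real (1 + k * S) * yule_pmf S k t else 0"
  let ?r = "real (1 + Suc k * S)"
  define C where "C k = (\<Prod>i<k. real (1 + i * S)) / (real S ^ k * fact k)" for k
  have C: "C (Suc k) * (real (Suc k) * real S) = real (1 + k * S) * C k"
    unfolding C_def by (rule yule_pmf_Suc_coeff[OF S_pos])
  have ind: "indep_var borel (\<tau> (Suc k)) borel (\<lambda>\<omega>. \<Sum>i<Suc k. \<tau> i \<omega>)"
  proof (rule indep_vars_sum)
    show "indep_vars (\<lambda>_. borel) \<tau> (insert (Suc k) {..<Suc k})"
      by (rule indep_vars_subset[OF clocks_indep]) (use Suc.prems in auto)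
  qed auto
  have dens: "(\<integral>\<^sup>+y. ennreal (exponential_density ?r (x - y)) * ennreal (?g y) \<partial>lborel)
     = ennreal (if 0 \<le> x then ?r * yule_pmf S (Suc k) x else 0)" for x
  proof (cases "0 \<le> x")
    case False
    then have eq: "ennreal (exponential_density ?r (x - y)) * ennreal (?g y) = 0" for y
      by (auto simp: exponential_density_def)
    show ?thesis unfolding eq using False by simp
  next
    case True
    let ?F = "\<lambda>y. ?r * exp (- ?r * x) * (C (Suc k) * (exp (real S * y) - 1) ^ Suc k)"
    let ?f = "\<lambda>y. ?r * exp (- ?r * x) * (real (1 + k * S) * C k * exp (real S * y) * (exp (real S * y) - 1) ^ k)"
    \<comment> \<open>The factor \<open>exp (?r y)\<close> of the last clock, with
      \<open>?r = 1 + (k + 1) S\<close>, turns \<open>1 - exp (- S y)\<close> into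
      \<open>exp (S y) - 1\<close> and leaves one \<open>exp (S y)\<close>.\<close>
    have exp_split: "exp (- ?r * (x - y)) * (exp (- y) * (1 - exp (- real S * y)) ^ k) =
       exp (- ?r * x) * (exp (real S * y) * (exp (real S * y) - 1) ^ k)" for y
    proof -
      have "(exp (real S * y) - 1) ^ k = (exp (real S * y) * (1 - exp (- real S * y))) ^ k"
        by (simp add: right_diff_distrib exp_minus)
      also have "\<dots> = exp (real k * (real S * y)) * (1 - exp (- real S * y)) ^ k"
        by (simp only: power_mult_distrib exp_of_nat_mult)
      finally have pw: "(exp (real S * y) - 1) ^ k = exp (real k * (real S * y)) * (1 - exp (- real S * y)) ^ k" .
      have "exp (- ?r * (x - y)) * exp (- y) = exp (- ?r * x) * exp (real S * y) * exp (real k * (real S * y))"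
        unfolding exp_add[symmetric] by (simp add: algebra_simps)
      then show ?thesis unfolding pw by (simp only: mult.assoc[symmetric])
    qed
    have "ennreal (exponential_density ?r (x - y)) * ennreal (?g y) = ennreal (?f y) * indicator {0..x} y" for y
    proof (cases "y \<in> {0..x}")
      case True
      have "?r * exp (- ?r * (x - y)) * (real (1 + k * S) * yule_pmf S k y) =
         ?r * (real (1 + k * S) * C k) * (exp (- ?r * (x - y)) * (exp (- y) * (1 - exp (- real S * y)) ^ k))"
        unfolding yule_pmf_def C_def by (simp only: mult_ac)
      also have "\<dots> = ?f y" unfolding exp_split by (simp only: mult_ac)
      finally have 1: "?r * exp (- ?r * (x - y)) * (real (1 + k * S) * yule_pmf S k y) = ?f y" .
      have 2: "exponential_density ?r (x - y) = ?r * exp (- ?r * (x - y))"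
        using True by (simp add: exponential_density_def algebra_simps)
      have 3: "?g y = real (1 + k * S) * yule_pmf S k y" using True by simp
      have "0 \<le> exponential_density ?r (x - y)"
        by (rule exponential_density_nonneg) (simp only: of_nat_0_less_iff add_gr_0 zero_less_one simp_thms)
      then have "ennreal (exponential_density ?r (x - y)) * ennreal (?g y) = ennreal (exponential_density ?r (x - y) * ?g y)"
        by (rule ennreal_mult'[symmetric])
      also have "exponential_density ?r (x - y) * ?g y = ?f y"
        unfolding 2 3 by (rule 1)
      finally show ?thesis by (simp only: indicator_simps(1)[OF True] mult_1_right)
    qed (auto simp: exponential_density_def)
    then have "(\<integral>\<^sup>+y. ennreal (exponential_density ?r (x - y)) * ennreal (?g y) \<partial>lborel) =
       (\<integral>\<^sup>+y. ennreal (?f y) * indicator {0..x} y \<partial>lborel)"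
      by simp
    also have "\<dots> = ennreal (?F x - ?F 0)"
    proof (rule nn_integral_FTC_Icc)
      fix y assume y: "y \<in> {0..x}"
      have f: "?f y = ?r * exp (- ?r * x) * (C (Suc k) * ((1 + of_nat k) * (exp (real S * y) * real S * (exp (real S * y) - 1) ^ k)))"
        unfolding C[symmetric] of_nat_Suc by (simp only: mult_ac add.commute)
      have "((\<lambda>y. exp (real S * y) - 1) has_real_derivative exp (real S * y) * real S) (at y)"
        by (auto intro!: derivative_eq_intros)
      from DERIV_power_Suc[OF this, of k]
      show "(?F has_real_derivative ?f y) (at y)"
        unfolding f by (rule DERIV_cmult[OF DERIV_cmult])
      have "0 \<le> C k" unfolding C_def by (intro divide_nonneg_nonneg prod_nonneg) auto
      moreover have "1 \<le> exp (real S * y)" using y by simp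
      ultimately show "0 \<le> ?f y" by (intro mult_nonneg_nonneg zero_le_power) auto
    qed (use True in auto)
    also have "?F x - ?F 0 = ?r * yule_pmf S (Suc k) x"
    proof -
      have "(exp (real S * x) - 1) ^ Suc k = (exp (real S * x) * (1 - exp (- real S * x))) ^ Suc k"
        by (simp add: right_diff_distrib exp_minus)
      also have "\<dots> = exp (real (Suc k) * (real S * x)) * (1 - exp (- real S * x)) ^ Suc k"
        by (simp only: power_mult_distrib exp_of_nat_mult)
      finally have "exp (- ?r * x) * (exp (real S * x) - 1) ^ Suc k =
         (exp (- ?r * x) * exp (real (Suc k) * (real S * x))) * (1 - exp (- real S * x)) ^ Suc k"
        by simp
      also have "exp (- ?r * x) * exp (real (Suc k) * (real S * x)) = exp (- x)"
        unfolding exp_add[symmetric] by (simp add: algebra_simps)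
      finally show ?thesis
        unfolding yule_pmf_def C_def[symmetric] by simp
    qed
    finally show ?thesis using True by simp
  qed
  have "distributed Q lborel (\<lambda>\<omega>. \<tau> (Suc k) \<omega> + (\<Sum>i<Suc k. \<tau> i \<omega>))
     (\<lambda>x. \<integral>\<^sup>+y. ennreal (exponential_density ?r (x - y)) * ennreal (?g y) \<partial>lborel)"
    using Suc.prems by (intro distributed_convolution ind clock_exponential Suc.IH) auto
  then show ?case unfolding dens by (simp add: add.commute)
qed

lemma sum_clocks_cdf:
  assumes "k \<le> n" "0 \<le> t"
  shows "prob {\<omega> \<in> space Q. (\<Sum>i<k. \<tau> i \<omega>) \<le> t} = 1 - (\<Sum>j<k. yule_pmf S j t)"
proof (cases k)
  case 0
  then show ?thesis using assms by (simp add: prob_space)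
next
  case (Suc j)
  let ?T = "\<lambda>\<omega>. \<Sum>i<Suc j. \<tau> i \<omega>" and ?g = "\<lambda>t. real (1 + j * S) * yule_pmf S j t"
  let ?F = "\<lambda>t. 1 - (\<Sum>k<Suc j. yule_pmf S k t)"
  have nonneg: "0 \<le> ?F t"
  proof -
    have "?F 0 \<le> ?F t"
      using assms by (intro DERIV_nonneg_imp_nondecreasing[of 0 t ?F])
        (use yule_pmf_deriv[OF S_pos] yule_pmf_nonneg in \<open>fastforce intro!: mult_nonneg_nonneg\<close>)+
    moreover have "?F 0 = 0"
      by (subst sum.lessThan_Suc_shift) (simp add: yule_pmf_def)
    ultimately show ?thesis by linarith
  qed
  have "emeasure Q (?T -` {..t} \<inter> space Q) = (\<integral>\<^sup>+x. ennreal (if 0 \<le> x then ?g x else 0) * indicator {..t} x \<partial>lborel)"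
    using distributed_emeasure[OF sum_clocks_density[of j], of "{..t}"] Suc assms by simp
  also have "\<dots> = (\<integral>\<^sup>+x. ennreal (?g x) * indicator {0..t} x \<partial>lborel)"
    by (intro nn_integral_cong) (auto split: split_indicator)
  also have "\<dots> = ennreal (?F t - ?F 0)"
  proof (rule nn_integral_FTC_Icc)
    show "?g \<in> borel_measurable borel" unfolding yule_pmf_def by measurable
  qed (use assms yule_pmf_nonneg yule_pmf_deriv[OF S_pos] in \<open>auto intro: has_field_derivative_at_within\<close>)
  also have "?F 0 = 0"
    by (subst sum.lessThan_Suc_shift) (simp add: yule_pmf_def)
  finally have "prob (?T -` {..t} \<inter> space Q) = ?F t"
    using nonneg by (simp add: measure_def)
  moreover have "?T -` {..t} \<inter> space Q = {\<omega> \<in> space Q. ?T \<omega> \<le> t}" by auto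
  ultimately show ?thesis using Suc by simp
qed

lemma prob_jump_count:
  assumes "n = Suc k" "0 \<le> t"
  shows "prob {\<omega> \<in> space Q. (\<Sum>i<k. \<tau> i \<omega>) \<le> t \<and> t < (\<Sum>i<Suc k. \<tau> i \<omega>)} = yule_pmf S k t"
proof -
  let ?A = "\<lambda>k. {\<omega> \<in> space Q. (\<Sum>i<k. \<tau> i \<omega>) \<le> t}"
  have meas: "?A j \<in> sets Q" for j using rv by measurable
  have "prob {\<omega> \<in> space Q. (\<Sum>i<k. \<tau> i \<omega>) \<le> t \<and> t < (\<Sum>i<Suc k. \<tau> i \<omega>)} = prob (?A k - ?A (Suc k))"
    by (intro arg_cong[where f = prob]) auto
  also have "\<dots> = prob (?A k) - prob (?A k \<inter> ?A (Suc k))"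
    by (rule finite_measure_Diff'[OF meas meas])
  also have "prob (?A k \<inter> ?A (Suc k)) = prob (?A (Suc k))"
  proof (rule finite_measure_eq_AE)
    show "AE \<omega> in Q. \<omega> \<in> ?A k \<inter> ?A (Suc k) \<longleftrightarrow> \<omega> \<in> ?A (Suc k)"
      using AE_clocks_pos AE_space
    proof eventually_elim
      case (elim \<omega>)
      then have "0 < \<tau> k \<omega>" using assms by simp
      then show ?case using elim by auto
    qed
  qed (rule sets.Int[OF meas meas], rule meas)
  also have "prob (?A k) - prob (?A (Suc k)) = yule_pmf S k t"
    using sum_clocks_cdf[of k t] sum_clocks_cdf[of "Suc k" t] assms by simp
  finally show ?thesis .
qed

end

section \<open>The law of the urn process\<close>

context balanced_urn
begin

text \<open>
  Paths of the jump chain are coded by the lists of drawn colours, with \<open>True\<close> for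
  a red ball.
\<close>
definition step :: "nat \<times> nat \<Rightarrow> bool \<Rightarrow> nat \<times> nat" where
  "step s red = (if red then (fst s + a, snd s + b) else (fst s + c, snd s + d))"

definition weight :: "nat \<times> nat \<Rightarrow> bool \<Rightarrow> real" where
  "weight s red = (if red then real (fst s) else real (snd s))"

fun path_weight :: "nat \<times> nat \<Rightarrow> bool list \<Rightarrow> real" where
  "path_weight s [] = 1"
| "path_weight s (red # bs) = weight s red * path_weight (step s red) bs"

definition state :: "nat \<times> nat \<Rightarrow> bool list \<Rightarrow> nat \<Rightarrow> nat \<times> nat" where
  "state s bs i = foldl step s (take i bs)"

definition paths :: "nat \<Rightarrow> bool list set" where
  "paths n = {bs. length bs = n}"

lemma finite_paths [simp]: "finite (paths n)"
  using finite_lists_length_eq[of "UNIV :: bool set" n] by (simp add: paths_def)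

lemma paths_0: "paths 0 = {[]}"
  by (auto simp: paths_def)

lemma sum_paths_Suc: "(\<Sum>bs\<in>paths (Suc n). f bs) = (\<Sum>bs\<in>paths n. f (True # bs)) + (\<Sum>bs\<in>paths n. f (False # bs))"
proof -
  have "paths (Suc n) = (#) True ` paths n \<union> (#) False ` paths n"
    unfolding paths_def by (auto simp: length_Suc_conv image_iff)
  also have "(\<Sum>bs\<in>\<dots>. f bs) = (\<Sum>bs\<in>(#) True ` paths n. f bs) + (\<Sum>bs\<in>(#) False ` paths n. f bs)"
    by (rule sum.union_disjoint) auto
  also have "\<dots> = (\<Sum>bs\<in>paths n. f (True # bs)) + (\<Sum>bs\<in>paths n. f (False # bs))"
    by (simp add: sum.reindex inj_on_def)
  finally show ?thesis .
qed

lemma state_0 [simp]: "state s bs 0 = s"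
  by (simp add: state_def)

lemma state_Cons_Suc [simp]: "state s (red # bs) (Suc i) = state (step s red) bs i"
  by (simp add: state_def)

lemma state_Suc: "i < length bs \<Longrightarrow> state s bs (Suc i) = step (state s bs i) (bs ! i)"
  by (simp add: state_def take_Suc_conv_app_nth)

lemma size_state:
  "i \<le> length bs \<Longrightarrow> fst (state s bs i) + snd (state s bs i) = fst s + snd s + i * S"
proof (induction i)
  case (Suc i)
  then show ?case using ab cd by (auto simp: state_Suc step_def)
qed simp

lemma gen_eq_path_sum:
  fixes h :: "nat \<times> nat \<Rightarrow> 'a::{real_algebra_1,comm_ring_1}"
  shows "gen n h s = (\<Sum>bs\<in>paths n. of_real (path_weight s bs) * h (state s bs n))"
proof (induction n arbitrary: s)
  case 0
  then show ?case by (simp add: paths_0)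
next
  case (Suc n)
  obtain x y where s: "s = (x, y)" by (cases s)
  show ?case
    unfolding sum_paths_Suc s gen_Suc Suc
    by (simp add: step_def weight_def sum_distrib_left mult.assoc)
qed

lemma gen_one: "gen n (\<lambda>_. 1) (x, y) = (\<Prod>i<n. real (x + y + i * S))"
proof (induction n arbitrary: x y)
  case (Suc n)
  have ab': "(x + a) + (y + b) + i * S = x + y + Suc i * S"
    and cd': "(x + c) + (y + d) + i * S = x + y + Suc i * S" for i
    using ab cd by simp_all
  show ?case
    unfolding gen_Suc Suc ab' cd' by (subst prod.lessThan_Suc_shift) (simp add: algebra_simps)
qed simp

lemma path_weight_eq_prod: "path_weight s bs = (\<Prod>i<length bs. weight (state s bs i) (bs ! i))"
proof (induction bs arbitrary: s)
  case (Cons red bs)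
  show ?case
    unfolding path_weight.simps Cons length_Cons prod.lessThan_Suc_shift by simp
qed simp

lemma path_weight_nonneg: "0 \<le> path_weight s bs"
  unfolding path_weight_eq_prod by (intro prod_nonneg) (simp add: weight_def)

text \<open>
  Summing over the last draw gives the total number of balls, which is the same for all paths.
\<close>
lemma sum_path_weight_take:
  fixes g :: "nat \<times> nat \<Rightarrow> 'a::{real_algebra_1,comm_ring_1}"
  shows "(\<Sum>bs\<in>paths (Suc k). of_real (path_weight s bs) * g (state s bs k)) =
    of_nat (fst s + snd s + k * S) * gen k g s"
proof (induction k arbitrary: s)
  case 0
  then show ?case by (simp add: sum_paths_Suc paths_0 weight_def algebra_simps)
next
  case (Suc k)
  have sz: "fst (step s red) + snd (step s red) + k * S = fst s + snd s + Suc k * S" for red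
    using ab cd by (simp add: step_def)
  have "(\<Sum>bs\<in>paths (Suc (Suc k)). of_real (path_weight s bs) * g (state s bs (Suc k))) =
     of_real (weight s True) * (\<Sum>bs\<in>paths (Suc k). of_real (path_weight (step s True) bs) * g (state (step s True) bs k)) +
     of_real (weight s False) * (\<Sum>bs\<in>paths (Suc k). of_real (path_weight (step s False) bs) * g (state (step s False) bs k))"
    by (subst sum_paths_Suc) (simp add: sum_distrib_left mult.assoc)
  also have "\<dots> = of_nat (fst s + snd s + Suc k * S) *
     (of_real (weight s True) * gen k g (step s True) + of_real (weight s False) * gen k g (step s False))"
    unfolding Suc sz by (simp only: ring_distribs mult_ac)
  also have "of_real (weight s True) * gen k g (step s True) + of_real (weight s False) * gen k g (step s False) = gen (Suc k) g s"
    by (cases s) (simp add: gen_Suc step_def weight_def)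
  finally show ?case .
qed

end

lemma (in finite_measure) measure_uniform_measure_pos:
  assumes "0 < measure M A" "B \<in> sets M"
  shows "measure (uniform_measure M A) B = measure M (A \<inter> B) / measure M A"
proof -
  have "emeasure M A \<noteq> 0" "emeasure M A \<noteq> \<infinity>"
    using assms(1) by (auto simp: emeasure_eq_measure)
  from measure_uniform_measure[OF this assms(2)] show ?thesis .
qed

lemma uniform_measure_eq_density:
  assumes "finite_measure M" "A \<in> sets M" "measure M A > 0"
  shows "uniform_measure M A = density M (\<lambda>x. ennreal (indicator A x / measure M A))"
proof -
  interpret finite_measure M by fact
  have "indicator A x / emeasure M A = ennreal (indicator A x / measure M A)" for x
    using assms(3) by (cases "x \<in> A") (simp_all add: emeasure_eq_measure divide_ennreal flip: ennreal_1)
  then show ?thesis by (simp add: uniform_measure_def)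
qed

text \<open>
  The condition \<open>a \<noteq> c\<close> makes the two kinds of jumps distinct, so that the
  chain determines the colours drawn.
\<close>
locale urn_process = balanced_urn a b c d S + prob_space M
  for a b c d S :: nat and M :: "'w measure" +
  fixes s0 :: "nat \<times> nat" and Z :: "nat \<Rightarrow> 'w \<Rightarrow> nat \<times> nat" and \<tau> :: "nat \<Rightarrow> 'w \<Rightarrow> real"
  assumes a_neq_c: "a \<noteq> c"
    and size_s0: "fst s0 + snd s0 = 1"
    and Z_measurable: "\<And>i. Z i \<in> measurable M (count_space UNIV)"
    and \<tau>_measurable: "\<And>i. \<tau> i \<in> borel_measurable M"
    and law: "\<And>n z t. (\<And>i. i < n \<Longrightarrow> 0 \<le> t i) \<Longrightarrow>
      prob {\<omega> \<in> space M. (\<forall>i\<le>n. Z i \<omega> = z i) \<and> (\<forall>i<n. t i < \<tau> i \<omega>)} =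
      (if z 0 = s0 then 1 else 0) *
      (\<Prod>i<n. urn_rate a b c d (z i) (z (Suc i)) / total_rate (urn_rate a b c d) (z i) *
         exp (- total_rate (urn_rate a b c d) (z i) * t i))"
begin

definition rates :: "nat \<Rightarrow> real" where
  "rates n = (\<Prod>i<n. real (1 + i * S))"

definition path_event :: "bool list \<Rightarrow> 'w set" where
  "path_event bs = {\<omega> \<in> space M. \<forall>i\<le>length bs. Z i \<omega> = state s0 bs i}"

definition T :: "nat \<Rightarrow> 'w \<Rightarrow> real" where
  "T n \<omega> = (\<Sum>i<n. \<tau> i \<omega>)"

lemma rates_pos: "0 < rates n"
  unfolding rates_def by (intro prod_pos) (simp add: add_pos_nonneg)

lemma Z_event [measurable]: "{\<omega> \<in> space M. Z i \<omega> = z} \<in> sets M"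
  using measurable_sets[OF Z_measurable[of i], of "{z}"] by (simp add: vimage_def Int_def conj_commute)

lemma path_event_sets [measurable]: "path_event bs \<in> sets M"
  unfolding path_event_def by measurable

lemma T_measurable [measurable]: "T n \<in> borel_measurable M"
  unfolding T_def[abs_def] using \<tau>_measurable by measurable

text \<open>
  The denominators of the transition probabilities and the parameters of the holding times are
  the same for all paths, which is the independence of the chain and the holding times.
\<close>
lemma path_law:
  assumes t: "\<And>i. i < length bs \<Longrightarrow> 0 \<le> t i"
  shows "prob (path_event bs \<inter> {\<omega> \<in> space M. \<forall>i<length bs. t i < \<tau> i \<omega>}) =
    path_weight s0 bs / rates (length bs) * (\<Prod>i<length bs. exp (- real (1 + i * S) * t i))"
proof -
  have q: "urn_rate a b c d (state s0 bs i) (state s0 bs (Suc i)) = weight (state s0 bs i) (bs ! i)"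
    if "i < length bs" for i
    using that a_neq_c by (cases "state s0 bs i") (simp add: state_Suc urn_rate_def step_def weight_def)
  have tot: "total_rate (urn_rate a b c d) (state s0 bs i) = real (1 + i * S)" if "i < length bs" for i
    using size_state[of i bs s0] that size_s0
    by (cases "state s0 bs i") (simp add: total_rate_urn_rate flip: of_nat_add)
  have "path_event bs \<inter> {\<omega> \<in> space M. \<forall>i<length bs. t i < \<tau> i \<omega>} =
     {\<omega> \<in> space M. (\<forall>i\<le>length bs. Z i \<omega> = state s0 bs i) \<and> (\<forall>i<length bs. t i < \<tau> i \<omega>)}"
    by (auto simp: path_event_def)
  then have "prob (path_event bs \<inter> {\<omega> \<in> space M. \<forall>i<length bs. t i < \<tau> i \<omega>}) =
     (\<Prod>i<length bs. weight (state s0 bs i) (bs ! i) / real (1 + i * S) * exp (- real (1 + i * S) * t i))"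
    using law[of "length bs" t "state s0 bs"] t q tot by simp
  then show ?thesis
    by (simp add: prod.distrib prod_dividef path_weight_eq_prod rates_def)
qed

lemma path_event_unique:
  assumes "\<omega> \<in> path_event bs" "\<omega> \<in> path_event bs'" "length bs = length bs'"
  shows "bs = bs'"
proof (rule nth_equalityI)
  fix i assume i: "i < length bs"
  have *: "bs ! i \<longleftrightarrow> fst (Z (Suc i) \<omega>) = fst (Z i \<omega>) + a"
    if "\<omega> \<in> path_event bs" "i < length bs" for bs
  proof -
    have "Z (Suc i) \<omega> = state s0 bs (Suc i)" "Z i \<omega> = state s0 bs i"
      using that by (auto simp: path_event_def)
    then show ?thesis
      using that a_neq_c by (simp add: state_Suc step_def)
  qed
  show "bs ! i = bs' ! i"
    using *[of bs] *[of bs'] assms i by simp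
qed fact

lemma sum_path_weights: "(\<Sum>bs\<in>paths n. path_weight s0 bs) = rates n"
  using gen_eq_path_sum[of n "\<lambda>_. 1::real" s0] gen_one[of n "fst s0" "snd s0"] size_s0
  by (simp add: rates_def)

text \<open>
  The probabilities of the disjoint events that belong to the paths with \<open>n\<close> draws
  add up to \<open>1\<close>.
\<close>
lemma AE_path: "AE \<omega> in M. (\<exists>bs\<in>paths n. \<omega> \<in> path_event bs) \<and> (\<forall>i<n. 0 < \<tau> i \<omega>)"
proof -
  let ?E = "\<lambda>bs. path_event bs \<inter> {\<omega> \<in> space M. \<forall>i<length bs. 0 < \<tau> i \<omega>}"
  have E: "?E bs \<in> sets M" for bs
    using \<tau>_measurable by measurable
  have "prob (\<Union>bs\<in>paths n. ?E bs) = (\<Sum>bs\<in>paths n. prob (?E bs))"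
  proof (rule finite_measure_finite_Union)
    show "disjoint_family_on ?E (paths n)"
      using path_event_unique by (fastforce simp: disjoint_family_on_def paths_def)
    show "?E ` paths n \<subseteq> sets M"
      using E by blast
  qed simp
  also have "\<dots> = (\<Sum>bs\<in>paths n. path_weight s0 bs / rates n)"
    using path_law[of _ "\<lambda>_. 0"] by (intro sum.cong) (auto simp: paths_def)
  also have "\<dots> = 1"
    using sum_path_weights[of n] rates_pos[of n] by (simp flip: sum_divide_distrib)
  finally have p1: "prob (\<Union>bs\<in>paths n. ?E bs) = 1" .
  have "(\<Union>bs\<in>paths n. ?E bs) \<in> sets M"
    by (rule sets.finite_UN[OF finite_paths E])
  with p1 have "AE \<omega> in M. \<omega> \<in> (\<Union>bs\<in>paths n. ?E bs)"
    by (simp only: prob_eq_1)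
  then show ?thesis
    by eventually_elim (auto simp: paths_def)
qed

lemma AE_\<tau>_pos: "AE \<omega> in M. \<forall>i. 0 < \<tau> i \<omega>"
proof -
  have "AE \<omega> in M. \<forall>n. (\<exists>bs\<in>paths n. \<omega> \<in> path_event bs) \<and> (\<forall>i<n. 0 < \<tau> i \<omega>)"
    using AE_path by (simp add: AE_all_countable)
  then show ?thesis by eventually_elim blast
qed

lemma prob_path_event: "prob (path_event bs) = path_weight s0 bs / rates (length bs)"
proof -
  have "prob (path_event bs) = prob (path_event bs \<inter> {\<omega> \<in> space M. \<forall>i<length bs. 0 < \<tau> i \<omega>})"
  proof (rule finite_measure_eq_AE)
    show "AE \<omega> in M. \<omega> \<in> path_event bs \<longleftrightarrow> \<omega> \<in> path_event bs \<inter> {\<omega> \<in> space M. \<forall>i<length bs. 0 < \<tau> i \<omega>}"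
      using AE_\<tau>_pos AE_space by eventually_elim auto
    show "path_event bs \<inter> {\<omega> \<in> space M. \<forall>i<length bs. 0 < \<tau> i \<omega>} \<in> sets M"
      using \<tau>_measurable by measurable
  qed measurable
  then show ?thesis using path_law[of bs "\<lambda>_. 0"] by simp
qed

text \<open>
  Division of \<open>path_law\<close> by the probability of the path leaves the product of the
  exponential tails.
\<close>
lemma path_clocks:
  assumes "0 < prob (path_event bs)"
  shows "yule_clocks (uniform_measure M (path_event bs)) \<tau> S (length bs)"
proof -
  let ?Q = "uniform_measure M (path_event bs)"
  interpret Q: prob_space ?Q
    using assms by (intro prob_space_uniform_measure) (auto simp: emeasure_eq_measure)
  show ?thesis
  proof unfold_locales
    show "\<tau> i \<in> borel_measurable ?Q" for i
      using \<tau>_measurable by simp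
    show "0 < real (1 + i * S)" for i by (simp add: add_pos_nonneg)
    show "0 < S" by (rule S_pos)
    fix t :: "nat \<Rightarrow> real" assume t: "\<And>i. i < length bs \<Longrightarrow> 0 \<le> t i"
    have meas: "{\<omega> \<in> space M. \<forall>i<length bs. t i < \<tau> i \<omega>} \<in> sets M"
      using \<tau>_measurable by measurable
    have "measure ?Q {\<omega> \<in> space ?Q. \<forall>i<length bs. t i < \<tau> i \<omega>} =
       prob (path_event bs \<inter> {\<omega> \<in> space M. \<forall>i<length bs. t i < \<tau> i \<omega>}) / prob (path_event bs)"
      unfolding space_uniform_measure by (rule measure_uniform_measure_pos[OF assms meas])
    also have "\<dots> = (\<Prod>i<length bs. exp (- real (1 + i * S) * t i))"
    proof -
      have "prob (path_event bs \<inter> {\<omega> \<in> space M. \<forall>i<length bs. t i < \<tau> i \<omega>}) =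
          prob (path_event bs) * (\<Prod>i<length bs. exp (- real (1 + i * S) * t i))"
        unfolding prob_path_event by (rule path_law) (rule t)
      then show ?thesis using assms by simp
    qed
    finally show "measure ?Q {\<omega> \<in> space ?Q. \<forall>i<length bs. t i < \<tau> i \<omega>} = (\<Prod>i<length bs. exp (- real (1 + i * S) * t i))" .
  qed
qed

lemma prob_path_jump_count:
  assumes "length bs = Suc k" "0 \<le> t"
  shows "prob (path_event bs \<inter> {\<omega> \<in> space M. T k \<omega> \<le> t \<and> t < T (Suc k) \<omega>}) =
    prob (path_event bs) * yule_pmf S k t"
proof (cases "prob (path_event bs) = 0")
  case True
  have "prob (path_event bs \<inter> {\<omega> \<in> space M. T k \<omega> \<le> t \<and> t < T (Suc k) \<omega>}) \<le> prob (path_event bs)"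
    by (intro finite_measure_mono) auto
  with True show ?thesis by (simp add: measure_le_0_iff)
next
  case False
  then have pos: "0 < prob (path_event bs)" by (simp add: zero_less_measure_iff)
  let ?Q = "uniform_measure M (path_event bs)"
  interpret Q: yule_clocks ?Q \<tau> S "length bs" by (rule path_clocks[OF pos])
  have meas: "{\<omega> \<in> space M. T k \<omega> \<le> t \<and> t < T (Suc k) \<omega>} \<in> sets M"
    by measurable
  have "measure ?Q {\<omega> \<in> space M. T k \<omega> \<le> t \<and> t < T (Suc k) \<omega>} =
       prob (path_event bs \<inter> {\<omega> \<in> space M. T k \<omega> \<le> t \<and> t < T (Suc k) \<omega>}) / prob (path_event bs)"
    by (rule measure_uniform_measure_pos[OF pos meas])
  then show ?thesis
    using Q.prob_jump_count[OF assms] pos by (simp add: T_def field_simps)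
qed

lemma expectation_path_laplace:
  assumes "0 \<le> \<theta>"
  shows "expectation (\<lambda>\<omega>. indicator (path_event bs) \<omega> * exp (- \<theta> * T (length bs) \<omega>)) =
    prob (path_event bs) * (\<Prod>i<length bs. real (1 + i * S) / (real (1 + i * S) + \<theta>))"
proof (cases "prob (path_event bs) = 0")
  case True
  then have "AE \<omega> in M. \<omega> \<notin> path_event bs"
    by (intro AE_not_in null_setsI) (auto simp: emeasure_eq_measure)
  then have "expectation (\<lambda>\<omega>. indicator (path_event bs) \<omega> * exp (- \<theta> * T (length bs) \<omega>)) = expectation (\<lambda>_. 0)"
    by (intro integral_cong_AE) auto
  with True show ?thesis by simp
next
  case False
  then have pos: "0 < prob (path_event bs)" by (simp add: zero_less_measure_iff)
  let ?Q = "uniform_measure M (path_event bs)"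
  interpret Q: yule_clocks ?Q \<tau> S "length bs" by (rule path_clocks[OF pos])
  have "Q.expectation (\<lambda>\<omega>. exp (- \<theta> * T (length bs) \<omega>)) =
     expectation (\<lambda>\<omega>. (indicator (path_event bs) \<omega> / prob (path_event bs)) *\<^sub>R exp (- \<theta> * T (length bs) \<omega>))"
    unfolding uniform_measure_eq_density[OF finite_measure_axioms path_event_sets pos]
    by (rule integral_density) (auto simp: measure_nonneg)
  also have "\<dots> = expectation (\<lambda>\<omega>. indicator (path_event bs) \<omega> * exp (- \<theta> * T (length bs) \<omega>)) / prob (path_event bs)"
    by (simp flip: integral_divide_zero)
  finally show ?thesis
    using Q.laplace_sum_clocks[OF assms] pos by (simp add: T_def field_simps)
qed

lemma AE_sum_path_indicator: "AE \<omega> in M. \<exists>bs\<in>paths n. \<omega> \<in> path_event bs \<and>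
   (\<forall>g::bool list \<Rightarrow> complex. (\<Sum>bs\<in>paths n. g bs * indicator (path_event bs) \<omega>) = g bs)"
  using AE_path[of n]
proof eventually_elim
  case (elim \<omega>)
  then obtain bs where bs: "bs \<in> paths n" "\<omega> \<in> path_event bs" by blast
  have "(\<Sum>bs\<in>paths n. g bs * indicator (path_event bs) \<omega>) = g bs" for g :: "bool list \<Rightarrow> complex"
  proof -
    have "(\<Sum>bs\<in>paths n. g bs * indicator (path_event bs) \<omega>) = (\<Sum>bs'\<in>paths n. if bs' = bs then g bs else 0)"
    proof (intro sum.cong refl)
      fix bs' assume "bs' \<in> paths n"
      then have "\<omega> \<in> path_event bs' \<longleftrightarrow> bs' = bs"
        using path_event_unique[of \<omega> bs' bs] bs by (auto simp: paths_def)
      then show "g bs' * indicator (path_event bs') \<omega> = (if bs' = bs then g bs else 0)"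
        by (cases "bs' = bs") (use bs in auto)
    qed
    then show ?thesis using bs by simp
  qed
  then show ?case using bs by blast
qed

text \<open>
  Decomposition over the paths with \<open>k + 1\<close> draws: the event involves the holding
  time in the state number \<open>k\<close>, whose law is known only given the next state as
  well.
\<close>
lemma expectation_jump_count:
  fixes h :: "nat \<times> nat \<Rightarrow> complex"
  assumes "0 \<le> t"
  shows "integrable M (\<lambda>\<omega>. h (Z k \<omega>) * indicator {\<omega> \<in> space M. T k \<omega> \<le> t \<and> t < T (Suc k) \<omega>} \<omega>)" (is ?I)
    and "expectation (\<lambda>\<omega>. h (Z k \<omega>) * indicator {\<omega> \<in> space M. T k \<omega> \<le> t \<and> t < T (Suc k) \<omega>} \<omega>) =
      gen k h s0 / of_real (rates k) * of_real (yule_pmf S k t)" (is ?E)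
proof -
  let ?B = "{\<omega> \<in> space M. T k \<omega> \<le> t \<and> t < T (Suc k) \<omega>}"
  have B: "?B \<in> sets M" by measurable
  let ?f = "\<lambda>\<omega>. \<Sum>bs\<in>paths (Suc k). h (state s0 bs k) * indicator (path_event bs \<inter> ?B) \<omega>"
  have eq: "AE \<omega> in M. ?f \<omega> = h (Z k \<omega>) * indicator ?B \<omega>"
    using AE_sum_path_indicator[of "Suc k"]
  proof eventually_elim
    case (elim \<omega>)
    then obtain bs where bs: "bs \<in> paths (Suc k)" "\<omega> \<in> path_event bs"
      and g: "\<forall>g::bool list \<Rightarrow> complex. (\<Sum>bs\<in>paths (Suc k). g bs * indicator (path_event bs) \<omega>) = g bs"
      by blast
    have "?f \<omega> = (\<Sum>bs\<in>paths (Suc k). h (state s0 bs k) * indicator (path_event bs) \<omega>) * indicator ?B \<omega>"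
      by (simp only: sum_distrib_right indicator_inter_arith mult.assoc)
    moreover have "Z k \<omega> = state s0 bs k"
      using bs by (simp add: path_event_def paths_def)
    ultimately show ?case using g[rule_format, of "\<lambda>bs. h (state s0 bs k)"] by simp
  qed
  have int: "integrable M (\<lambda>\<omega>. h (state s0 bs k) * indicator (path_event bs \<inter> ?B) \<omega>)" for bs
  proof (rule integrable_const_bound[where B = "norm (h (state s0 bs k))"])
    show "(\<lambda>\<omega>. h (state s0 bs k) * indicator (path_event bs \<inter> ?B) \<omega>) \<in> borel_measurable M"
      using B by measurable
  qed (auto simp: indicator_def)
  have hm: "(\<lambda>\<omega>. h (Z k \<omega>) * indicator ?B \<omega>) \<in> borel_measurable M"
    using B measurable_compose[OF Z_measurable, of h borel] by measurable
  have intf: "integrable M ?f" by (intro Bochner_Integration.integrable_sum int)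
  show ?I
    using intf hm eq by (rule integrable_cong_AE_imp)
  have "expectation (\<lambda>\<omega>. h (Z k \<omega>) * indicator ?B \<omega>) = expectation ?f"
    using eq hm intf by (intro integral_cong_AE) (auto elim: eventually_mono)
  also have "\<dots> = (\<Sum>bs\<in>paths (Suc k). h (state s0 bs k) * of_real (prob (path_event bs \<inter> ?B)))"
  proof (subst Bochner_Integration.integral_sum)
    have "expectation (\<lambda>\<omega>. indicator (path_event bs \<inter> ?B) \<omega> :: complex) = of_real (prob (path_event bs \<inter> ?B))" for bs
    proof -
      have "expectation (\<lambda>\<omega>. indicator (path_event bs \<inter> ?B) \<omega> :: complex) =
         expectation (\<lambda>\<omega>. complex_of_real (indicator (path_event bs \<inter> ?B) \<omega>))"
        by (intro Bochner_Integration.integral_cong) (auto simp: indicator_def)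
      then show ?thesis using B by (simp add: sets.Int_space_eq2)
    qed
    then show "(\<Sum>bs\<in>paths (Suc k). expectation (\<lambda>\<omega>. h (state s0 bs k) * indicator (path_event bs \<inter> ?B) \<omega>)) =
      (\<Sum>bs\<in>paths (Suc k). h (state s0 bs k) * of_real (prob (path_event bs \<inter> ?B)))"
      by simp
  qed (rule int)
  also have "\<dots> = (\<Sum>bs\<in>paths (Suc k). of_real (path_weight s0 bs) * h (state s0 bs k)) / of_real (rates (Suc k)) * of_real (yule_pmf S k t)"
    unfolding sum_distrib_right sum_divide_distrib
    using prob_path_jump_count[OF _ assms] by (intro sum.cong) (auto simp: paths_def prob_path_event)
  also have "\<dots> = gen k h s0 / of_real (rates k) * of_real (yule_pmf S k t)"
  proof -
    have r: "rates (Suc k) = real (1 + k * S) * rates k"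
      by (simp add: rates_def)
    have "of_nat (fst s0 + snd s0 + k * S) = (of_real (real (1 + k * S)) :: complex)"
      using size_s0 by simp
    moreover have "of_real (real (1 + k * S)) \<noteq> (0::complex)"
      by (metis of_nat_0_less_iff of_real_eq_0_iff order_less_irrefl zero_less_Suc plus_1_eq_Suc)
    ultimately show ?thesis unfolding sum_path_weight_take r by (simp del: of_nat_add of_nat_mult of_real_of_nat_eq)
  qed
  finally show ?E .
qed

text \<open>
  Exponential functions of jump times are products over the holding times, so that discounted
  functions of the chain have explicit means.
\<close>
lemma expectation_laplace:
  fixes f :: "nat \<times> nat \<Rightarrow> real"
  assumes "0 \<le> \<theta>"
  shows "integrable M (\<lambda>\<omega>. f (Z n \<omega>) * exp (- \<theta> * T n \<omega>))" (is ?I)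
    and "expectation (\<lambda>\<omega>. f (Z n \<omega>) * exp (- \<theta> * T n \<omega>)) =
      gen n f s0 / (\<Prod>i<n. real (1 + i * S) + \<theta>)" (is ?E)
proof -
  let ?f = "\<lambda>\<omega>. \<Sum>bs\<in>paths n. f (state s0 bs n) * (indicator (path_event bs) \<omega> * exp (- \<theta> * T n \<omega>))"
  have eq: "AE \<omega> in M. ?f \<omega> = f (Z n \<omega>) * exp (- \<theta> * T n \<omega>)"
    using AE_sum_path_indicator[of n]
  proof eventually_elim
    case (elim \<omega>)
    then obtain bs where bs: "bs \<in> paths n" "\<omega> \<in> path_event bs"
      and g: "\<forall>g::bool list \<Rightarrow> complex. (\<Sum>bs\<in>paths n. g bs * indicator (path_event bs) \<omega>) = g bs"
      by blast
    have ind: "(indicator A \<omega> :: complex) = of_real (indicator A \<omega>)" for A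
      by (simp add: indicator_def)
    have s: "(\<Sum>bs\<in>paths n. f (state s0 bs n) * indicator (path_event bs) \<omega>) = f (state s0 bs n)"
      using g[rule_format, of "\<lambda>bs. of_real (f (state s0 bs n))"] unfolding ind of_real_mult[symmetric] of_real_sum[symmetric] of_real_eq_iff .
    have "?f \<omega> = (\<Sum>bs\<in>paths n. f (state s0 bs n) * indicator (path_event bs) \<omega>) * exp (- \<theta> * T n \<omega>)"
      by (simp only: sum_distrib_right mult.assoc)
    moreover have "Z n \<omega> = state s0 bs n"
      using bs by (simp add: path_event_def paths_def)
    ultimately show ?case using s by simp
  qed
  have int: "integrable M (\<lambda>\<omega>. f (state s0 bs n) * (indicator (path_event bs) \<omega> * exp (- \<theta> * T n \<omega>)))" for bs
  proof (intro integrable_mult_right integrable_const_bound[where B = 1])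
    show "AE \<omega> in M. norm (indicator (path_event bs) \<omega> * exp (- \<theta> * T n \<omega>)) \<le> 1"
      using AE_\<tau>_pos
    proof eventually_elim
      case (elim \<omega>)
      then have "0 \<le> T n \<omega>" unfolding T_def by (intro sum_nonneg) (simp add: less_imp_le)
      then show ?case using assms by (simp add: indicator_def)
    qed
  qed measurable
  have hm: "(\<lambda>\<omega>. f (Z n \<omega>) * exp (- \<theta> * T n \<omega>)) \<in> borel_measurable M"
    using measurable_compose[OF Z_measurable, of f borel] by measurable
  have intf: "integrable M ?f" by (intro Bochner_Integration.integrable_sum int)
  show ?I
    using intf hm eq by (rule integrable_cong_AE_imp)
  have "expectation (\<lambda>\<omega>. f (Z n \<omega>) * exp (- \<theta> * T n \<omega>)) = expectation ?f"
    using eq hm intf by (intro integral_cong_AE) (auto elim: eventually_mono)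
  also have "\<dots> = (\<Sum>bs\<in>paths n. f (state s0 bs n) * expectation (\<lambda>\<omega>. indicator (path_event bs) \<omega> * exp (- \<theta> * T n \<omega>)))"
    by (subst Bochner_Integration.integral_sum) (use int in simp_all)
  also have "\<dots> = (\<Sum>bs\<in>paths n. path_weight s0 bs * f (state s0 bs n)) / (\<Prod>i<n. real (1 + i * S) + \<theta>)"
    unfolding sum_divide_distrib
  proof (intro sum.cong refl)
    fix bs assume "bs \<in> paths n"
    then have n: "length bs = n" by (simp add: paths_def)
    have "(\<Prod>i<n. real (1 + i * S) / (real (1 + i * S) + \<theta>)) = rates n / (\<Prod>i<n. real (1 + i * S) + \<theta>)"
      by (simp only: prod_dividef rates_def)
    then show "f (state s0 bs n) * expectation (\<lambda>\<omega>. indicator (path_event bs) \<omega> * exp (- \<theta> * T n \<omega>)) =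
        path_weight s0 bs * f (state s0 bs n) / (\<Prod>i<n. real (1 + i * S) + \<theta>)"
      using expectation_path_laplace[OF assms, of bs] rates_pos[of n] unfolding n prob_path_event by simp
  qed
  also have "\<dots> = gen n f s0 / (\<Prod>i<n. real (1 + i * S) + \<theta>)"
    using gen_eq_path_sum[of n f s0] by simp
  finally show ?E .
qed

end

section \<open>Means at fixed times and discounted means at jump times\<close>

lemma filterlim_at_top_of_incseq_unbounded:
  fixes X :: "nat \<Rightarrow> real"
  assumes "incseq X" "\<And>K::nat. \<exists>n. real K < X n"
  shows "filterlim X at_top sequentially"
  unfolding filterlim_at_top
proof
  fix B
  obtain K where "B \<le> real K" using real_arch_simple by blast
  moreover obtain n where "real K < X n" using assms(2) by blast
  ultimately have "B \<le> X k" if "n \<le> k" for k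
    using incseqD[OF assms(1) that] by linarith
  then show "\<forall>\<^sub>F k in sequentially. B \<le> X k"
    by (auto simp: eventually_sequentially)
qed

context urn_process
begin

text \<open>
  For the discount rate \<open>S\<close> the product of the factors
  \<open>r i / (r i + S)\<close> telescopes, since \<open>r i + S\<close> is the next
  rate.
\<close>
lemma expectation_discounted_T: "expectation (\<lambda>\<omega>. exp (- real S * T n \<omega>)) = 1 / real (1 + n * S)"
proof -
  have "(\<Prod>i<n. real (1 + i * S) + real S) * 1 = rates (Suc n)"
    unfolding rates_def prod.lessThan_Suc_shift by (simp add: add_ac)
  also have "\<dots> = rates n * real (1 + n * S)"
    by (simp add: rates_def)
  finally have "(\<Prod>i<n. real (1 + i * S) + real S) = rates n * real (1 + n * S)"
    by simp
  moreover have "gen n (\<lambda>_. 1) s0 = rates n"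
    using gen_one[of n "fst s0" "snd s0"] size_s0 by (simp add: rates_def)
  ultimately show ?thesis
    using expectation_laplace(2)[of "real S" "\<lambda>_. 1" n] rates_pos[of n] by simp
qed

text \<open>
  Non-explosion, by Markov's inequality for the discounted jump times.
\<close>
lemma AE_T_unbounded: "AE \<omega> in M. \<forall>K::nat. \<exists>n. real K < T n \<omega>"
proof (subst AE_all_countable, intro allI)
  fix K :: nat
  let ?A = "{\<omega> \<in> space M. \<forall>n. T n \<omega> \<le> real K}"
  have A: "?A \<in> sets M" by measurable
  have le: "prob ?A * exp (- real S * real K) \<le> 1 / real (1 + n * S)" for n
  proof -
    have "prob ?A * exp (- real S * real K) = expectation (\<lambda>\<omega>. exp (- real S * real K) * indicator ?A \<omega>)"
      using A by simp
    also have "\<dots> \<le> expectation (\<lambda>\<omega>. exp (- real S * T n \<omega>))"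
    proof (rule integral_mono)
      show "integrable M (\<lambda>\<omega>. exp (- real S * real K) * indicator ?A \<omega>)"
        using A by (intro integrable_mult_right integrable_real_indicator) (auto simp: emeasure_eq_measure)
      show "integrable M (\<lambda>\<omega>. exp (- real S * T n \<omega>))"
        using expectation_laplace(1)[of "real S" "\<lambda>_. 1" n] by simp
    qed (auto simp: indicator_def mult_left_mono)
    finally show ?thesis unfolding expectation_discounted_T .
  qed
  have "(\<lambda>n. 1 / real (1 + n * S)) \<longlonglongrightarrow> 0"
    using S_pos by real_asymp
  then have "prob ?A * exp (- real S * real K) \<le> 0"
    by (rule LIMSEQ_le_const) (use le in auto)
  then have "prob ?A = 0"
    by (simp add: mult_le_0_iff measure_le_0_iff)
  then have "AE \<omega> in M. \<omega> \<notin> ?A"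
    using A by (intro AE_not_in null_setsI) (auto simp: emeasure_eq_measure)
  then show "AE \<omega> in M. \<exists>n. real K < T n \<omega>"
    using AE_space by eventually_elim (auto simp: not_le)
qed

lemma T_0 [simp]: "T 0 \<omega> = 0"
  by (simp add: T_def)

lemma T_Suc: "T (Suc n) \<omega> = T n \<omega> + \<tau> n \<omega>"
  by (simp add: T_def)

lemma AE_T: "AE \<omega> in M. strict_mono (\<lambda>n. T n \<omega>) \<and> filterlim (\<lambda>n. T n \<omega>) at_top sequentially"
  using AE_\<tau>_pos AE_T_unbounded
proof eventually_elim
  case (elim \<omega>)
  then have "strict_mono (\<lambda>n. T n \<omega>)"
    by (simp add: strict_mono_Suc_iff T_Suc)
  moreover from this have "incseq (\<lambda>n. T n \<omega>)"
    by (rule strict_mono_mono)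
  ultimately show ?case
    using elim by (auto intro: filterlim_at_top_of_incseq_unbounded)
qed

end

locale urn_jump_process = urn_process +
  fixes U :: "real \<Rightarrow> 'a \<Rightarrow> nat \<times> nat"
  assumes U_measurable: "\<And>t. 0 \<le> t \<Longrightarrow> U t \<in> measurable M (count_space UNIV)"
    and U_eq: "AE \<omega> in M. \<forall>n t. T n \<omega> \<le> t \<and> t < T (Suc n) \<omega> \<longrightarrow> U t \<omega> = Z n \<omega>"
begin

text \<open>
  By non-explosion exactly one of the events that there are \<open>n\<close> jumps up to time
  \<open>t\<close> occurs almost surely, and on it \<open>U t = Z n\<close>; the sum over
  \<open>n\<close> is the exponential generating function at the changed time.
\<close>
lemma expectation_U:
  fixes h :: "nat \<times> nat \<Rightarrow> complex"
  assumes h: "\<And>s. norm (h s) \<le> 1" and t: "0 \<le> t"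
  shows "expectation (\<lambda>\<omega>. h (U t \<omega>)) = urn_mean h s0 t"
proof -
  let ?B = "\<lambda>n. {\<omega> \<in> space M. T n \<omega> \<le> t \<and> t < T (Suc n) \<omega>}"
  let ?g = "\<lambda>n \<omega>. h (Z n \<omega>) * indicator (?B n) \<omega>"
  have gm: "?g n \<in> borel_measurable M" for n
    using expectation_jump_count(1)[OF t, of h n] by (rule borel_measurable_integrable)
  have hU: "(\<lambda>\<omega>. h (U t \<omega>)) \<in> borel_measurable M"
    using measurable_compose[OF U_measurable[OF t], of h borel] by simp
  have AE_sum: "AE \<omega> in M. \<exists>k. \<forall>N. (\<Sum>n<N. ?g n \<omega>) = (if k < N then h (U t \<omega>) else 0)"
    using AE_T U_eq AE_space
  proof eventually_elim
    case (elim \<omega>)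
    then have mono: "strict_mono (\<lambda>n. T n \<omega>)" and lim: "filterlim (\<lambda>n. T n \<omega>) at_top sequentially"
      by auto
    have "\<exists>n. t < T n \<omega>"
      using lim by (auto simp: filterlim_at_top_dense eventually_sequentially)
    \<comment> \<open>The least index is positive because \<open>T 0 = 0\<close>, and its
      predecessor is the number of jumps up to time \<open>t\<close>.\<close>
    define k where "k = (LEAST n. t < T n \<omega>) - 1"
    have L: "t < T (LEAST n. t < T n \<omega>) \<omega>"
      using \<open>\<exists>n. t < T n \<omega>\<close> by (rule LeastI_ex)
    moreover from this have L0: "(LEAST n. t < T n \<omega>) \<noteq> 0"
      using t by (metis T_0 not_le)
    ultimately have k2: "t < T (Suc k) \<omega>" by (simp add: k_def)
    have k1: "T k \<omega> \<le> t"
      using not_less_Least[of k "\<lambda>n. t < T n \<omega>"] L0 by (simp add: k_def)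
    have other: "n = k" if "T n \<omega> \<le> t" "t < T (Suc n) \<omega>" for n
    proof (rule ccontr)
      assume "n \<noteq> k"
      then consider "Suc n \<le> k" | "Suc k \<le> n" by linarith
      then show False
      proof cases
        case 1
        then have "T (Suc n) \<omega> \<le> T k \<omega>" by (rule monoD[OF strict_mono_mono[OF mono]])
        then show False using that k1 by linarith
      next
        case 2
        then have "T (Suc k) \<omega> \<le> T n \<omega>" by (rule monoD[OF strict_mono_mono[OF mono]])
        then show False using that k2 by linarith
      qed
    qed
    have Uk: "U t \<omega> = Z k \<omega>" using elim k1 k2 by blast
    have "?g n \<omega> = (if n = k then h (U t \<omega>) else 0)" for n
    proof (cases "n = k")
      case True
      then show ?thesis using k1 k2 elim(3) Uk by simp
    next
      case False
      then have "\<not> (T n \<omega> \<le> t \<and> t < T (Suc n) \<omega>)" using other[of n] by blast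
      then show ?thesis using False by simp
    qed
    then show ?case by (intro exI[of _ k]) simp
  qed
  have "(\<lambda>N. expectation (\<lambda>\<omega>. \<Sum>n<N. ?g n \<omega>)) \<longlonglongrightarrow> expectation (\<lambda>\<omega>. h (U t \<omega>))"
  proof (rule integral_dominated_convergence[where w = "\<lambda>_. 1"])
    show "AE \<omega> in M. (\<lambda>N. \<Sum>n<N. ?g n \<omega>) \<longlonglongrightarrow> h (U t \<omega>)"
      using AE_sum
    proof eventually_elim
      case (elim \<omega>)
      then obtain k where k: "\<And>N. (\<Sum>n<N. ?g n \<omega>) = (if k < N then h (U t \<omega>) else 0)" by blast
      have "\<forall>\<^sub>F N in sequentially. (\<Sum>n<N. ?g n \<omega>) = h (U t \<omega>)"
        unfolding k using eventually_gt_at_top[of k] by eventually_elim simp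
      then show ?case by (rule tendsto_eventually)
    qed
    show "AE \<omega> in M. norm (\<Sum>n<N. ?g n \<omega>) \<le> 1" for N
      using AE_sum
    proof eventually_elim
      case (elim \<omega>)
      then obtain k where k: "\<And>N. (\<Sum>n<N. ?g n \<omega>) = (if k < N then h (U t \<omega>) else 0)" by blast
      show ?case unfolding k using h by simp
    qed
    show "(\<lambda>\<omega>. \<Sum>n<N. ?g n \<omega>) \<in> borel_measurable M" for N
      using gm by (rule borel_measurable_sum)
  qed (use hU in auto)
  moreover have "expectation (\<lambda>\<omega>. \<Sum>n<N. ?g n \<omega>) = (\<Sum>n<N. gen n h s0 / of_real (rates n) * of_real (yule_pmf S n t))" for N
    by (subst Bochner_Integration.integral_sum) (simp_all add: expectation_jump_count[OF t])
  ultimately have sums1: "(\<lambda>n. gen n h s0 / of_real (rates n) * of_real (yule_pmf S n t)) sums expectation (\<lambda>\<omega>. h (U t \<omega>))"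
    by (simp add: sums_def)
  let ?u = "of_real ((1 - exp (- real S * t)) / real S) :: complex"
  have summand: "gen n h s0 / of_real (rates n) * of_real (yule_pmf S n t) = of_real (exp (- t)) * (gen n h s0 / fact n * ?u ^ n)" for n
  proof -
    have "of_real (yule_pmf S n t) = of_real (rates n) * of_real (exp (- t)) * ?u ^ n / fact n"
      unfolding yule_pmf_def rates_def[symmetric] by (simp add: power_divide)
    then show ?thesis using rates_pos[of n] by simp
  qed
  have "summable (\<lambda>n. gen n h s0 / fact n * ?u ^ n)"
    using summable_norm_cancel[OF summable_norm_egf[of h, OF h urn_time_less[OF t], of "fst s0" "snd s0"]] by simp
  then have "(\<lambda>n. of_real (exp (- t)) * (gen n h s0 / fact n * ?u ^ n)) sums (of_real (exp (- t)) * egf h s0 ?u)"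
    unfolding egf_def by (intro sums_mult summable_sums)
  with sums1 have "expectation (\<lambda>\<omega>. h (U t \<omega>)) = of_real (exp (- t)) * egf h s0 ?u"
    unfolding summand by (rule sums_unique2)
  then show ?thesis
    using size_s0 by (cases s0) (simp add: urn_mean_def flip: of_nat_add)
qed

end

text \<open>
  The second eigenvalue \<open>m\<close> of the replacement matrix exceeds half the first
  eigenvalue \<open>S\<close>.
\<close>
locale large_urn = balanced_urn +
  fixes m :: nat
  assumes a_eq: "a = c + m" and d_eq: "d = m + b" and S_lt: "S < 2 * m" and m_lt: "m < S"
begin

lemma u2_add: "u2 S b c (x + x', y + y') = u2 S b c (x, y) + u2 S b c (x', y')"
  by (simp add: u2_def add_divide_distrib[symmetric] algebra_simps)

text \<open>
  A character of the additive monoid of states.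
\<close>
definition wave :: "real \<Rightarrow> nat \<times> nat \<Rightarrow> complex" where
  "wave x s = iexp (x * u2 S b c s)"

text \<open>
  The linear form \<open>u2\<close> is an eigenvector of the replacement matrix for the
  eigenvalue \<open>m\<close>.
\<close>
lemma urn_gen_u2: "urn_gen a b c d (u2 S b c) (x, y) = (real (x + y) + real m) * u2 S b c (x, y)"
  using S_pos by (simp add: urn_gen_def u2_def a_eq d_eq field_simps)

lemma gen_Suc': "gen (Suc n) h s = gen n (urn_gen a b c d h) s"
  by (simp only: gen_def funpow_Suc_right comp_apply)

text \<open>
  After \<open>n\<close> draws the number of balls is known, so functions of it can be taken out
  of the mean.
\<close>
lemma gen_size:
  fixes \<rho> :: "nat \<Rightarrow> real"
  shows "gen n (\<lambda>s. \<rho> (fst s + snd s) * h s) (x, y) = \<rho> (x + y + n * S) * gen n h (x, y)"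
proof (induction n arbitrary: x y)
  case (Suc n)
  have "(x + a) + (y + b) + n * S = x + y + Suc n * S" "(x + c) + (y + d) + n * S = x + y + Suc n * S"
    using ab cd by simp_all
  then show ?case unfolding gen_Suc Suc by (simp only: ring_distribs mult_ac)
qed simp

lemma gen_u2: "gen n (u2 S b c) (x, y) = (\<Prod>i<n. real (x + y + i * S) + real m) * u2 S b c (x, y)"
proof (induction n)
  case (Suc n)
  have "gen (Suc n) (u2 S b c) (x, y) = gen n (\<lambda>s. (real (fst s + snd s) + real m) * u2 S b c s) (x, y)"
    unfolding gen_Suc' by (rule arg_cong[where f = "\<lambda>h. gen n h (x, y)"]) (auto simp: fun_eq_iff urn_gen_u2)
  also have "\<dots> = (real (x + y + n * S) + real m) * gen n (u2 S b c) (x, y)"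
    by (rule gen_size)
  finally show ?case unfolding Suc by simp
qed simp

lemma gen_mono:
  fixes f g :: "nat \<times> nat \<Rightarrow> real"
  assumes "\<And>s. f s \<le> g s"
  shows "gen n f s \<le> gen n g s"
  unfolding gen_eq_path_sum using assms path_weight_nonneg by (intro sum_mono mult_left_mono) auto

lemma gen_add: "gen n (\<lambda>s. f s + g s) s = gen n f s + gen n (g :: nat \<times> nat \<Rightarrow> real) s"
  unfolding gen_eq_path_sum by (simp add: ring_distribs sum.distrib)

text \<open>
  The jumps of \<open>u2\<close> have mean \<open>m * u2 / (x + y)\<close> and size at
  most \<open>m\<close>.
\<close>
lemma urn_gen_u2_square:
  "urn_gen a b c d (\<lambda>s. (u2 S b c s)\<^sup>2) (x, y) \<le> (real (x + y) + 2 * real m) * (u2 S b c (x, y))\<^sup>2 + real (x + y) * (real m)\<^sup>2"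
proof -
  define v where "v = u2 S b c (x, y)"
  have ab1: "u2 S b c (x + a, y + b) = v + u2 S b c (a, b)" "u2 S b c (x + c, y + d) = v + u2 S b c (c, d)"
    by (simp_all add: v_def u2_add)
  have j: "u2 S b c (a, b) = real m * (real b / real S)" "u2 S b c (c, d) = - (real m * (real c / real S))"
    by (simp_all add: u2_def a_eq d_eq algebra_simps)
  have "b \<le> S" "c \<le> S" using ab cd by auto
  then have bS: "real b / real S \<le> 1" and cS: "real c / real S \<le> 1"
    using S_pos by (simp_all add: divide_le_eq_1)
  have jb: "(u2 S b c (a, b))\<^sup>2 \<le> (real m)\<^sup>2" "(u2 S b c (c, d))\<^sup>2 \<le> (real m)\<^sup>2"
    unfolding j power2_minus
    by (rule power_mono[OF mult_left_le[OF bS]] power_mono[OF mult_left_le[OF cS]]; simp)+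
  have lin: "real x * u2 S b c (a, b) + real y * u2 S b c (c, d) = real m * v"
    unfolding j unfolding v_def u2_def split using S_pos by (simp add: field_simps)
  have "urn_gen a b c d (\<lambda>s. (u2 S b c s)\<^sup>2) (x, y) =
     real (x + y) * v\<^sup>2 + 2 * v * (real x * u2 S b c (a, b) + real y * u2 S b c (c, d))
     + (real x * (u2 S b c (a, b))\<^sup>2 + real y * (u2 S b c (c, d))\<^sup>2)"
    unfolding urn_gen_def split ab1 by (simp add: power2_sum algebra_simps)
  also have "\<dots> \<le> real (x + y) * v\<^sup>2 + 2 * v * (real m * v) + (real x * (real m)\<^sup>2 + real y * (real m)\<^sup>2)"
    unfolding lin using jb by (intro add_mono mult_left_mono order_refl) auto
  also have "\<dots> = (real (x + y) + 2 * real m) * v\<^sup>2 + real (x + y) * (real m)\<^sup>2"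
    by (simp add: algebra_simps power2_eq_square)
  finally show ?thesis by (simp add: v_def)
qed

text \<open>
  The second moments of the discounted chain at jump times. The increment at step
  \<open>n\<close> is at most \<open>m\<^sup>2 * P (n + 1)\<close>, where
  \<open>P n\<close> is the product of the first \<open>n\<close> factors
  \<open>r i / (r i + 2 m)\<close>. The identity
  \<open>r n * P n - r (n + 1) * P (n + 1) = (2 m - S) * P (n + 1)\<close>
  and \<open>2 m - S \<ge> 1\<close> make these increments telescope.
\<close>
lemma gen_u2_square_bounded:
  assumes "x + y = 1"
  shows "gen n (\<lambda>s. (u2 S b c s)\<^sup>2) (x, y) / (\<Prod>i<n. real (1 + i * S) + 2 * real m) \<le> (u2 S b c (x, y))\<^sup>2 + (real m)\<^sup>2"
proof -
  define r where "r i = real (1 + i * S)" for i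
  define P where "P n = (\<Prod>i<n. r i / (r i + 2 * real m))" for n
  define D where "D n = (\<Prod>i<n. r i + 2 * real m)" for n
  have r_pos: "0 < r i" for i by (simp add: r_def add_pos_nonneg)
  have rm: "0 < r i + 2 * real m" for i using r_pos[of i] by (simp add: add_pos_nonneg)
  have D_pos: "0 < D n" for n unfolding D_def using rm by (intro prod_pos) auto
  have P_Suc: "P (Suc n) * (r n + 2 * real m) = r n * P n" for n
    using rm[of n] by (simp add: P_def)
  have P_pos: "0 < P n" for n unfolding P_def using rm r_pos by (intro prod_pos) auto
  have tele: "P (Suc n) \<le> r n * P n - r (Suc n) * P (Suc n)" for n
  proof -
    have "r n * P n - r (Suc n) * P (Suc n) = (2 * real m - real S) * P (Suc n)"
    proof -
      have "r n * P n - r (Suc n) * P (Suc n) = P (Suc n) * (r n + 2 * real m) - r (Suc n) * P (Suc n)"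
        by (simp only: P_Suc)
      then show ?thesis by (simp add: r_def algebra_simps)
    qed
    moreover have "1 \<le> 2 * real m - real S" using S_lt by linarith
    ultimately show ?thesis using P_pos[of "Suc n"] by (simp add: mult_le_cancel_right1)
  qed
  let ?W = "\<lambda>n. gen n (\<lambda>s. (u2 S b c s)\<^sup>2) (x, y)"
  have W: "?W n / D n \<le> (u2 S b c (x, y))\<^sup>2 + (real m)\<^sup>2 * (1 - r n * P n)" for n
  proof (induction n)
    case 0
    show ?case by (simp add: D_def P_def r_def)
  next
    case (Suc n)
    have "?W (Suc n) \<le> gen n (\<lambda>s. (real (fst s + snd s) + 2 * real m) * (u2 S b c s)\<^sup>2 + (real (fst s + snd s) * (real m)\<^sup>2) * 1) (x, y)"
      unfolding gen_Suc' by (rule gen_mono) (use urn_gen_u2_square in \<open>auto split: prod.splits\<close>)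
    also have "\<dots> = (real (x + y + n * S) + 2 * real m) * ?W n + (real (x + y + n * S) * (real m)\<^sup>2) * gen n (\<lambda>_. 1) (x, y)"
      unfolding gen_add gen_size[of n "\<lambda>k. real k + 2 * real m"] gen_size[of n "\<lambda>k. real k * (real m)\<^sup>2"] ..
    also have "\<dots> = (r n + 2 * real m) * ?W n + (real m)\<^sup>2 * (r n * (\<Prod>i<n. r i))"
      unfolding gen_one assms r_def by simp
    finally have "?W (Suc n) / D (Suc n) \<le> ((r n + 2 * real m) * ?W n + (real m)\<^sup>2 * (r n * (\<Prod>i<n. r i))) / D (Suc n)"
      using D_pos[of "Suc n"] by (simp add: divide_right_mono)
    also have "\<dots> = ?W n / D n + (real m)\<^sup>2 * P (Suc n)"
    proof -
      have "D (Suc n) = D n * (r n + 2 * real m)" by (simp add: D_def)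
      moreover have "P (Suc n) = (r n * (\<Prod>i<n. r i)) / D (Suc n)"
        by (simp add: P_def D_def prod_dividef)
      ultimately show ?thesis using rm[of n] D_pos[of n] by (simp add: add_divide_distrib)
    qed
    also have "\<dots> \<le> (u2 S b c (x, y))\<^sup>2 + (real m)\<^sup>2 * (1 - r n * P n) + (real m)\<^sup>2 * (r n * P n - r (Suc n) * P (Suc n))"
      using Suc tele[of n] by (intro add_mono mult_left_mono) auto
    also have "\<dots> = (u2 S b c (x, y))\<^sup>2 + (real m)\<^sup>2 * (1 - r (Suc n) * P (Suc n))"
      by (simp add: algebra_simps)
    finally show ?case .
  qed
  have "(real m)\<^sup>2 * (1 - r n * P n) \<le> (real m)\<^sup>2 * 1"
    using r_pos[of n] P_pos[of n] by (intro mult_left_mono) auto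
  with W[of n] show ?thesis unfolding D_def r_def by simp
qed

end

locale large_urn_process = urn_jump_process a b c d S M s0 Z \<tau> U + large_urn a b c d S m
  for a b c d S :: nat and M :: "'w measure" and s0 Z \<tau> U m +
  fixes X :: "'w \<Rightarrow> real"
  assumes X_measurable: "X \<in> borel_measurable M"
    and X_lim: "AE \<omega> in M. ((\<lambda>t. exp (- (real m * t)) * u2 S b c (U t \<omega>)) \<longlongrightarrow> X \<omega>) at_top"
begin

text \<open>
  The discounted martingale, observed at the jump times.
\<close>
definition Q :: "nat \<Rightarrow> 'w \<Rightarrow> real" where
  "Q n \<omega> = u2 S b c (Z n \<omega>) * exp (- real m * T n \<omega>)"

lemma Q_lim: "AE \<omega> in M. (\<lambda>n. Q n \<omega>) \<longlonglongrightarrow> X \<omega>"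
  using X_lim AE_T U_eq
proof eventually_elim
  case (elim \<omega>)
  have "((\<lambda>n. exp (- (real m * T n \<omega>)) * u2 S b c (U (T n \<omega>) \<omega>)) \<longlongrightarrow> X \<omega>) sequentially"
    using elim by (intro filterlim_compose[OF elim(1)]) auto
  moreover have "U (T n \<omega>) \<omega> = Z n \<omega>" for n
    using elim strict_monoD[of "\<lambda>n. T n \<omega>" n "Suc n"] by auto
  ultimately show ?case by (simp add: Q_def mult.commute)
qed

lemma Q_moments:
  shows "integrable M (Q n)" "expectation (Q n) = u2 S b c s0"
    "integrable M (\<lambda>\<omega>. (Q n \<omega>)\<^sup>2)" "expectation (\<lambda>\<omega>. (Q n \<omega>)\<^sup>2) \<le> (u2 S b c s0)\<^sup>2 + (real m)\<^sup>2"
proof -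
  obtain x y where s0: "s0 = (x, y)" by (cases s0)
  have xy: "x + y = 1" using size_s0 s0 by simp
  have pos: "0 < (\<Prod>i<n. real (1 + i * S) + real m)"
    by (intro prod_pos) (simp add: add_pos_nonneg)
  show "integrable M (Q n)"
    unfolding Q_def[abs_def] by (rule expectation_laplace(1)) simp
  show "expectation (Q n) = u2 S b c s0"
  proof -
    have "expectation (Q n) = gen n (u2 S b c) (x, y) / (\<Prod>i<n. real (1 + i * S) + real m)"
      unfolding Q_def[abs_def] using expectation_laplace(2)[of "real m" "u2 S b c" n] by (simp add: s0)
    also have "\<dots> = u2 S b c (x, y)"
      unfolding gen_u2 xy by (rule nonzero_mult_div_cancel_left) (rule less_imp_neq[OF pos, symmetric])
    finally show ?thesis by (simp add: s0)
  qed
  have sq: "(Q n \<omega>)\<^sup>2 = (u2 S b c (Z n \<omega>))\<^sup>2 * exp (- (2 * real m) * T n \<omega>)" for \<omega>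
    by (simp add: Q_def power_mult_distrib flip: exp_double)
  show "integrable M (\<lambda>\<omega>. (Q n \<omega>)\<^sup>2)"
    unfolding sq by (rule expectation_laplace(1)) simp
  show "expectation (\<lambda>\<omega>. (Q n \<omega>)\<^sup>2) \<le> (u2 S b c s0)\<^sup>2 + (real m)\<^sup>2"
    unfolding sq using expectation_laplace(2)[of "2 * real m" "\<lambda>s. (u2 S b c s)\<^sup>2" n] gen_u2_square_bounded[OF xy, of n]
    by (simp add: s0)
qed

text \<open>
  Taylor's formula for the exponential, applied to the martingale \<open>Q n\<close> with
  constant mean and bounded second moment, and then the limit
  \<open>n \<rightarrow> \<infinity>\<close>.
\<close>
lemma char_expansion:
  "norm (char (distr M borel X) x - (1 + \<i> * of_real x * of_real (u2 S b c s0))) \<le> ((u2 S b c s0)\<^sup>2 + (real m)\<^sup>2) / 2 * x\<^sup>2"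
proof -
  let ?K = "(u2 S b c s0)\<^sup>2 + (real m)\<^sup>2"
  have Qm: "Q n \<in> borel_measurable M" for n
    using Q_moments(1) by (rule borel_measurable_integrable)
  have bound: "norm (expectation (\<lambda>\<omega>. iexp (x * Q n \<omega>)) - (1 + \<i> * of_real x * of_real (u2 S b c s0))) \<le> ?K / 2 * x\<^sup>2" for n
  proof -
    have i1: "integrable M (\<lambda>\<omega>. iexp (x * Q n \<omega>))"
      using Qm by (intro integrable_const_bound[where B = 1]) auto
    have i2: "integrable M (\<lambda>\<omega>. \<i> * of_real x * complex_of_real (Q n \<omega>))"
      using Q_moments(1) by (intro integrable_mult_right integrable_of_real)
    let ?R = "\<lambda>\<omega>. iexp (x * Q n \<omega>) - (1 + \<i> * of_real x * of_real (Q n \<omega>))"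
    have "expectation ?R = expectation (\<lambda>\<omega>. iexp (x * Q n \<omega>)) - (1 + \<i> * of_real x * of_real (u2 S b c s0))"
      using i1 i2 Q_moments(2)[of n]
      by (simp add: Bochner_Integration.integral_diff Bochner_Integration.integral_add prob_space)
    moreover have "norm (expectation ?R) \<le> expectation (\<lambda>\<omega>. x\<^sup>2 / 2 * (Q n \<omega>)\<^sup>2)"
    proof (rule order_trans[OF integral_norm_bound], rule integral_mono)
      show "integrable M (\<lambda>\<omega>. norm (iexp (x * Q n \<omega>) - (1 + \<i> * of_real x * of_real (Q n \<omega>))))"
        using i1 i2 by (intro integrable_norm Bochner_Integration.integrable_diff Bochner_Integration.integrable_add) auto
      show "integrable M (\<lambda>\<omega>. x\<^sup>2 / 2 * (Q n \<omega>)\<^sup>2)"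
        using Q_moments(3) by (intro integrable_mult_right)
      fix \<omega>
      have A: "\<bar>z\<bar> ^ Suc 1 / fact (Suc 1) = z\<^sup>2 / 2" for z :: real
        by (simp add: power2_eq_square)
      have B: "(\<Sum>k\<le>1. (\<i> * of_real z) ^ k / fact k) = 1 + \<i> * of_real z" for z :: real
        by simp
      have "norm (iexp (x * Q n \<omega>) - (1 + \<i> * of_real (x * Q n \<omega>))) \<le> (x * Q n \<omega>)\<^sup>2 / 2"
        using iexp_approx1[of "x * Q n \<omega>" 1] unfolding A B .
      then show "norm (iexp (x * Q n \<omega>) - (1 + \<i> * of_real x * of_real (Q n \<omega>))) \<le> x\<^sup>2 / 2 * (Q n \<omega>)\<^sup>2"
        by (simp add: power_mult_distrib mult.assoc)
    qed
    moreover have "expectation (\<lambda>\<omega>. x\<^sup>2 / 2 * (Q n \<omega>)\<^sup>2) \<le> ?K / 2 * x\<^sup>2"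
    proof -
      have "x\<^sup>2 / 2 * expectation (\<lambda>\<omega>. (Q n \<omega>)\<^sup>2) \<le> x\<^sup>2 / 2 * ?K"
        using Q_moments(4) by (intro mult_left_mono) auto
      then show ?thesis by (simp add: mult.commute)
    qed
    ultimately show ?thesis by simp
  qed
  have "(\<lambda>n. expectation (\<lambda>\<omega>. iexp (x * Q n \<omega>))) \<longlonglongrightarrow> expectation (\<lambda>\<omega>. iexp (x * X \<omega>))"
  proof (rule integral_dominated_convergence[where w = "\<lambda>_. 1"])
    show "AE \<omega> in M. (\<lambda>n. iexp (x * Q n \<omega>)) \<longlonglongrightarrow> iexp (x * X \<omega>)"
      using Q_lim by eventually_elim (intro tendsto_intros)
  qed (use Qm X_measurable in auto)
  then have "(\<lambda>n. norm (expectation (\<lambda>\<omega>. iexp (x * Q n \<omega>)) - (1 + \<i> * of_real x * of_real (u2 S b c s0)))) \<longlonglongrightarrow>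
     norm (expectation (\<lambda>\<omega>. iexp (x * X \<omega>)) - (1 + \<i> * of_real x * of_real (u2 S b c s0)))"
    by (intro tendsto_intros)
  then have "norm (expectation (\<lambda>\<omega>. iexp (x * X \<omega>)) - (1 + \<i> * of_real x * of_real (u2 S b c s0))) \<le> ?K / 2 * x\<^sup>2"
    by (rule LIMSEQ_le_const2) (use bound in auto)
  moreover have "char (distr M borel X) x = expectation (\<lambda>\<omega>. iexp (x * X \<omega>))"
    using X_measurable by (simp add: char_def integral_distr)
  ultimately show ?thesis by simp
qed

lemma urn_mean_tendsto_char:
  "((\<lambda>t. urn_mean (wave (x * exp (- real m * t))) s0 t) \<longlongrightarrow> char (distr M borel X) x) at_top"
proof -
  have Um: "(\<lambda>\<omega>. wave \<theta> (U t \<omega>)) \<in> borel_measurable M" if "0 \<le> t" for \<theta> t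
    using measurable_compose[OF U_measurable[OF that], of "wave \<theta>" borel] by simp
  have "((\<lambda>t. expectation (\<lambda>\<omega>. if 0 \<le> t then wave (x * exp (- real m * t)) (U t \<omega>) else 1)) \<longlongrightarrow> expectation (\<lambda>\<omega>. iexp (x * X \<omega>))) at_top"
  proof (rule integral_dominated_convergence_at_top[where w = "\<lambda>_. 1"])
    show "AE \<omega> in M. ((\<lambda>t. if 0 \<le> t then wave (x * exp (- real m * t)) (U t \<omega>) else 1) \<longlongrightarrow> iexp (x * X \<omega>)) at_top"
      using X_lim
    proof eventually_elim
      case (elim \<omega>)
      then have "((\<lambda>t. iexp (x * (exp (- (real m * t)) * u2 S b c (U t \<omega>)))) \<longlongrightarrow> iexp (x * X \<omega>)) at_top"
        by (intro tendsto_intros)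
      moreover have "\<forall>\<^sub>F t in at_top. iexp (x * (exp (- (real m * t)) * u2 S b c (U t \<omega>))) =
         (if 0 \<le> t then wave (x * exp (- real m * t)) (U t \<omega>) else 1)"
        using eventually_ge_at_top[of 0] by eventually_elim (simp add: wave_def mult.assoc)
      ultimately show ?case by (rule Lim_transform_eventually)
    qed
    show "\<forall>\<^sub>F t in at_top. AE \<omega> in M. norm (if 0 \<le> t then wave (x * exp (- real m * t)) (U t \<omega>) else 1) \<le> 1"
      by (intro always_eventually allI AE_I2) (simp add: wave_def)
    show "(\<lambda>\<omega>. if 0 \<le> t then wave (x * exp (- real m * t)) (U t \<omega>) else 1) \<in> borel_measurable M" for t
      using Um[of t] by (cases "0 \<le> t") auto
  qed (use X_measurable in auto)
  moreover have "\<forall>\<^sub>F t in at_top. expectation (\<lambda>\<omega>. if 0 \<le> t then wave (x * exp (- real m * t)) (U t \<omega>) else 1) = urn_mean (wave (x * exp (- real m * t))) s0 t"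
    proof -
    have "norm (wave \<theta> s) \<le> 1" for \<theta> s by (simp add: wave_def)
    then have eU: "expectation (\<lambda>\<omega>. wave \<theta> (U t \<omega>)) = urn_mean (wave \<theta>) s0 t" if "0 \<le> t" for \<theta> t
      using that by (rule expectation_U)
    show ?thesis
      using eventually_ge_at_top[of 0] by eventually_elim (simp only: if_True eU)
  qed
  ultimately have "((\<lambda>t. urn_mean (wave (x * exp (- real m * t))) s0 t) \<longlongrightarrow> expectation (\<lambda>\<omega>. iexp (x * X \<omega>))) at_top"
    by (rule Lim_transform_eventually)
  then show ?thesis
    using X_measurable by (simp add: char_def integral_distr)
qed

end

section \<open>The differential system\<close>

lemma (in large_urn_process) norm_urn_mean_le:
  assumes "0 \<le> t"
  shows "norm (urn_mean (wave \<theta>) s0 t) \<le> 1"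
proof -
  have w: "norm (wave \<theta> s) \<le> 1" for s by (simp add: wave_def)
  have "norm (expectation (\<lambda>\<omega>. wave \<theta> (U t \<omega>))) \<le> expectation (\<lambda>\<omega>. norm (wave \<theta> (U t \<omega>)))"
    by (rule integral_norm_bound)
  also have "\<dots> = 1"
    by (simp add: wave_def prob_space)
  finally show ?thesis
    using expectation_U[of "wave \<theta>", OF w assms] by simp
qed

text \<open>
  The equation \<open>E' = H - E\<close> in integrated form, with integrating factor
  \<open>exp r\<close>.
\<close>
lemma relaxation_integral:
  fixes E H :: "real \<Rightarrow> complex"
  assumes E': "\<And>t. 0 \<le> t \<Longrightarrow> (E has_vector_derivative (H t - E t)) (at t)"
    and "0 \<le> t" "0 \<le> s"
  shows "((\<lambda>r. of_real (exp r) * H (t + r)) has_integral (of_real (exp s) * E (t + s) - E t)) {0..s}"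
proof -
  have "((\<lambda>r. of_real (exp r) * H (t + r)) has_integral
     (of_real (exp s) * E (t + s) - of_real (exp 0) * E (t + 0))) {0..s}"
  proof (rule fundamental_theorem_of_calculus[OF \<open>0 \<le> s\<close>])
    fix r assume r: "r \<in> {0..s}"
    have "((\<lambda>r. t + r) has_vector_derivative 1) (at r)"
      by (auto intro!: derivative_eq_intros)
    moreover have "(E has_vector_derivative (H (t + r) - E (t + r))) (at (t + r))"
      using r assms by (intro E') auto
    ultimately have "((\<lambda>r. E (t + r)) has_vector_derivative (H (t + r) - E (t + r))) (at r)"
      using vector_diff_chain_at[of "\<lambda>r. t + r" 1 r E] by (simp add: o_def)
    moreover have "((\<lambda>r. of_real (exp r) :: complex) has_vector_derivative of_real (exp r)) (at r)"
      by (rule has_vector_derivative_of_real) (auto intro!: derivative_eq_intros)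
    ultimately have "((\<lambda>r. of_real (exp r) * E (t + r)) has_vector_derivative
       (of_real (exp r) * (H (t + r) - E (t + r)) + of_real (exp r) * E (t + r))) (at r)"
      by (intro has_vector_derivative_mult)
    then show "((\<lambda>r. of_real (exp r) * E (t + r)) has_vector_derivative (of_real (exp r) * H (t + r))) (at r within {0..s})"
      by (simp add: algebra_simps has_vector_derivative_at_within)
  qed
  then show ?thesis by simp
qed

text \<open>
  The parameter \<open>x exp (- m t)\<close> at time \<open>t\<close> is
  \<open>x exp (m r) * exp (- m (t + r))\<close>, the parameter that belongs to the
  point \<open>x exp (m r)\<close> at time \<open>t + r\<close>. The integrated equation on
  \<open>[t, t + s]\<close> therefore converges to one on the orbit of \<open>x\<close>.
\<close>
lemma self_similar_limit_integral:
  fixes E H :: "real \<Rightarrow> real \<Rightarrow> complex" and F L :: "real \<Rightarrow> complex" and m :: real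
  assumes E': "\<And>\<theta> t. 0 \<le> t \<Longrightarrow> (E \<theta> has_vector_derivative (H \<theta> t - E \<theta> t)) (at t)"
    and bound: "\<And>\<theta> t. 0 \<le> t \<Longrightarrow> norm (H \<theta> t) \<le> 1"
    and limE: "\<And>x. ((\<lambda>t. E (x * exp (- m * t)) t) \<longlongrightarrow> F x) at_top"
    and limH: "\<And>x. ((\<lambda>t. H (x * exp (- m * t)) t) \<longlongrightarrow> L x) at_top"
    and s: "0 \<le> s"
  shows "of_real (exp s) * F (x * exp (m * s)) = F x + integral {0..s} (\<lambda>r. of_real (exp r) * L (x * exp (m * r)))"
proof -
  let ?\<theta> = "\<lambda>n. x * exp (- m * real n)"
  have shift: "x * exp (m * r) * exp (- m * (real n + r)) = ?\<theta> n" for n r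
    by (simp add: algebra_simps flip: exp_add)
  have top: "filterlim (\<lambda>n. real n + r) at_top sequentially" for r
    by real_asymp
  have E_lim: "(\<lambda>n. E (?\<theta> n) (real n + r)) \<longlonglongrightarrow> F (x * exp (m * r))" for r
    using filterlim_compose[OF limE[of "x * exp (m * r)"] top[of r]] unfolding shift .
  have H_lim: "(\<lambda>n. H (?\<theta> n) (real n + r)) \<longlonglongrightarrow> L (x * exp (m * r))" for r
    using filterlim_compose[OF limH[of "x * exp (m * r)"] top[of r]] unfolding shift .
  have int: "((\<lambda>r. of_real (exp r) * H (?\<theta> n) (real n + r)) has_integral
     (of_real (exp s) * E (?\<theta> n) (real n + s) - E (?\<theta> n) (real n))) {0..s}" for n
    by (rule relaxation_integral[OF E' _ s]) auto
  have "(\<lambda>n. integral {0..s} (\<lambda>r. of_real (exp r) * H (?\<theta> n) (real n + r))) \<longlonglongrightarrow>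
     integral {0..s} (\<lambda>r. of_real (exp r) * L (x * exp (m * r)))"
  proof (rule dominated_convergence(2)[where h = "\<lambda>r. exp r"])
    show "(\<lambda>r. exp r) integrable_on {0..s}"
      by (intro integrable_continuous_interval continuous_intros)
    show "norm (of_real (exp r) * H (?\<theta> n) (real n + r)) \<le> exp r" if "r \<in> {0..s}" for n r
      using bound[of "real n + r" "?\<theta> n"] that by (simp add: norm_mult mult_left_le)
    show "(\<lambda>n. of_real (exp r) * H (?\<theta> n) (real n + r)) \<longlonglongrightarrow> of_real (exp r) * L (x * exp (m * r))" for r
      by (intro tendsto_intros H_lim)
  qed (use int in \<open>auto intro: has_integral_integrable\<close>)
  moreover have "integral {0..s} (\<lambda>r. of_real (exp r) * H (?\<theta> n) (real n + r)) =
     of_real (exp s) * E (?\<theta> n) (real n + s) - E (?\<theta> n) (real n)" for n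
    using int by (rule integral_unique)
  moreover have "(\<lambda>n. of_real (exp s) * E (?\<theta> n) (real n + s) - E (?\<theta> n) (real n)) \<longlonglongrightarrow> of_real (exp s) * F (x * exp (m * s)) - F x"
    using E_lim[of 0] by (intro tendsto_intros E_lim) simp
  ultimately have "integral {0..s} (\<lambda>r. of_real (exp r) * L (x * exp (m * r))) = of_real (exp s) * F (x * exp (m * s)) - F x"
    using LIMSEQ_unique by simp
  then show ?thesis by simp
qed

text \<open>
  Every \<open>y \<noteq> 0\<close> is an interior point of the orbit that starts at
  \<open>x = y exp (- m)\<close>, at parameter \<open>1\<close>; the integral equation is
  differentiated there.
\<close>
lemma self_similar_limit_ode:
  fixes E H :: "real \<Rightarrow> real \<Rightarrow> complex" and F L :: "real \<Rightarrow> complex" and m :: real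
  assumes E': "\<And>\<theta> t. 0 \<le> t \<Longrightarrow> (E \<theta> has_vector_derivative (H \<theta> t - E \<theta> t)) (at t)"
    and bound: "\<And>\<theta> t. 0 \<le> t \<Longrightarrow> norm (H \<theta> t) \<le> 1"
    and limE: "\<And>x. ((\<lambda>t. E (x * exp (- m * t)) t) \<longlongrightarrow> F x) at_top"
    and limH: "\<And>x. ((\<lambda>t. H (x * exp (- m * t)) t) \<longlongrightarrow> L x) at_top"
    and L: "continuous_on UNIV L" and m: "0 < m" and y: "y \<noteq> 0"
  shows "(F has_vector_derivative (L y - F y) / of_real (m * y)) (at y)"
proof -
  define x where "x = y * exp (- m)"
  let ?g = "\<lambda>r. of_real (exp r) * L (x * exp (m * r))"
  have g: "continuous_on {0..2} ?g"
    by (intro continuous_intros continuous_on_compose2[OF L]) auto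
  have x1: "x * exp (m * 1) = y"
    by (simp add: x_def mult.assoc flip: exp_add)
  have "((\<lambda>s. integral {0..s} ?g) has_vector_derivative ?g 1) (at 1 within {0..2})"
    by (rule integral_has_vector_derivative[OF g]) simp
  then have "((\<lambda>s. integral {0..s} ?g) has_vector_derivative ?g 1) (at 1)"
    by (simp add: at_within_Icc_at)
  then have "((\<lambda>s. F x + integral {0..s} ?g) has_vector_derivative ?g 1) (at 1)"
    by (auto intro!: derivative_eq_intros)
  moreover have "((\<lambda>s. of_real (exp (- s)) :: complex) has_vector_derivative of_real (- exp (- 1))) (at 1)"
    by (rule has_vector_derivative_of_real) (auto intro!: derivative_eq_intros)
  ultimately have "((\<lambda>s. of_real (exp (- s)) * (F x + integral {0..s} ?g)) has_vector_derivative
     (of_real (exp (- 1)) * ?g 1 + of_real (- exp (- 1)) * (F x + integral {0..1} ?g))) (at 1)"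
    by (intro has_vector_derivative_mult)
  moreover have int: "F x + integral {0..s} ?g = of_real (exp s) * F (x * exp (m * s))" if "0 \<le> s" for s
    using self_similar_limit_integral[of E H m F L s x, OF E' bound limE limH that] by simp
  moreover have "of_real (exp (- 1)) * ?g 1 + of_real (- exp (- 1)) * (of_real (exp 1) * F (x * exp (m * 1))) = L y - F y"
  proof -
    have "complex_of_real (exp (- 1)) * of_real (exp 1) = 1"
      by (simp flip: of_real_mult exp_add)
    then show ?thesis unfolding x1 by (simp flip: mult.assoc)
  qed
  ultimately have "((\<lambda>s. of_real (exp (- s)) * (F x + integral {0..s} ?g)) has_vector_derivative (L y - F y)) (at 1)"
    by simp
  then have F1: "((\<lambda>s. F (x * exp (m * s))) has_vector_derivative (L y - F y)) (at 1)"
  proof (rule has_vector_derivative_transform_within_open)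
    show "open {0<..<2::real}" "1 \<in> {0<..<2::real}" by auto
    fix s :: real assume "s \<in> {0<..<2}"
    then have "of_real (exp (- s)) * (F x + integral {0..s} ?g) = (of_real (exp (- s)) * of_real (exp s)) * F (x * exp (m * s))"
      using int[of s] by simp
    also have "complex_of_real (exp (- s)) * of_real (exp s) = 1"
      by (simp flip: of_real_mult exp_add)
    finally show "of_real (exp (- s)) * (F x + integral {0..s} ?g) = F (x * exp (m * s))" by simp
  qed
  \<comment> \<open>The parameter of \<open>z\<close> on the orbit of \<open>x\<close>, near
    \<open>y\<close>; the quotient \<open>z / y\<close> is positive for both signs of
    \<open>y\<close>.\<close>
  let ?s = "\<lambda>z. 1 + ln (z / y) / m"
  have "(?s has_real_derivative 1 / (m * y)) (at y)"
    using m y by (auto intro!: derivative_eq_intros)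
  then have "(?s has_vector_derivative 1 / (m * y)) (at y)"
    by (simp add: has_real_derivative_iff_has_vector_derivative)
  moreover have "((\<lambda>s. F (x * exp (m * s))) has_vector_derivative (L y - F y)) (at (?s y))"
    using F1 y by simp
  ultimately have "(((\<lambda>s. F (x * exp (m * s))) \<circ> ?s) has_vector_derivative ((1 / (m * y)) *\<^sub>R (L y - F y))) (at y)"
    by (rule vector_diff_chain_at)
  then have "(F has_vector_derivative ((1 / (m * y)) *\<^sub>R (L y - F y))) (at y)"
  proof (rule has_vector_derivative_transform_within_open)
    have "{z. 0 < z / y} = (\<lambda>z. z / y) -` {0<..}" by auto
    then show "open {z. 0 < z / y}"
      using y by (auto intro!: open_vimage continuous_intros)
    show "y \<in> {z. 0 < z / y}" using y by simp
    fix z assume "z \<in> {z. 0 < z / y}"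
    then have "exp (m * ?s z) = exp m * (z / y)"
      using m by (simp add: distrib_left exp_add)
    moreover have "x * (exp m * (z / y)) = z"
      using y by (simp add: x_def exp_minus)
    ultimately show "((\<lambda>s. F (x * exp (m * s))) \<circ> ?s) z = F z"
      by (simp only: comp_apply)
  qed
  then show ?thesis
    by (simp add: scaleR_conv_of_real divide_inverse mult.commute)
qed

lemma has_vector_derivative_at_0_of_expansion:
  fixes F :: "real \<Rightarrow> complex"
  assumes "\<And>x. norm (F x - (1 + k * of_real x)) \<le> K * x\<^sup>2"
  shows "(F has_vector_derivative k) (at 0)"
proof -
  have F0: "F 0 = 1" using assms[of 0] by simp
  have "(\<lambda>h. norm (F h - F 0 - h *\<^sub>R k) / norm h) \<midarrow>0\<rightarrow> 0"
  proof (rule Lim_null_comparison)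
    show "(\<lambda>h. K * \<bar>h\<bar>) \<midarrow>0\<rightarrow> 0"
      by (auto intro!: tendsto_eq_intros)
    have "norm (norm (F h - F 0 - h *\<^sub>R k) / norm h) \<le> K * \<bar>h\<bar>" if "h \<noteq> 0" for h
      using assms[of h] that
      by (simp add: F0 scaleR_conv_of_real algebra_simps divide_le_eq power2_eq_square)
    then show "\<forall>\<^sub>F h in at 0. norm (norm (F h - F 0 - h *\<^sub>R k) / norm h) \<le> K * \<bar>h\<bar>"
      by (auto simp: eventually_at_filter)
  qed
  then show ?thesis
    unfolding has_vector_derivative_def has_derivative_at by (auto intro: bounded_linear_scaleR_left)
qed

lemma markov_jump_process_imp_large_urn_process:
  assumes "large_urn a b c d S m" and "fst s0 + snd s0 = 1"
    and mj: "markov_jump_process M (urn_rate a b c d) s0 U"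
    and X: "X \<in> borel_measurable M"
      "AE \<omega> in M. ((\<lambda>t. exp (- (real m * t)) * u2 S b c (U t \<omega>)) \<longlongrightarrow> X \<omega>) at_top"
  obtains Z \<tau> where "large_urn_process a b c d S M s0 Z \<tau> U m X"
proof -
  interpret large_urn a b c d S m by fact
  have ac: "a \<noteq> c" using a_eq S_lt m_lt by simp
  from mj obtain Z :: "nat \<Rightarrow> 'a \<Rightarrow> nat \<times> nat" and \<tau> :: "nat \<Rightarrow> 'a \<Rightarrow> real" where
    M: "prob_space M" and U: "\<And>t. 0 \<le> t \<Longrightarrow> U t \<in> measurable M (count_space UNIV)"
    and Z: "\<And>i. Z i \<in> measurable M (count_space UNIV)"
    and \<tau>: "\<And>i. \<tau> i \<in> borel_measurable M"
    and law: "\<And>n z t. (\<And>i. i < n \<Longrightarrow> 0 \<le> t i) \<Longrightarrow>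
      measure M {\<omega> \<in> space M. (\<forall>i\<le>n. Z i \<omega> = z i) \<and> (\<forall>i<n. t i < \<tau> i \<omega>)} =
      (if z 0 = s0 then 1 else 0) *
      (\<Prod>i<n. urn_rate a b c d (z i) (z (Suc i)) / total_rate (urn_rate a b c d) (z i) *
         exp (- total_rate (urn_rate a b c d) (z i) * t i))"
    and Ueq: "AE \<omega> in M. \<forall>n t. (\<Sum>i<n. \<tau> i \<omega>) \<le> t \<and> t < (\<Sum>i<Suc n. \<tau> i \<omega>) \<longrightarrow> U t \<omega> = Z n \<omega>"
    unfolding markov_jump_process_def by blast
  interpret M: prob_space M by (rule M)
  interpret P: urn_process a b c d S M s0 Z \<tau>
    by unfold_locales (fact ac assms Z \<tau> law)+
  have "large_urn_process a b c d S M s0 Z \<tau> U m X"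
    by unfold_locales (use U Ueq X in \<open>auto simp: P.T_def\<close>)
  then show ?thesis by (rule that)
qed

theorem char_urn_system_solution:
  assumes lu: "large_urn a b c d S m"
    and U: "markov_jump_process M (urn_rate a b c d) (1, 0) U"
    and V: "markov_jump_process N (urn_rate a b c d) (0, 1) V"
    and X: "X \<in> borel_measurable M"
      "AE \<omega> in M. ((\<lambda>t. exp (- (real m * t)) * u2 S b c (U t \<omega>)) \<longlongrightarrow> X \<omega>) at_top"
    and Y: "Y \<in> borel_measurable N"
      "AE \<omega> in N. ((\<lambda>t. exp (- (real m * t)) * u2 S b c (V t \<omega>)) \<longlongrightarrow> Y \<omega>) at_top"
  defines "F \<equiv> char (distr M borel X)" and "G \<equiv> char (distr N borel Y)"
  shows "urn_system_solution m S a b c d F G"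
proof -
  interpret large_urn a b c d S m by (rule lu)
  obtain Z \<tau> where "large_urn_process a b c d S M (1, 0) Z \<tau> U m X"
    by (rule markov_jump_process_imp_large_urn_process[OF lu _ U X]) auto
  then interpret X: large_urn_process a b c d S M "(1, 0)" Z \<tau> U m X .
  obtain Z' \<tau>' where "large_urn_process a b c d S N (0, 1) Z' \<tau>' V m Y"
    by (rule markov_jump_process_imp_large_urn_process[OF lu _ V Y]) auto
  then interpret Y: large_urn_process a b c d S N "(0, 1)" Z' \<tau>' V m Y .
  have m_pos: "0 < real m" using S_lt by simp
  have wave: "norm (wave \<theta> s) \<le> 1" "wave \<theta> (x + x', y + y') = wave \<theta> (x, y) * wave \<theta> (x', y')" "wave \<theta> (0, 0) = 1"
    for \<theta> s x x' y y'
    by (simp_all add: wave_def u2_add distrib_left exp_add[symmetric]) (simp_all add: u2_def)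
  let ?E = "\<lambda>\<theta>. urn_mean (wave \<theta>) (1, 0)" and ?D = "\<lambda>\<theta>. urn_mean (wave \<theta>) (0, 1)"
  have limE: "((\<lambda>t. ?E (x * exp (- real m * t)) t) \<longlongrightarrow> F x) at_top" for x
    unfolding F_def by (rule X.urn_mean_tendsto_char)
  have limD: "((\<lambda>t. ?D (x * exp (- real m * t)) t) \<longlongrightarrow> G x) at_top" for x
    unfolding G_def by (rule Y.urn_mean_tendsto_char)
  interpret dX: real_distribution "distr M borel X"
    using X(1) by (intro real_distribution.intro X.prob_space_distr) (auto simp: real_distribution_axioms_def)
  interpret dY: real_distribution "distr N borel Y"
    using Y(1) by (intro real_distribution.intro Y.prob_space_distr) (auto simp: real_distribution_axioms_def)
  have contF: "continuous_on UNIV F" and contG: "continuous_on UNIV G"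
    unfolding F_def G_def by (intro continuous_at_imp_continuous_on ballI dX.isCont_char dY.isCont_char)+
  have bE: "norm (?E \<theta> t) \<le> 1" and bD: "norm (?D \<theta> t) \<le> 1" if "0 \<le> t" for \<theta> t
    using X.norm_urn_mean_le[OF that] Y.norm_urn_mean_le[OF that] by auto
  have bound: "norm (?E \<theta> t ^ i * ?D \<theta> t ^ j) \<le> 1" if "0 \<le> t" for \<theta> t i j
    using bE[OF that, of \<theta>] bD[OF that, of \<theta>]
    by (simp add: norm_mult norm_power mult_le_one power_le_one)
  have F': "(F has_vector_derivative (F y ^ (a + 1) * G y ^ b - F y) / of_real (real m * y)) (at y)" if "y \<noteq> 0" for y
    by (rule self_similar_limit_ode[of ?E "\<lambda>\<theta> t. ?E \<theta> t ^ (a + 1) * ?D \<theta> t ^ b"])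
      (intro urn_mean_deriv wave bound limE limD tendsto_intros continuous_intros contF contG m_pos that; assumption)+
  have G': "(G has_vector_derivative (F y ^ c * G y ^ (d + 1) - G y) / of_real (real m * y)) (at y)" if "y \<noteq> 0" for y
    by (rule self_similar_limit_ode[of ?D "\<lambda>\<theta> t. ?E \<theta> t ^ c * ?D \<theta> t ^ (d + 1)"])
      (intro urn_mean_deriv wave bound limE limD tendsto_intros continuous_intros contF contG m_pos that; assumption)+
  have expF: "norm (F x - (1 + \<i> * (of_nat b / of_nat S) * of_real x)) \<le> ((u2 S b c (1, 0))\<^sup>2 + (real m)\<^sup>2) / 2 * x\<^sup>2" for x
    using X.char_expansion[of x] by (simp add: F_def u2_def mult_ac)
  have expG: "norm (G x - (1 + - \<i> * (of_nat c / of_nat S) * of_real x)) \<le> ((u2 S b c (0, 1))\<^sup>2 + (real m)\<^sup>2) / 2 * x\<^sup>2" for x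
    using Y.char_expansion[of x] by (simp add: G_def u2_def mult_ac)
  have F0: "F 0 = 1" "G 0 = 1" using expF[of 0] expG[of 0] by simp_all
  note F0' = has_vector_derivative_at_0_of_expansion[of F, OF expF]
    and G0' = has_vector_derivative_at_0_of_expansion[of G, OF expG]
  have dF: "F differentiable at x" for x
    using F'[of x] F0' by (cases "x = 0") (auto intro: differentiableI_vector)
  have dG: "G differentiable at x" for x
    using G'[of x] G0' by (cases "x = 0") (auto intro: differentiableI_vector)
  have mx: "complex_of_real (real m * x) = of_nat m * of_real x" for x by simp
  show ?thesis
    unfolding urn_system_solution_def
  proof (intro conjI allI dF dG)
    fix x
    show "F x + of_nat m * of_real x * vector_derivative F (at x) = F x ^ (a + 1) * G x ^ b"
    proof (cases "x = 0")
      case False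
      then show ?thesis
        using vector_derivative_at[OF F'[OF False]] m_pos unfolding mx by simp
    qed (simp add: F0)
    show "G x + of_nat m * of_real x * vector_derivative G (at x) = F x ^ c * G x ^ (d + 1)"
    proof (cases "x = 0")
      case False
      then show ?thesis
        using vector_derivative_at[OF G'[OF False]] m_pos unfolding mx by simp
    qed (simp add: F0)
  next
    show "(\<lambda>x. F x - (1 + \<i> * (of_nat b / of_nat S) * of_real x)) \<in> O[at 0](\<lambda>x. of_real (x ^ 2))"
      using expF by (intro bigoI[where c = "((u2 S b c (1, 0))\<^sup>2 + (real m)\<^sup>2) / 2"] always_eventually)
        (simp add: norm_power)
    show "(\<lambda>x. G x - (1 - \<i> * (of_nat c / of_nat S) * of_real x)) \<in> O[at 0](\<lambda>x. of_real (x ^ 2))"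
      using expG by (intro bigoI[where c = "((u2 S b c (0, 1))\<^sup>2 + (real m)\<^sup>2) / 2"] always_eventually)
        (simp add: norm_power)
  qed
qed

section \<open>A Schwarz-Christoffel map of the upper half-plane\<close>

definition upper :: "complex set" where
  "upper = {v. 0 \<le> Im v}"

lemma Im_Ln_upper:
  assumes "v \<in> upper" "v \<noteq> 0"
  shows "0 \<le> Im (Ln v)" "Im (Ln v) \<le> pi"
  using assms Im_Ln_pos_le[of v] by (auto simp: upper_def)

lemma cmod_powr_real: "cmod (z powr of_real s) = cmod z powr s"
  by (simp add: norm_powr_complex)

text \<open>
  Division by \<open>\<i>\<close> moves the closed upper half-plane into the closed right
  half-plane, away from the branch cut.
\<close>
lemma continuous_on_powr_upper:
  assumes "0 < s"
  shows "continuous_on upper (\<lambda>v. v powr of_real s)"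
proof -
  have "v powr of_real s = \<i> powr of_real s * (v / \<i>) powr of_real s" if "v \<in> upper" for v
  proof (cases "v = 0")
    case False
    have "0 \<le> Re (v / \<i>)" using that by (simp add: upper_def)
    then have "\<bar>Im (Ln (v / \<i>))\<bar> \<le> pi / 2"
      using False by (subst Re_Ln_pos_le) auto
    then have b: "- (pi / 2) \<le> Im (Ln (v / \<i>))" "Im (Ln (v / \<i>)) \<le> pi / 2"
      by linarith+
    have li: "Im (Ln \<i>) = pi / 2" by simp
    have "Ln (\<i> * (v / \<i>)) = Ln \<i> + Ln (v / \<i>)"
    proof (rule Ln_times_simple)
      show "v / \<i> \<noteq> 0" using False by simp
      show "- pi < Im (Ln \<i>) + Im (Ln (v / \<i>))" "Im (Ln \<i>) + Im (Ln (v / \<i>)) \<le> pi"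
        using b li pi_gt_zero by linarith+
    qed simp
    then have "Ln v = Ln \<i> + Ln (v / \<i>)" by simp
    with False show ?thesis
      by (simp add: powr_def distrib_left flip: exp_add)
  qed simp
  moreover have "continuous_on upper (\<lambda>v. \<i> powr of_real s * (v / \<i>) powr of_real s)"
    using assms by (intro continuous_on_mult continuous_on_const continuous_on_powr_complex continuous_intros)
      (auto simp: upper_def)
  ultimately show ?thesis
    by (subst continuous_on_cong[OF refl]) auto
qed

locale sector_map =
  fixes m S \<beta> \<gamma> :: nat
  assumes \<beta>_pos: "0 < \<beta>" and \<gamma>_pos: "0 < \<gamma>" and sum_eq: "\<beta> + \<gamma> + m = S" and S_lt: "S < 2 * m"
begin

definition p :: real where "p = real \<beta> / real m"
definition q :: real where "q = real \<gamma> / real m"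

lemma m_pos: "0 < real m"
  using S_lt by simp

lemma p_pos: "0 < p" and q_pos: "0 < q" and pq_less: "p + q < 1" and S_over_m: "real S / real m = p + q + 1"
proof -
  show "0 < p" "0 < q" using m_pos \<beta>_pos \<gamma>_pos by (simp_all add: p_def q_def)
  have "real \<beta> + real \<gamma> < real m" using sum_eq S_lt by linarith
  then show "p + q < 1" using m_pos by (simp add: p_def q_def field_simps)
  have "real S = real \<beta> + real \<gamma> + real m" using sum_eq by linarith
  then show "real S / real m = p + q + 1" using m_pos by (simp add: p_def q_def field_simps)
qed

definition \<psi> :: "complex \<Rightarrow> complex" where
  "\<psi> v = (1 + v) powr of_real p * v powr of_real q / of_nat m"

lemma cmod_\<psi>: "cmod (\<psi> v) = cmod (1 + v) powr p * cmod v powr q / real m"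
  by (simp add: \<psi>_def norm_mult norm_divide cmod_powr_real)

lemma \<psi>_eq_0_iff: "\<psi> v = 0 \<longleftrightarrow> v = 0 \<or> v = -1"
  using m_pos p_pos q_pos by (auto simp: \<psi>_def powr_def add_eq_0_iff)

lemma \<psi>_nonzero: "0 < Im v \<or> 0 < Re v \<Longrightarrow> \<psi> v \<noteq> 0"
  by (auto simp: \<psi>_eq_0_iff)

lemma \<psi>_polar:
  assumes "v \<noteq> 0" "v \<noteq> -1"
  shows "\<psi> v = of_real (cmod (\<psi> v)) * cis (p * Im (Ln (1 + v)) + q * Im (Ln v))"
proof -
  let ?L = "of_real p * Ln (1 + v) + of_real q * Ln v"
  have "1 + v \<noteq> 0" using assms(2) by (simp add: add_eq_0_iff)
  then have e: "\<psi> v = exp ?L / of_nat m"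
    using assms by (simp add: \<psi>_def powr_def exp_add)
  have "exp ?L = of_real (exp (Re ?L)) * cis (Im ?L)"
    by (rule exp_eq_polar)
  moreover have "cmod (\<psi> v) = exp (Re ?L) / real m"
    unfolding e by (simp add: norm_divide)
  ultimately show ?thesis unfolding e by simp
qed

text \<open>
  The argument of \<open>\<psi> v\<close> lies between \<open>0\<close> and
  \<open>(p + q) \<pi> < \<pi>\<close>; rotation by half of this angle makes the real part
  positive, and even comparable to the modulus.
\<close>
lemma \<psi>_sector:
  assumes "v \<in> upper"
  shows "cos ((p + q) * pi / 2) * cmod (\<psi> v) \<le> Re (cis (- ((p + q) * pi / 2)) * \<psi> v)"
proof (cases "v = 0 \<or> v = -1")
  case True
  then have "\<psi> v = 0" by (simp add: \<psi>_eq_0_iff)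
  then show ?thesis by simp
next
  case False
  define \<alpha> where "\<alpha> = (p + q) * pi / 2"
  define \<theta> where "\<theta> = p * Im (Ln (1 + v)) + q * Im (Ln v)"
  have up: "1 + v \<in> upper" "1 + v \<noteq> 0" using assms False by (simp_all add: upper_def add_eq_0_iff)
  have v0: "v \<noteq> 0" using False by simp
  have "0 \<le> \<theta>"
    unfolding \<theta>_def using Im_Ln_upper[OF up] Im_Ln_upper[OF assms v0] p_pos q_pos by simp
  moreover have "\<theta> \<le> p * pi + q * pi"
    unfolding \<theta>_def using Im_Ln_upper[OF up] Im_Ln_upper[OF assms v0] p_pos q_pos
    by (intro add_mono mult_left_mono) auto
  moreover have "p * pi + q * pi = 2 * \<alpha>" by (simp add: \<alpha>_def algebra_simps)
  ultimately have "\<bar>\<theta> - \<alpha>\<bar> \<le> \<alpha>" by linarith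
  moreover have "\<alpha> \<le> pi" using pq_less by (simp add: \<alpha>_def)
  ultimately have "cos \<alpha> \<le> cos \<bar>\<theta> - \<alpha>\<bar>"
    by (intro cos_monotone_0_pi_le) auto
  then have "cos \<alpha> * cmod (\<psi> v) \<le> cos (\<theta> - \<alpha>) * cmod (\<psi> v)"
    by (intro mult_right_mono) auto
  also have "\<dots> = Re (cis (- \<alpha>) * (of_real (cmod (\<psi> v)) * cis \<theta>))"
    by (simp add: cos_diff algebra_simps)
  also have "of_real (cmod (\<psi> v)) * cis \<theta> = \<psi> v"
    unfolding \<theta>_def using False by (intro \<psi>_polar[symmetric]) auto
  finally show ?thesis by (simp add: \<alpha>_def)
qed

lemma cos_half_pos: "0 < cos ((p + q) * pi / 2)"
proof (rule cos_gt_zero)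
  show "0 < (p + q) * pi / 2" using p_pos q_pos by simp
  show "(p + q) * pi / 2 < pi / 2" using pq_less by simp
qed

lemma continuous_on_\<psi>: "continuous_on upper \<psi>"
proof -
  have "continuous_on upper (\<lambda>v. (1 + v) powr of_real p)"
    by (rule continuous_on_compose2[OF continuous_on_powr_upper[OF p_pos]]) (auto intro!: continuous_intros simp: upper_def)
  then show ?thesis
    unfolding \<psi>_def[abs_def] using m_pos continuous_on_powr_upper[OF q_pos]
    by (intro continuous_on_divide continuous_on_mult continuous_on_const) auto
qed

lemma \<psi>_differentiable: "0 < Im v \<Longrightarrow> \<psi> field_differentiable at v"
proof -
  assume "0 < Im v"
  moreover have "\<psi> holomorphic_on {v. 0 < Im v}"
    unfolding \<psi>_def[abs_def] using m_pos
    by (intro holomorphic_intros) (auto simp: complex_nonpos_Reals_iff)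
  ultimately show ?thesis
    using open_halfspace_Im_gt[of 0] by (intro holomorphic_on_imp_differentiable_at) auto
qed

text \<open>
  Cauchy's theorem for functions that are continuous on a closed convex set and holomorphic
  inside yields a primitive up to the boundary, including the branch points \<open>0\<close> and
  \<open>-1\<close>.
\<close>
lemma ex_primitive: "\<exists>g. g 0 = 0 \<and> (\<forall>v\<in>upper. (g has_field_derivative \<psi> v) (at v within upper))"
proof -
  have "convex upper" unfolding upper_def by (rule convex_halfspace_Im_ge)
  moreover have "0 < Im v" if "v \<in> interior upper" for v
  proof -
    from that obtain e where e: "0 < e" "ball v e \<subseteq> upper" by (auto simp: mem_interior)
    have "v - of_real (e / 2) * \<i> \<in> ball v e" using e(1) by (simp add: dist_norm norm_mult)
    with e(2) have "v - of_real (e / 2) * \<i> \<in> upper" by blast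
    then have "0 \<le> Im v - e / 2" by (simp add: upper_def)
    with e(1) show ?thesis by simp
  qed
  ultimately obtain g where "\<And>v. v \<in> upper \<Longrightarrow> (g has_field_derivative \<psi> v) (at v within upper)"
    using holomorphic_convex_primitive[of upper "{}" \<psi>] continuous_on_\<psi> \<psi>_differentiable by auto
  then have "\<forall>v\<in>upper. ((\<lambda>v. g v - g 0) has_field_derivative \<psi> v) (at v within upper)"
    by (auto intro!: derivative_eq_intros)
  then show ?thesis by (intro exI[of _ "\<lambda>v. g v - g 0"]) simp
qed

definition \<Psi> :: "complex \<Rightarrow> complex" where
  "\<Psi> = (SOME g. g 0 = 0 \<and> (\<forall>v\<in>upper. (g has_field_derivative \<psi> v) (at v within upper)))"

lemma \<Psi>_0 [simp]: "\<Psi> 0 = 0"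
  and \<Psi>_deriv: "v \<in> upper \<Longrightarrow> (\<Psi> has_field_derivative \<psi> v) (at v within upper)"
  using someI_ex[OF ex_primitive] unfolding \<Psi>_def[symmetric] by auto

lemma \<Psi>_deriv_at:
  assumes "0 < Im v"
  shows "(\<Psi> has_field_derivative \<psi> v) (at v)"
proof -
  have "(\<Psi> has_field_derivative \<psi> v) (at v within {v. 0 < Im v})"
    using assms by (intro has_field_derivative_subset[OF \<Psi>_deriv]) (auto simp: upper_def)
  moreover have "at v within {v. 0 < Im v} = at v"
    by (rule at_within_open) (simp_all add: assms open_halfspace_Im_gt)
  ultimately show ?thesis by simp
qed

lemma continuous_on_\<Psi>: "continuous_on upper \<Psi>"
  using \<Psi>_deriv by (rule DERIV_continuous_on)

lemma convex_upper: "v \<in> upper \<Longrightarrow> w \<in> upper \<Longrightarrow> 0 \<le> t \<Longrightarrow> t \<le> 1 \<Longrightarrow> v + of_real t * (w - v) \<in> upper"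
proof -
  assume "v \<in> upper" "w \<in> upper" "0 \<le> t" "t \<le> 1"
  then have "0 \<le> (1 - t) * Im v + t * Im w" by (simp add: upper_def)
  then show ?thesis by (simp add: upper_def algebra_simps)
qed

text \<open>
  The mean value theorem for a real linear functional of \<open>\<Psi>\<close> along a segment;
  all mapping properties of \<open>\<Psi>\<close> below are derived from it.
\<close>
lemma \<Psi>_mvt:
  assumes "v \<in> upper" "w \<in> upper"
  obtains t where "0 < t" "t < 1"
    "Re (k * (\<Psi> w - \<Psi> v)) = Re (k * (w - v) * \<psi> (v + of_real t * (w - v)))"
proof -
  let ?l = "\<lambda>t. v + of_real t * (w - v)"
  have "((\<lambda>t. Re (k * \<Psi> (?l t))) has_derivative (\<lambda>h. h * Re (k * ((w - v) * \<psi> (?l t))))) (at t within {0..1})"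
    if "0 \<le> t" "t \<le> 1" for t
  proof -
    have "(?l has_vector_derivative (w - v)) (at t within {0..1})"
      by (auto intro!: derivative_eq_intros)
    moreover have "(\<Psi> has_field_derivative \<psi> (?l t)) (at (?l t) within ?l ` {0..1})"
      using assms that by (intro has_field_derivative_subset[OF \<Psi>_deriv]) (auto intro!: convex_upper)
    ultimately have "((\<lambda>t. \<Psi> (?l t)) has_vector_derivative (w - v) * \<psi> (?l t)) (at t within {0..1})"
      using field_vector_diff_chain_within[of ?l "w - v" t "{0..1}" \<Psi>] by (simp add: o_def)
    then have "((\<lambda>t. k * \<Psi> (?l t)) has_vector_derivative k * ((w - v) * \<psi> (?l t))) (at t within {0..1})"
      by (rule has_vector_derivative_mult_right)
    from bounded_linear.has_vector_derivative[OF bounded_linear_Re this] show ?thesis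
      by (simp add: has_vector_derivative_def)
  qed
  then obtain t where "t \<in> {0<..<1}" "Re (k * \<Psi> (?l 1)) - Re (k * \<Psi> (?l 0)) = (1 - 0) * Re (k * ((w - v) * \<psi> (?l t)))"
    using mvt_simple[of 0 1 "\<lambda>t. Re (k * \<Psi> (?l t))" "\<lambda>t h. h * Re (k * ((w - v) * \<psi> (?l t)))"] by auto
  then show ?thesis using that[of t] by (simp add: algebra_simps)
qed

text \<open>
  The open upper half-plane together with the positive real axis. The positive axis is included
  because \<open>J_fun\<close> has to be continuous across it.
\<close>
definition slit_upper :: "complex set" where
  "slit_upper = upper - \<real>\<^sub>\<le>\<^sub>0"

lemma slit_upper_iff: "v \<in> slit_upper \<longleftrightarrow> 0 < Im v \<or> (Im v = 0 \<and> 0 < Re v)"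
  by (auto simp: slit_upper_def upper_def complex_nonpos_Reals_iff)

lemma \<psi>_slope_pos:
  assumes "v \<in> upper" "w \<in> upper" "v \<noteq> w"
  obtains t where "0 < t" "t < 1"
    "cos ((p + q) * pi / 2) * cmod (\<psi> (v + of_real t * (w - v))) \<le>
       Re (cis (- ((p + q) * pi / 2)) * ((\<Psi> w - \<Psi> v) / (w - v)))"
proof -
  let ?k = "cis (- ((p + q) * pi / 2)) / (w - v)"
  obtain t where t: "0 < t" "t < 1" "Re (?k * (\<Psi> w - \<Psi> v)) = Re (?k * (w - v) * \<psi> (v + of_real t * (w - v)))"
    by (rule \<Psi>_mvt[OF assms(1,2)])
  have "?k * (w - v) = cis (- ((p + q) * pi / 2))" using assms(3) by simp
  then have "Re (cis (- ((p + q) * pi / 2)) * ((\<Psi> w - \<Psi> v) / (w - v))) = Re (cis (- ((p + q) * pi / 2)) * \<psi> (v + of_real t * (w - v)))"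
    using t(3) by (simp add: mult.commute)
  also have "\<dots> \<ge> cos ((p + q) * pi / 2) * cmod (\<psi> (v + of_real t * (w - v)))"
    using t assms by (intro \<psi>_sector convex_upper) auto
  finally show ?thesis using that t by blast
qed

text \<open>
  The Noshiro-Warschawski criterion: on a convex set, a derivative with values in a half-plane
  implies injectivity.
\<close>
lemma inj_on_\<Psi>: "inj_on \<Psi> slit_upper"
proof (rule inj_onI, rule ccontr)
  fix v w assume vw: "v \<in> slit_upper" "w \<in> slit_upper" "\<Psi> v = \<Psi> w" "v \<noteq> w"
  then have up: "v \<in> upper" "w \<in> upper" by (auto simp: slit_upper_def)
  obtain t where t: "0 < t" "t < 1" "cos ((p + q) * pi / 2) * cmod (\<psi> (v + of_real t * (w - v))) \<le>
       Re (cis (- ((p + q) * pi / 2)) * ((\<Psi> w - \<Psi> v) / (w - v)))"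
    using \<psi>_slope_pos[OF up \<open>v \<noteq> w\<close>] .
  let ?z = "v + of_real t * (w - v)"
  have z: "Im ?z = (1 - t) * Im v + t * Im w" "Re ?z = (1 - t) * Re v + t * Re w"
    by (simp_all add: algebra_simps)
  have "0 < Im ?z \<or> 0 < Re ?z"
  proof (cases "Im v = 0 \<and> Im w = 0")
    case True
    then have "0 < (1 - t) * Re v + t * Re w"
      using vw t by (intro add_pos_pos mult_pos_pos) (auto simp: slit_upper_iff)
    then show ?thesis unfolding z by simp
  next
    case False
    then have "0 < (1 - t) * Im v \<or> 0 < t * Im w"
      using vw t by (auto simp: slit_upper_iff)
    moreover have "0 \<le> (1 - t) * Im v" "0 \<le> t * Im w"
      using vw t by (auto simp: slit_upper_iff)
    ultimately show ?thesis unfolding z by linarith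
  qed
  then have "\<psi> ?z \<noteq> 0" by (rule \<psi>_nonzero)
  then have "0 < cos ((p + q) * pi / 2) * cmod (\<psi> ?z)" using cos_half_pos by simp
  with t(3) vw(3) show False by simp
qed

text \<open>
  The slopes over \<open>[0, v/2]\<close> and \<open>[v/2, v]\<close> point into the same
  half-plane, so they do not cancel; on the second segment the modulus of \<open>\<psi>\<close>
  is at least \<open>1/m\<close>. Hence \<open>\<Psi>\<close> is proper.
\<close>
lemma \<Psi>_growth:
  assumes "v \<in> upper" "4 \<le> cmod v"
  shows "cos ((p + q) * pi / 2) / (2 * real m) * cmod v \<le> cmod (\<Psi> v)"
proof -
  let ?c = "cos ((p + q) * pi / 2)" and ?e = "cis (- ((p + q) * pi / 2))"
  have v0: "v \<noteq> 0" using assms by auto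
  have up: "v / 2 \<in> upper" "0 \<in> upper" using assms by (auto simp: upper_def)
  obtain t where t: "0 < t" "t < 1" "?c * cmod (\<psi> (v / 2 + of_real t * (v - v / 2))) \<le> Re (?e * ((\<Psi> v - \<Psi> (v / 2)) / (v - v / 2)))"
    by (rule \<psi>_slope_pos[OF up(1) assms(1)]) (use v0 in auto)
  obtain t' where t': "0 < t'" "t' < 1" "?c * cmod (\<psi> (0 + of_real t' * (v / 2 - 0))) \<le> Re (?e * ((\<Psi> (v / 2) - \<Psi> 0) / (v / 2 - 0)))"
    by (rule \<psi>_slope_pos[OF up(2,1)]) (use v0 in auto)
  let ?z = "v / 2 + of_real t * (v - v / 2)"
  have z: "?z = of_real ((1 + t) / 2) * v" by (simp add: field_simps)
  have "cmod ?z = (1 + t) / 2 * cmod v"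
    unfolding z norm_mult norm_of_real using t by simp
  moreover have "(1 / 2) * 4 \<le> (1 + t) / 2 * cmod v" using t assms by (intro mult_mono) auto
  ultimately have z2: "2 \<le> cmod ?z" by simp
  moreover have "cmod ?z \<le> cmod (1 + ?z) + 1"
    using norm_triangle_ineq4[of "1 + ?z" 1] by simp
  ultimately have "1 \<le> cmod (1 + ?z) powr p" "1 \<le> cmod ?z powr q"
    using p_pos q_pos by (intro ge_one_powr_ge_zero; linarith)+
  then have "1 * 1 \<le> cmod (1 + ?z) powr p * cmod ?z powr q"
    by (intro mult_mono) auto
  then have "1 / real m \<le> cmod (\<psi> ?z)"
    unfolding cmod_\<psi> by (intro divide_right_mono) auto
  then have "?c * (1 / real m) \<le> ?c * cmod (\<psi> ?z)"
    using cos_half_pos by (intro mult_left_mono) auto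
  also have "\<dots> \<le> Re (?e * ((\<Psi> v - \<Psi> (v / 2)) / (v / 2)))"
    using t(3) by simp
  also have "\<dots> \<le> Re (?e * ((\<Psi> v - \<Psi> (v / 2)) / (v / 2))) + Re (?e * (\<Psi> (v / 2) / (v / 2)))"
  proof -
    have "0 \<le> ?c * cmod (\<psi> (0 + of_real t' * (v / 2 - 0)))" using cos_half_pos by simp
    with t'(3) show ?thesis by simp
  qed
  also have "\<dots> = Re (?e * (\<Psi> v / (v / 2)))"
    by (simp only: plus_complex.sel[symmetric] distrib_left[symmetric] add_divide_distrib[symmetric] diff_add_cancel)
  also have "\<dots> \<le> cmod (?e * (\<Psi> v / (v / 2)))" by (rule complex_Re_le_cmod)
  also have "\<dots> = 2 * cmod (\<Psi> v) / cmod v" by (simp add: norm_mult norm_divide)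
  finally show ?thesis using v0 m_pos by (simp add: field_simps)
qed

lemma Im_\<psi>_neg:
  assumes "y < 0" "y \<noteq> -1"
  shows "0 < Im (\<psi> (of_real y))"
proof -
  let ?\<theta> = "p * Im (Ln (1 + of_real y)) + q * Im (Ln (of_real y))"
  have y1: "complex_of_real y \<noteq> 0" "complex_of_real y \<noteq> -1"
    using assms by (auto simp: complex_eq_iff)
  have "Im (Ln (of_real y)) = pi" using y1 assms by (simp add: Im_Ln_eq_pi)
  moreover have "1 + complex_of_real y \<noteq> 0" using y1 by (simp add: add_eq_0_iff)
  then have "0 \<le> Im (Ln (1 + of_real y))" "Im (Ln (1 + of_real y)) \<le> pi"
    by (simp_all add: Im_Ln_upper upper_def)
  then have "0 \<le> p * Im (Ln (1 + of_real y))" "p * Im (Ln (1 + of_real y)) \<le> p * pi"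
    using p_pos by (auto intro: mult_left_mono)
  moreover have "p * pi + q * pi < 1 * pi"
    unfolding distrib_right[symmetric] using pq_less by (intro mult_strict_right_mono) auto
  moreover have "0 < q * pi" using q_pos by simp
  ultimately have "0 < ?\<theta>" "?\<theta> < pi" by auto
  then have "0 < sin ?\<theta>" by (rule sin_gt_zero)
  moreover have "0 < cmod (\<psi> (of_real y))" using y1 by (simp add: \<psi>_eq_0_iff)
  ultimately have "0 < Im (of_real (cmod (\<psi> (of_real y))) * cis ?\<theta>)" by simp
  then show ?thesis using \<psi>_polar[OF y1] by simp
qed

text \<open>
  Two boundary segments are treated separately since \<open>\<psi>\<close> vanishes at
  \<open>-1\<close>, where the image of the boundary turns.
\<close>
lemma Im_\<Psi>_neg:
  assumes "x < 0"
  shows "Im (\<Psi> (of_real x)) < 0"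
proof -
  have step: "Im (\<Psi> (of_real x)) < Im (\<Psi> (of_real y))" if "x < y" "y \<le> 0" "-1 \<notin> {x<..<y}" for x y
  proof -
    have up: "complex_of_real y \<in> upper" "complex_of_real x \<in> upper" by (simp_all add: upper_def)
    obtain t where t: "0 < t" "t < 1" "Re (- \<i> * (\<Psi> (of_real x) - \<Psi> (of_real y))) =
        Re (- \<i> * (of_real x - of_real y) * \<psi> (of_real y + of_real t * (of_real x - of_real y)))"
      by (rule \<Psi>_mvt[OF up])
    let ?z = "y + t * (x - y)"
    have "?z = (1 - t) * y + t * x" by (simp add: algebra_simps)
    moreover have "(1 - t) * y + t * x < (1 - t) * y + t * y" "(1 - t) * x + t * x < (1 - t) * y + t * x"
      using t that by simp_all
    ultimately have z: "x < ?z" "?z < y" by (simp_all add: algebra_simps)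
    then have "0 < Im (\<psi> (of_real ?z))" using that by (intro Im_\<psi>_neg) auto
    then have "(x - y) * Im (\<psi> (of_real ?z)) < 0" using that by (intro mult_neg_pos) auto
    then show ?thesis using t(3) by (simp add: algebra_simps)
  qed
  show ?thesis
  proof (cases "x < -1")
    case True
    then show ?thesis using step[of x "-1"] step[of "-1" 0] by simp
  next
    case False
    then show ?thesis using step[of x 0] assms by simp
  qed
qed

lemma \<psi>_pos: "0 < y \<Longrightarrow> \<psi> (of_real y) = of_real ((1 + y) powr p * y powr q / real m)"
  using powr_of_real[of "1 + y" p] powr_of_real[of y q] by (simp add: \<psi>_def)

lemma \<Psi>_pos:
  assumes "0 < x"
  shows "Im (\<Psi> (of_real x)) = 0" "0 < Re (\<Psi> (of_real x))"
proof -
  have up: "0 \<in> upper" "complex_of_real x \<in> upper" by (simp_all add: upper_def)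
  obtain t where t: "0 < t" "t < 1" "Re (- \<i> * (\<Psi> (of_real x) - \<Psi> 0)) = Re (- \<i> * (of_real x - 0) * \<psi> (0 + of_real t * (of_real x - 0)))"
    by (rule \<Psi>_mvt[OF up])
  then show "Im (\<Psi> (of_real x)) = 0" using \<psi>_pos[of "t * x"] assms by simp
  obtain t where t: "0 < t" "t < 1" "Re (1 * (\<Psi> (of_real x) - \<Psi> 0)) = Re (1 * (of_real x - 0) * \<psi> (0 + of_real t * (of_real x - 0)))"
    by (rule \<Psi>_mvt[OF up])
  have "0 < (1 + t * x) powr p * (t * x) powr q / real m"
  proof -
    have "0 < t * x" using t assms by simp
    then have "t * x \<noteq> 0" "1 + t * x \<noteq> 0" by linarith+
    then have "0 < (1 + t * x) powr p" "0 < (t * x) powr q" by (simp_all only: powr_gt_zero simp_thms)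
    then show ?thesis using m_pos by (intro divide_pos_pos mult_pos_pos)
  qed
  from mult_pos_pos[OF assms this]
  have "0 < x * ((1 + t * x) powr p * (t * x) powr q / real m)" .
  moreover have "\<psi> (of_real (t * x)) = of_real ((1 + t * x) powr p * (t * x) powr q / real m)"
    using t(1) assms by (intro \<psi>_pos) simp
  ultimately show "0 < Re (\<Psi> (of_real x))" using t(3) by simp
qed

text \<open>
  The negative real axis is mapped into the lower half-plane, so boundary points do not
  contribute preimages of points of \<open>slit_upper\<close>, except on the positive axis.
\<close>
lemma \<Psi>_preimage:
  assumes "v \<in> upper" "\<Psi> v \<in> slit_upper"
  shows "v \<in> slit_upper" "0 < Im (\<Psi> v) \<Longrightarrow> 0 < Im v"
proof -
  have *: "0 < Im v \<or> (Im v = 0 \<and> 0 < Re v \<and> Im (\<Psi> v) = 0)"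
  proof (cases "Im v = 0")
    case True
    then have v: "v = of_real (Re v)" by (simp add: complex_eq_iff)
    consider "Re v < 0" | "Re v = 0" | "0 < Re v" by linarith
    then show ?thesis
    proof cases
      case 1
      then show ?thesis using Im_\<Psi>_neg[of "Re v"] v assms by (simp add: slit_upper_iff)
    next
      case 2
      then have "v = 0" using True by (simp add: complex_eq_iff)
      then show ?thesis using assms by (simp add: slit_upper_iff)
    next
      case 3
      then show ?thesis using \<Psi>_pos(1)[of "Re v"] v True by simp
    qed
  qed (use assms in \<open>auto simp: upper_def\<close>)
  then show "v \<in> slit_upper" "0 < Im (\<Psi> v) \<Longrightarrow> 0 < Im v" by (auto simp: slit_upper_iff)
qed

text \<open>
  Properness: by the growth estimate, a convergent sequence of values has bounded arguments.
\<close>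
lemma closed_\<Psi>_image:
  assumes "closed A" "A \<subseteq> upper"
  shows "closed (\<Psi> ` A)"
  unfolding closed_sequential_limits
proof (intro allI impI, elim conjE)
  fix y l assume y: "\<forall>n. y n \<in> \<Psi> ` A" and l: "y \<longlonglongrightarrow> l"
  from y have "\<forall>n. \<exists>v. v \<in> A \<and> y n = \<Psi> v" by blast
  from choice[OF this] obtain v where v: "\<And>n. v n \<in> A" "\<And>n. y n = \<Psi> (v n)" by blast
  let ?c = "cos ((p + q) * pi / 2) / (2 * real m)"
  have c: "0 < ?c" using cos_half_pos m_pos by simp
  obtain B where B: "\<And>n. cmod (y n) \<le> B"
    using convergent_imp_Bseq[OF convergentI[OF l]] by (auto simp: Bseq_def)
  have "cmod (v n) \<le> max 4 (B / ?c)" for n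
  proof (cases "4 \<le> cmod (v n)")
    case True
    then have "?c * cmod (v n) \<le> B" using \<Psi>_growth[of "v n"] v assms B[of n] by force
    then have "cmod (v n) \<le> B / ?c" using c by (simp only: pos_le_divide_eq mult.commute)
    then show ?thesis by simp
  qed simp
  then have "\<forall>n. v n \<in> A \<inter> cball 0 (max 4 (B / ?c))" using v by (simp add: dist_norm)
  moreover have "seq_compact (A \<inter> cball 0 (max 4 (B / ?c)))"
    using assms by (intro compact_imp_seq_compact closed_Int_compact) auto
  ultimately obtain a r where ar: "a \<in> A" "strict_mono r" "(v \<circ> r) \<longlonglongrightarrow> a"
    by (metis seq_compactE IntD1)
  have "((\<Psi> \<circ> (v \<circ> r)) \<longlongrightarrow> \<Psi> a) sequentially"
    unfolding o_def[of \<Psi>]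
    by (rule continuous_on_tendsto_compose[OF continuous_on_\<Psi> ar(3)]) (use ar(1) v(1) assms(2) in \<open>auto intro!: always_eventually\<close>)
  moreover have "\<Psi> \<circ> (v \<circ> r) = y \<circ> r" by (rule ext) (simp only: comp_apply v(2))
  moreover have "(y \<circ> r) \<longlonglongrightarrow> l" using l ar(2) by (rule LIMSEQ_subseq_LIMSEQ)
  ultimately have "\<Psi> a = l" using LIMSEQ_unique by metis
  then show "l \<in> \<Psi> ` A" using ar by blast
qed

lemma closed_upper: "closed upper"
  unfolding upper_def by (rule closed_halfspace_Im_ge)

text \<open>
  The image of the open half-plane is open, and by properness it is relatively closed in the
  upper half-plane, because boundary values lie elsewhere. Connectedness leaves only the whole
  half-plane.
\<close>
lemma \<Psi>_surj_upper: "{w. 0 < Im w} \<subseteq> \<Psi> ` {v. 0 < Im v}"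
proof -
  let ?H = "{w. 0 < Im w}"
  have op: "open (\<Psi> ` ?H)"
  proof (rule open_mapping_thm3)
    show "\<Psi> holomorphic_on ?H"
      unfolding holomorphic_on_open[OF open_halfspace_Im_gt] using \<Psi>_deriv_at by blast
    show "inj_on \<Psi> ?H" by (rule inj_on_subset[OF inj_on_\<Psi>]) (auto simp: slit_upper_iff)
  qed (rule open_halfspace_Im_gt)
  have eq: "?H - \<Psi> ` ?H = ?H \<inter> - \<Psi> ` upper"
  proof (intro equalityI subsetI)
    fix w assume w: "w \<in> ?H - \<Psi> ` ?H"
    have "w \<notin> \<Psi> ` upper"
    proof
      assume "w \<in> \<Psi> ` upper"
      then obtain v where v: "v \<in> upper" "w = \<Psi> v" by blast
      have "0 < Im w" using w by blast
      then have pos: "0 < Im (\<Psi> v)" by (simp only: v(2))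
      then have sl: "\<Psi> v \<in> slit_upper" by (simp only: slit_upper_iff simp_thms)
      have "0 < Im v" by (rule \<Psi>_preimage(2)[OF v(1) sl pos])
      then show False using w v(2) by blast
    qed
    then show "w \<in> ?H \<inter> - \<Psi> ` upper" using w by blast
  qed (auto simp: upper_def)
  have "connected ?H" by (rule convex_connected[OF convex_halfspace_Im_gt])
  then have "\<not> (open (\<Psi> ` ?H) \<and> open (?H \<inter> - \<Psi> ` upper) \<and> ?H \<subseteq> \<Psi> ` ?H \<union> (?H \<inter> - \<Psi> ` upper) \<and>
     \<Psi> ` ?H \<inter> (?H \<inter> - \<Psi> ` upper) \<inter> ?H = {} \<and> \<Psi> ` ?H \<inter> ?H \<noteq> {} \<and> (?H \<inter> - \<Psi> ` upper) \<inter> ?H \<noteq> {})"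
    unfolding connected_def by blast
  moreover have "open (?H \<inter> - \<Psi> ` upper)"
    using closed_\<Psi>_image[OF closed_upper order_refl] open_halfspace_Im_gt by (intro open_Int) auto
  \<comment> \<open>The point \<open>\<Psi> (1 + \<i>)\<close> is in both sets: on the segment
    from \<open>1\<close> to \<open>1 + \<i>\<close> the arguments of \<open>v\<close> and
    \<open>1 + v\<close> are less than \<open>\<pi> / 2\<close>, so \<open>\<psi>\<close> has
    positive real part there.\<close>
  moreover have "\<Psi> ` ?H \<inter> ?H \<noteq> {}"
  proof -
    have up: "1 \<in> upper" "1 + \<i> \<in> upper" by (simp_all add: upper_def)
    obtain t where t: "0 < t" "t < 1" "Re (- \<i> * (\<Psi> (1 + \<i>) - \<Psi> 1)) = Re (- \<i> * (1 + \<i> - 1) * \<psi> (1 + of_real t * (1 + \<i> - 1)))"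
      by (rule \<Psi>_mvt[OF up])
    let ?z = "1 + of_real t * \<i>"
    have z: "?z \<noteq> 0" "?z \<noteq> -1" by (auto simp: complex_eq_iff)
    have 1: "\<bar>Im (Ln ?z)\<bar> < pi / 2" by (rule Re_Ln_pos_lt_imp) simp
    have 2: "\<bar>Im (Ln (1 + ?z))\<bar> < pi / 2" by (rule Re_Ln_pos_lt_imp) simp
    have "\<bar>p * Im (Ln (1 + ?z)) + q * Im (Ln ?z)\<bar> \<le> p * \<bar>Im (Ln (1 + ?z))\<bar> + q * \<bar>Im (Ln ?z)\<bar>"
      using p_pos q_pos by (intro order_trans[OF abs_triangle_ineq]) (simp add: abs_mult)
    also have "\<dots> \<le> p * (pi / 2) + q * (pi / 2)"
      using 1 2 p_pos q_pos by (intro add_mono mult_left_mono) auto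
    also have "\<dots> < 1 * (pi / 2)"
      unfolding distrib_right[symmetric] using pq_less by (intro mult_strict_right_mono) auto
    finally have lt: "\<bar>p * Im (Ln (1 + ?z)) + q * Im (Ln ?z)\<bar> < 1 * (pi / 2)" .
    have "0 < cos (p * Im (Ln (1 + ?z)) + q * Im (Ln ?z))"
      by (rule cos_gt_zero_pi) (use lt in linarith)+
    moreover have "0 < cmod (\<psi> ?z)" using z by (simp add: \<psi>_eq_0_iff)
    ultimately have "0 < Re (of_real (cmod (\<psi> ?z)) * cis (p * Im (Ln (1 + ?z)) + q * Im (Ln ?z)))"
      by simp
    moreover have "Re (\<psi> ?z) = Re (of_real (cmod (\<psi> ?z)) * cis (p * Im (Ln (1 + ?z)) + q * Im (Ln ?z)))"
      by (rule arg_cong[OF \<psi>_polar[OF z]])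
    ultimately have "0 < Re (\<psi> ?z)" by (simp only:)
    then have "0 < Im (\<Psi> (1 + \<i>))" using t(3) \<Psi>_pos(1)[of 1] by simp
    then have "\<Psi> (1 + \<i>) \<in> \<Psi> ` ?H \<inter> ?H" by (intro IntI imageI) simp_all
    then show ?thesis by blast
  qed
  ultimately have "(?H \<inter> - \<Psi> ` upper) = {}"
    using op eq by blast
  then show ?thesis using eq by blast
qed

lemma \<Psi>_surj_pos:
  assumes "0 < r"
  obtains x where "0 < x" "\<Psi> (of_real x) = of_real r"
proof -
  let ?c = "cos ((p + q) * pi / 2) / (2 * real m)"
  have c: "0 < ?c" using cos_half_pos m_pos by simp
  let ?R = "max 4 (r / ?c)"
  let ?f = "\<lambda>x. Re (\<Psi> (of_real x))"
  have "r / ?c \<le> ?R" by simp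
  then have "r \<le> ?c * ?R" using c by (simp only: pos_divide_le_eq mult.commute)
  also have "\<dots> \<le> cmod (\<Psi> (of_real ?R))"
    using \<Psi>_growth[of "of_real ?R"] by (simp add: upper_def)
  also have "\<dots> = ?f ?R"
  proof -
    have "0 < ?R" by simp
    from \<Psi>_pos[OF this] show ?thesis unfolding cmod_def by simp
  qed
  finally have "r \<le> ?f ?R" .
  moreover have "?f 0 \<le> r" using assms by simp
  moreover have "continuous_on {0..?R} ?f"
    by (intro continuous_on_Re continuous_on_compose2[OF continuous_on_\<Psi>] continuous_intros) (auto simp: upper_def)
  moreover have "0 \<le> ?R" by simp
  ultimately obtain x where x: "0 \<le> x" "?f x = r"
    using IVT'[of ?f 0 r ?R] by blast
  then have "x \<noteq> 0" using assms by auto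
  then have "0 < x" using x by simp
  then show ?thesis using x \<Psi>_pos(1)[of x] by (intro that[of x]) (auto simp: complex_eq_iff)
qed

definition K :: "complex \<Rightarrow> complex" where
  "K w = inv_into slit_upper \<Psi> w"

lemma K:
  assumes "w \<in> slit_upper"
  shows "K w \<in> slit_upper" "\<Psi> (K w) = w"
proof -
  have "w \<in> \<Psi> ` slit_upper"
  proof (cases "0 < Im w")
    case True
    then show ?thesis using \<Psi>_surj_upper by (force simp: slit_upper_iff)
  next
    case False
    then have "0 < Re w" "w = of_real (Re w)" using assms by (auto simp: slit_upper_iff complex_eq_iff)
    with \<Psi>_surj_pos[of "Re w"] obtain x where "0 < x" "\<Psi> (of_real x) = w" by metis
    then show ?thesis by (intro image_eqI[of _ _ "of_real x"]) (auto simp: slit_upper_iff)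
  qed
  then show "K w \<in> slit_upper" "\<Psi> (K w) = w"
    unfolding K_def by (auto intro: inv_into_into f_inv_into_f)
qed

lemma K_\<Psi>: "v \<in> slit_upper \<Longrightarrow> K (\<Psi> v) = v"
  unfolding K_def using inj_on_\<Psi> by (rule inv_into_f_f)

lemma K_upper: "0 < Im w \<Longrightarrow> 0 < Im (K w)"
proof -
  assume w: "0 < Im w"
  then have "w \<in> slit_upper" by (simp add: slit_upper_iff)
  note K[OF this]
  moreover from this have "K w \<in> upper" by (simp add: slit_upper_def)
  ultimately show ?thesis
    using w \<Psi>_preimage(2)[of "K w"] \<open>w \<in> slit_upper\<close> by simp
qed

lemma K_pos:
  assumes "0 < r"
  obtains x where "0 < x" "K (of_real r) = of_real x"
proof -
  obtain x where x: "0 < x" "\<Psi> (of_real x) = of_real r" using \<Psi>_surj_pos[OF assms] .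
  have "K (\<Psi> (of_real x)) = of_real x" using x(1) by (intro K_\<Psi>) (simp add: slit_upper_iff)
  then show ?thesis unfolding x(2) by (rule that[OF x(1)])
qed

text \<open>
  The map \<open>\<Psi>\<close> sends closed subsets of the closed half-plane to closed sets.
\<close>
lemma continuous_on_K: "continuous_on slit_upper K"
  unfolding continuous_on_closed_invariant
proof (intro allI impI)
  fix B :: "complex set" assume B: "closed B"
  have "closed (\<Psi> ` (B \<inter> upper))"
    using B closed_upper by (intro closed_\<Psi>_image closed_Int) auto
  moreover have "\<Psi> ` (B \<inter> upper) \<inter> slit_upper = K -` B \<inter> slit_upper"
  proof (intro equalityI subsetI)
    fix w assume w: "w \<in> \<Psi> ` (B \<inter> upper) \<inter> slit_upper"
    then obtain v where v: "v \<in> B" "v \<in> upper" "w = \<Psi> v" by blast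
    have "\<Psi> v \<in> slit_upper" using w unfolding v(3) by blast
    then have "v \<in> slit_upper" by (rule \<Psi>_preimage(1)[OF v(2)])
    then have "K w = v" unfolding v(3) by (rule K_\<Psi>)
    then show "w \<in> K -` B \<inter> slit_upper" using w v(1) by blast
  next
    fix w assume w: "w \<in> K -` B \<inter> slit_upper"
    then have "w = \<Psi> (K w)" "K w \<in> upper" using K[of w] by (auto simp: slit_upper_def)
    then show "w \<in> \<Psi> ` (B \<inter> upper) \<inter> slit_upper"
      using w by (intro IntI image_eqI[of w \<Psi> "K w"]) simp_all
  qed
  ultimately show "\<exists>A. closed A \<and> A \<inter> slit_upper = K -` B \<inter> slit_upper" by blast
qed

end

section \<open>The functions I and J\<close>

lemma Im_inverse_pos_iff: "0 < Im (inverse w) \<longleftrightarrow> Im w < 0"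
proof (cases "w = 0")
  case False
  then have "0 < (Re w)\<^sup>2 + (Im w)\<^sup>2" by (simp add: complex_neq_0)
  then have "0 < - Im w / ((Re w)\<^sup>2 + (Im w)\<^sup>2) \<longleftrightarrow> 0 < - Im w"
    by (simp only: zero_less_divide_iff) auto
  then show ?thesis by (simp only: inverse_complex.sel neg_0_less_iff_less)
qed simp

lemma Ln_inverse_power:
  assumes "u \<noteq> 0" "- pi < - (real m * Im (Ln u))" "- (real m * Im (Ln u)) \<le> pi"
  shows "Ln (inverse (u ^ m)) = - (of_nat m * Ln u)"
proof (rule Ln_unique)
  show "exp (- (of_nat m * Ln u)) = inverse (u ^ m)"
    using assms(1) by (simp add: exp_minus exp_of_nat_mult)
qed (use assms in simp_all)

context sector_map
begin

lemma sector_Im_Ln: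
  assumes "u \<in> sector m"
  shows "u \<noteq> 0" "\<bar>real m * Im (Ln u)\<bar> < pi"
proof -
  show u0: "u \<noteq> 0" using assms by (simp add: sector_def)
  then have "- (pi / real m) < Im (Ln u)" "Im (Ln u) < pi / real m"
    using assms by (simp_all add: sector_def Arg_eq_Im_Ln)
  then have "real m * - (pi / real m) < real m * Im (Ln u)" "real m * Im (Ln u) < real m * (pi / real m)"
    using m_pos by (simp_all only: mult_less_cancel_left_pos)
  then show "\<bar>real m * Im (Ln u)\<bar> < pi" using m_pos by (simp add: abs_less_iff)
qed

lemma Ln_inverse_power_sector:
  assumes "u \<in> sector m"
  shows "Ln (inverse (u ^ m)) = - (of_nat m * Ln u)"
  by (rule Ln_inverse_power) (use sector_Im_Ln[OF assms] in linarith)+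

lemma root_inverse_power:
  assumes "u \<in> sector m"
  shows "inverse (u ^ m) powr of_real (- (1 / real m)) = u"
  using sector_Im_Ln[OF assms] m_pos by (simp add: powr_def Ln_inverse_power_sector[OF assms])

lemma Ln_root:
  assumes "v \<notin> \<real>\<^sub>\<le>\<^sub>0"
  shows "Ln (v powr of_real (- (1 / real m))) = - (Ln v / of_nat m)"
proof (rule Ln_unique)
  have v0: "v \<noteq> 0" using assms by auto
  then show "exp (- (Ln v / of_nat m)) = v powr of_real (- (1 / real m))"
    by (simp add: powr_def)
  have "\<bar>Im (Ln v)\<bar> < pi"
    using Im_Ln_less_pi[OF assms] mpi_less_Im_Ln[OF v0] by (simp add: abs_less_iff)
  moreover have "\<bar>Im (Ln v)\<bar> / real m \<le> \<bar>Im (Ln v)\<bar> / 1"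
    using m_pos by (intro divide_left_mono) auto
  ultimately have "\<bar>Im (Ln v) / real m\<bar> < pi" by simp
  then have "- pi < - (Im (Ln v) / real m)" "- (Im (Ln v) / real m) \<le> pi" by linarith+
  then show "- pi < Im (- (Ln v / of_nat m))" "Im (- (Ln v / of_nat m)) \<le> pi"
    by simp_all
qed

lemma root_mem_sector:
  assumes "v \<notin> \<real>\<^sub>\<le>\<^sub>0"
  shows "v powr of_real (- (1 / real m)) \<in> sector m"
proof -
  have v0: "v \<noteq> 0" using assms by auto
  have b: "- pi < Im (Ln v)" "Im (Ln v) < pi"
    using Im_Ln_less_pi[OF assms] mpi_less_Im_Ln[OF v0] by auto
  have n0: "v powr of_real (- (1 / real m)) \<noteq> 0" using v0 by (simp add: powr_def)
  have "Arg (v powr of_real (- (1 / real m))) = - (Im (Ln v) / real m)"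
    unfolding Arg_eq_Im_Ln[OF n0] Ln_root[OF assms] by simp
  moreover have "Im (Ln v) / real m < pi / real m" "- pi / real m < Im (Ln v) / real m"
    using b m_pos by (intro divide_strict_right_mono; simp)+
  ultimately show ?thesis using n0 by (simp add: sector_def)
qed

lemma inverse_power_root:
  fixes v :: complex
  assumes "v \<noteq> 0"
  shows "inverse ((v powr of_real (- (1 / real m))) ^ m) = v"
proof -
  have "(v powr of_real (- (1 / real m))) ^ m = exp (of_nat m * (of_real (- (1 / real m)) * Ln v))"
    using assms by (simp only: powr_def assms if_False exp_of_nat_mult)
  also have "of_nat m * (of_real (- (1 / real m)) * Ln v) = - Ln v"
    using m_pos by simp
  finally show ?thesis using assms by (simp add: exp_minus)
qed

lemma Im_root_neg:
  assumes "0 < Im v"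
  shows "Im (v powr of_real (- (1 / real m))) < 0"
proof -
  have v: "v \<notin> \<real>\<^sub>\<le>\<^sub>0" "v \<noteq> 0" using assms by (auto simp: complex_nonpos_Reals_iff)
  let ?u = "v powr of_real (- (1 / real m))"
  have u0: "?u \<noteq> 0" using v by (simp add: powr_def)
  have b: "0 < Im (Ln v)" "Im (Ln v) < pi" using Im_Ln_pos_lt_imp[OF assms] by auto
  have "Im (Ln ?u) = - (Im (Ln v) / real m)" unfolding Ln_root[OF v(1)] by simp
  moreover have "Im (Ln v) / real m \<le> Im (Ln v) / 1"
    using m_pos b by (intro divide_left_mono) auto
  moreover have "0 < Im (Ln v) / real m" using b m_pos by simp
  ultimately have "Im (Ln ?u) < 0" "- pi < Im (Ln ?u)" using b by auto
  then have "\<not> (0 \<le> Im (Ln ?u) \<and> Im (Ln ?u) \<le> pi)" by simp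
  then have "\<not> 0 \<le> Im ?u" unfolding Im_Ln_pos_le[OF u0] .
  then show ?thesis by simp
qed

lemma Im_inverse_power_pos:
  assumes "u \<in> sector m" "Im u < 0"
  shows "0 < Im (inverse (u ^ m))"
proof -
  note u = sector_Im_Ln[OF assms(1)]
  have "\<not> (0 \<le> Im (Ln u) \<and> Im (Ln u) \<le> pi)" using Im_Ln_pos_le[OF u(1)] assms by simp
  moreover have "Im (Ln u) \<le> pi" by (rule Im_Ln_le_pi[OF u(1)])
  ultimately have "Im (Ln u) < 0" by simp
  then have "real m * Im (Ln u) < 0" using m_pos by (simp add: mult_pos_neg)
  then have "0 < Im (Ln (inverse (u ^ m))) \<and> Im (Ln (inverse (u ^ m))) < pi"
    unfolding Ln_inverse_power_sector[OF assms(1)] using u(2) by simp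
  then show ?thesis using Im_Ln_pos_lt[of "inverse (u ^ m)"] u(1) by simp
qed

text \<open>
  The arguments of \<open>v\<close> and \<open>1 + 1/v\<close> have opposite signs, so their
  sum does not leave the principal range.
\<close>
lemma shifted_powr:
  assumes "0 < Im v"
  shows "(1 + v) powr of_real p = v powr of_real p * (1 + inverse v) powr of_real p"
proof -
  have v0: "v \<noteq> 0" using assms by auto
  have "Im (inverse v) < 0" using assms Im_inverse_pos_iff[of "inverse v"] by (simp only: inverse_inverse_eq)
  then have i: "Im (1 + inverse v) < 0" by (simp only: plus_complex.sel one_complex.sel add_0_left)
  then have i0: "1 + inverse v \<noteq> 0" by (metis less_irrefl zero_complex.sel(2))
  have "\<not> (0 \<le> Im (Ln (1 + inverse v)) \<and> Im (Ln (1 + inverse v)) \<le> pi)"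
    unfolding Im_Ln_pos_le[OF i0] using i by simp
  then have "Im (Ln (1 + inverse v)) < 0" using Im_Ln_le_pi[OF i0] by simp
  moreover have "- pi < Im (Ln (1 + inverse v))" by (rule mpi_less_Im_Ln[OF i0])
  moreover have "0 < Im (Ln v)" "Im (Ln v) < pi" using Im_Ln_pos_lt_imp[OF assms] by auto
  ultimately have "Ln (v * (1 + inverse v)) = Ln v + Ln (1 + inverse v)"
    using v0 i0 by (intro Ln_times_simple) auto
  moreover have e: "v * (1 + inverse v) = 1 + v" using v0 by (simp add: distrib_left)
  ultimately have "Ln (1 + v) = Ln v + Ln (1 + inverse v)" by simp
  moreover have "1 + v \<noteq> 0" using v0 i0 e by (metis mult_eq_0_iff)
  ultimately show ?thesis using v0 i0 by (simp add: powr_def exp_add distrib_left)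
qed

lemma set_integrable_I_integrand:
  "set_integrable lborel {1<..} (\<lambda>t. (1 + (complex_of_real t * u) ^ m) powr of_real p / complex_of_real t ^ (S + 1))"
  if cont: "continuous_on {0<..} (\<lambda>t. (1 + (complex_of_real t * u) ^ m) powr of_real p / complex_of_real t ^ (S + 1))"
proof -
  let ?g = "\<lambda>t. (1 + (complex_of_real t * u) ^ m) powr of_real p / complex_of_real t ^ (S + 1)"
  define C where "C = (1 + cmod u ^ m) powr p"
  have sq: "set_integrable lborel (einterval 1 \<infinity>) (\<lambda>t::real. 1 / t\<^sup>2)"
  proof (rule interval_integral_FTC_nonneg(1)[where F = "\<lambda>t. - 1 / t" and A = "-1" and B = 0])
    show "DERIV (\<lambda>t. - 1 / t) t :> 1 / t\<^sup>2" if "1 < ereal t" for t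
      using that by (auto intro!: derivative_eq_intros simp: power2_eq_square)
    show "isCont (\<lambda>t::real. 1 / t\<^sup>2) t" if "1 < ereal t" for t
      using that by (auto intro!: continuous_intros)
    show "(((\<lambda>t. - 1 / t) \<circ> real_of_ereal) \<longlongrightarrow> - 1) (at_right 1)"
      unfolding one_ereal_def ereal_tendsto_simps by (auto intro!: tendsto_eq_intros)
    show "(((\<lambda>t. - 1 / t) \<circ> real_of_ereal) \<longlongrightarrow> 0) (at_left \<infinity>)"
      unfolding ereal_tendsto_simps by real_asymp
  qed auto
  have ei: "einterval 1 \<infinity> = {1::real<..}" by (auto simp: einterval_def)
  have "set_integrable lborel {1<..} (\<lambda>t::real. C * (1 / t\<^sup>2))"
    using sq unfolding ei by (rule set_integrable_mult_right)
  then show ?thesis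
  proof (rule set_integrable_bound)
    have "continuous_on {1<..} ?g" by (rule continuous_on_subset[OF cont]) auto
    then show "set_borel_measurable lborel {1<..} ?g"
      unfolding set_borel_measurable_def using borel_measurable_continuous_on_indicator[of "{1<..}" ?g] by simp
    have "cmod (?g t) \<le> C * (1 / t\<^sup>2)" if t: "1 < t" for t
    proof -
      have "cmod (1 + (complex_of_real t * u) ^ m) \<le> 1 + (t * cmod u) ^ m"
        using t by (intro order_trans[OF norm_triangle_ineq]) (simp add: norm_power norm_mult)
      also have "\<dots> \<le> t ^ m + (t * cmod u) ^ m"
        using t by (intro add_right_mono one_le_power) auto
      also have "\<dots> = t ^ m * (1 + cmod u ^ m)"
        by (simp add: power_mult_distrib distrib_left)
      finally have "cmod (1 + (complex_of_real t * u) ^ m) powr p \<le> (t ^ m * (1 + cmod u ^ m)) powr p"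
        using p_pos by (intro powr_mono2) auto
      also have "\<dots> = (t ^ m) powr p * C"
        unfolding C_def by (simp add: powr_mult)
      also have "(t ^ m) powr p = t ^ \<beta>"
      proof -
        have "(t ^ m) powr p = (t powr real m) powr p" using t by (simp add: powr_realpow)
        also have "\<dots> = t powr real \<beta>" using m_pos by (simp add: powr_powr p_def)
        finally show ?thesis using t by (simp add: powr_realpow)
      qed
      finally have "cmod (1 + (complex_of_real t * u) ^ m) powr p \<le> t ^ \<beta> * C" .
      then have "cmod (?g t) \<le> t ^ \<beta> * C / t ^ (S + 1)"
        unfolding norm_divide cmod_powr_real norm_power norm_of_real using t by (simp add: divide_right_mono)
      also have "\<dots> = C * (t ^ \<beta> / t ^ (S + 1))" by simp
      also have "t ^ \<beta> / t ^ (S + 1) \<le> 1 / t\<^sup>2"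
      proof -
        have "t ^ (\<beta> + 2) \<le> t ^ (S + 1)"
          using t sum_eq \<gamma>_pos m_pos by (intro power_increasing) auto
        then have "t ^ \<beta> * t\<^sup>2 \<le> t ^ (S + 1)" by (simp only: power_add)
        then show ?thesis using t by (simp add: divide_simps)
      qed
      finally show ?thesis by (simp add: C_def mult_left_mono)
    qed
    then show "AE t\<in>{1<..} in lborel. norm (?g t) \<le> norm (C * (1 / t\<^sup>2))"
      by (intro AE_I2) (auto simp: C_def)
  qed
qed

text \<open>
  With \<open>v(t) = (t u) powr (-m)\<close> the function \<open>- \<Psi> (v(t))\<close>
  is a primitive of the integrand, and it tends to \<open>- \<Psi> 0 = 0\<close> at
  infinity.
\<close>
lemma I_fun_eq:
  assumes u: "u \<in> sector m" "Im u < 0"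
  shows "I_fun m S \<beta> u = \<Psi> (inverse (u ^ m))"
proof -
  let ?g = "\<lambda>t. (1 + (complex_of_real t * u) ^ m) powr of_real p / complex_of_real t ^ (S + 1)"
  let ?v = "\<lambda>t. inverse ((complex_of_real t * u) ^ m)"
  have u0: "u \<noteq> 0" using sector_Im_Ln[OF u(1)] by simp
  have v_pos: "0 < Im (?v t)" if "0 < t" for t
  proof -
    have "?v t = of_real (inverse (t ^ m)) * inverse (u ^ m)"
      by (simp add: power_mult_distrib)
    then have "Im (?v t) = inverse (t ^ m) * Im (inverse (u ^ m))"
      by (simp only: times_complex.sel Re_complex_of_real Im_complex_of_real mult_zero_left add_0_right)
    then show ?thesis using Im_inverse_power_pos[OF u] that by (simp only: mult_pos_pos positive_imp_inverse_positive zero_less_power)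
  qed
  have base: "Im (1 + (complex_of_real t * u) ^ m) < 0" if "0 < t" for t
    using v_pos[OF that] unfolding Im_inverse_pos_iff by simp
  have cont: "continuous_on {0<..} ?g"
  proof (intro continuous_on_divide continuous_on_powr_complex continuous_intros)
    show "{0<..} \<subseteq> {t. 0 \<le> Re (1 + (complex_of_real t * u) ^ m) \<or> Im (1 + (complex_of_real t * u) ^ m) \<noteq> 0}"
      using base by force
  qed (use p_pos in auto)
  have Ln_v: "Ln (?v t) = - (of_nat m * Ln u) - of_nat m * of_real (ln t)" if "0 < t" for t
  proof -
    have "Ln (complex_of_real t * u) = of_real (ln t) + Ln u"
      using that u0 by (simp add: Ln_times_of_real Ln_of_real)
    moreover have "Ln (?v t) = - (of_nat m * Ln (complex_of_real t * u))"
      using sector_Im_Ln[OF u(1)] that calculation by (intro Ln_inverse_power) auto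
    ultimately show ?thesis by (simp add: algebra_simps)
  qed
  have deriv: "((\<lambda>t. - \<Psi> (?v t)) has_vector_derivative (inverse (u ^ S) * ?g t)) (at t)" if t: "0 < t" for t
  proof -
    have t0: "complex_of_real t \<noteq> 0" using t by simp
    have "((\<lambda>t. inverse ((complex_of_real t * u) ^ m)) has_vector_derivative - (of_nat m * ?v t / of_real t)) (at t)"
    proof -
      obtain k where k: "m = Suc k" using m_pos by (cases m) auto
      let ?P = "(complex_of_real t * u) ^ m"
      have P0: "?P \<noteq> 0" using t0 u0 by simp
      have "((\<lambda>z. z * u) has_field_derivative u) (at (complex_of_real t))"
        by (auto intro!: derivative_eq_intros)
      from DERIV_power_Suc[OF this, of k]
      have "((\<lambda>z. (z * u) ^ m) has_field_derivative (1 + of_nat k) * (u * (of_real t * u) ^ k)) (at (complex_of_real t))"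
        unfolding k .
      moreover have "(1 + of_nat k) * (u * (of_real t * u) ^ k) = of_nat m * (?P / of_real t)"
        using t0 by (simp add: k)
      ultimately have "((\<lambda>z. (z * u) ^ m) has_field_derivative of_nat m * (?P / of_real t)) (at (complex_of_real t))"
        by (simp only:)
      from DERIV_inverse'[OF this P0]
      have "((\<lambda>z. inverse ((z * u) ^ m)) has_field_derivative - (inverse ?P * (of_nat m * (?P / of_real t)) * inverse ?P)) (at (complex_of_real t))" .
      moreover have "inverse ?P * (of_nat m * (?P / of_real t)) * inverse ?P = of_nat m * inverse ?P / of_real t"
      proof -
        have "inverse X * (c * (X / r)) * inverse X = c * inverse X / r" if "X \<noteq> 0" for X c r :: complex
          using that by simp
        then show ?thesis using P0 by blast
      qed
      ultimately have "((\<lambda>z. inverse ((z * u) ^ m)) has_field_derivative - (of_nat m * inverse ((of_real t * u) ^ m) / of_real t)) (at (complex_of_real t))"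
        by (simp only:)
      then show ?thesis by (rule has_vector_derivative_real_field)
    qed
    moreover have "((\<lambda>v. - \<Psi> v) has_field_derivative - \<psi> (?v t)) (at (?v t))"
      by (intro DERIV_minus \<Psi>_deriv_at v_pos t)
    ultimately have "((\<lambda>t. - \<Psi> (?v t)) has_vector_derivative (- (of_nat m * ?v t / of_real t) * - \<psi> (?v t))) (at t)"
      by (rule field_vector_diff_chain_at[of ?v _ t "\<lambda>v. - \<Psi> v", unfolded o_def])
    moreover have "- (of_nat m * ?v t / of_real t) * - \<psi> (?v t) = inverse (u ^ S) * ?g t"
    proof -
      have v0: "?v t \<noteq> 0" using v_pos[OF t] by auto
      have "?v t powr of_real p * ?v t powr of_real q * ?v t = ?v t powr of_real p * ?v t powr of_real q * ?v t powr of_real 1"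
        using v0 by simp
      also have "\<dots> = exp (of_real (p + q + 1) * Ln (?v t))"
        using v0 by (simp only: powr_def if_False exp_add[symmetric] of_real_add distrib_right)
      also have "of_real (p + q + 1) * Ln (?v t) = - (of_nat S * Ln u) - of_nat S * of_real (ln t)"
        unfolding Ln_v[OF t] S_over_m[symmetric] using m_pos by (simp add: field_simps)
      also have "exp \<dots> = inverse (u ^ S) * inverse (of_real t ^ S)"
        using u0 t by (simp add: exp_diff exp_minus exp_of_nat_mult exp_of_real divide_inverse)
      finally have e: "?v t powr of_real p * ?v t powr of_real q * ?v t = inverse (u ^ S) * inverse (of_real t ^ S)" .
      have "- (of_nat m * ?v t / of_real t) * - \<psi> (?v t) =
         (?v t powr of_real p * ?v t powr of_real q * ?v t) * (1 + inverse (?v t)) powr of_real p / of_real t"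
        unfolding \<psi>_def shifted_powr[OF v_pos[OF t]] using m_pos by simp
      also have "inverse (?v t) = (complex_of_real t * u) ^ m" by simp
      finally show ?thesis unfolding e by (simp add: divide_inverse mult_ac)
    qed
    ultimately show ?thesis by (simp only:)
  qed
  have "(LBINT t=1..\<infinity>. inverse (u ^ S) * ?g t) = 0 - (- \<Psi> (?v 1))"
  proof (rule interval_integral_FTC_integrable)
    show "((\<lambda>t. - \<Psi> (?v t)) has_vector_derivative (inverse (u ^ S) * ?g t)) (at t)" if "1 < ereal t" for t
      using that by (intro deriv) auto
    show "isCont (\<lambda>t. inverse (u ^ S) * ?g t) t" if "1 < ereal t" for t
      using that by (intro isCont_mult continuous_const continuous_on_interior[OF cont]) (auto simp: interior_open)
    have ei: "einterval 1 \<infinity> = {1::real<..}" by (auto simp: einterval_def)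
    show "set_integrable lborel (einterval 1 \<infinity>) (\<lambda>t. inverse (u ^ S) * ?g t)"
      unfolding ei by (intro set_integrable_mult_right set_integrable_I_integrand cont)
    have "isCont (\<lambda>t. - \<Psi> (?v t)) 1"
      using deriv[of 1] by (intro has_vector_derivative_continuous) auto
    then show "(((\<lambda>t. - \<Psi> (?v t)) \<circ> real_of_ereal) \<longlongrightarrow> - \<Psi> (?v 1)) (at_right 1)"
      unfolding one_ereal_def ereal_tendsto_simps by (simp add: isCont_def filterlim_at_split)
    show "(((\<lambda>t. - \<Psi> (?v t)) \<circ> real_of_ereal) \<longlongrightarrow> 0) (at_left \<infinity>)"
      unfolding ereal_tendsto_simps
    proof -
      have "((\<lambda>t::real. inverse (t ^ m)) \<longlongrightarrow> 0) at_top"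
        using m_pos by (intro tendsto_inverse_0_at_top filterlim_pow_at_top filterlim_ident) auto
      then have "((\<lambda>t. of_real (inverse (t ^ m)) * inverse (u ^ m)) \<longlongrightarrow> of_real 0 * inverse (u ^ m)) at_top"
        by (intro tendsto_intros)
      then have "(?v \<longlongrightarrow> 0) at_top"
        by (simp add: power_mult_distrib)
      moreover have "\<forall>\<^sub>F t in at_top. ?v t \<in> upper"
        using eventually_gt_at_top[of 0] by eventually_elim (use v_pos in \<open>force simp: upper_def\<close>)
      ultimately have "((\<lambda>t. \<Psi> (?v t)) \<longlongrightarrow> \<Psi> 0) at_top"
        by (intro continuous_on_tendsto_compose[OF continuous_on_\<Psi>]) (auto simp: upper_def)
      then show "((\<lambda>t. - \<Psi> (?v t)) \<longlongrightarrow> 0) at_top"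
        using tendsto_minus by fastforce
    qed
  qed auto
  then have "(LINT t:{1<..}|lborel. inverse (u ^ S) * ?g t) = \<Psi> (inverse (u ^ m))"
    unfolding one_ereal_def interval_integral_to_infinity_eq by simp
  moreover have "(LINT t:{1..}|lborel. inverse (u ^ S) * ?g t) = (LINT t:{1<..}|lborel. inverse (u ^ S) * ?g t)"
  proof -
    have c: "continuous_on {1..} (\<lambda>t. inverse (u ^ S) * ?g t)"
      by (intro continuous_intros continuous_on_subset[OF cont]) auto
    show ?thesis
      unfolding set_lebesgue_integral_def
    proof (rule integral_cong_AE)
      show "(\<lambda>t. indicator {1..} t *\<^sub>R (inverse (u ^ S) * ?g t)) \<in> borel_measurable lborel"
        using borel_measurable_continuous_on_indicator[OF _ c] by simp
      show "(\<lambda>t. indicator {1<..} t *\<^sub>R (inverse (u ^ S) * ?g t)) \<in> borel_measurable lborel"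
        using borel_measurable_continuous_on_indicator[OF _ continuous_on_subset[OF c], of "{1<..}"] by auto
      show "AE t in lborel. indicator {1..} t *\<^sub>R (inverse (u ^ S) * ?g t) = indicator {1<..} t *\<^sub>R (inverse (u ^ S) * ?g t)"
        using AE_lborel_singleton[of 1] by eventually_elim (auto simp: indicator_def)
    qed
  qed
  moreover have "I_fun m S \<beta> u = (LINT t:{1..}|lborel. inverse (u ^ S) * ?g t)"
  proof -
    have "(of_nat \<beta> / of_nat m :: complex) = of_real p" by (simp add: p_def)
    then show ?thesis
      unfolding I_fun_def set_integral_mult_right by (simp add: divide_inverse)
  qed
  ultimately show ?thesis by simp
qed

lemma I_fun_cnj:
  assumes "u \<in> sector m" "Im u < 0"
  shows "I_fun m S \<beta> (cnj u) = cnj (I_fun m S \<beta> u)"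
proof -
  let ?g = "\<lambda>u t. (1 + (complex_of_real t * u) ^ m) powr (of_nat \<beta> / of_nat m) / complex_of_real t ^ (S + 1)"
  have "?g (cnj u) t = cnj (?g u t)" if "1 \<le> t" for t
  proof -
    have "0 < Im (inverse (u ^ m))" by (rule Im_inverse_power_pos[OF assms])
    then have "Im (u ^ m) < 0" by (simp only: Im_inverse_pos_iff)
    moreover have "(complex_of_real t * u) ^ m = of_real (t ^ m) * u ^ m"
      by (simp add: power_mult_distrib)
    ultimately have "Im (1 + (complex_of_real t * u) ^ m) \<noteq> 0" using that by auto
    then have "cnj ((1 + (complex_of_real t * u) ^ m) powr (of_nat \<beta> / of_nat m)) =
       cnj (1 + (complex_of_real t * u) ^ m) powr cnj (of_nat \<beta> / of_nat m)"
      by (intro cnj_powr) auto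
    then show ?thesis by simp
  qed
  then have "(LINT t:{1..}|lborel. ?g (cnj u) t) = (LINT t:{1..}|lborel. cnj (?g u t))"
    by (intro set_lebesgue_integral_cong) auto
  also have "\<dots> = cnj (LINT t:{1..}|lborel. ?g u t)"
    unfolding set_lebesgue_integral_def complex_cnj_scaleR[symmetric] by (rule Bochner_Integration.integral_cnj)
  finally show ?thesis unfolding I_fun_def by simp
qed

lemma sector_cnj:
  assumes "u \<in> sector m"
  shows "cnj u \<in> sector m"
proof -
  note u = sector_Im_Ln[OF assms]
  have "1 * \<bar>Im (Ln u)\<bar> \<le> real m * \<bar>Im (Ln u)\<bar>"
    using m_pos by (intro mult_right_mono) auto
  also have "\<dots> < pi" using u(2) by (simp add: abs_mult)
  finally have "Im (Ln u) \<noteq> pi" by auto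
  then have "u \<notin> \<real>\<^sub>\<le>\<^sub>0"
    using u(1) by (auto simp: Im_Ln_eq_pi complex_nonpos_Reals_iff complex_eq_iff)
  then have "Ln (cnj u) = cnj (Ln u)" by (rule cnj_Ln[symmetric])
  then have "Arg (cnj u) = - Arg u" using u(1) by (simp add: Arg_eq_Im_Ln)
  then show ?thesis using assms by (auto simp: sector_def)
qed

text \<open>
  A function with the properties that characterise \<open>J_fun\<close>; it is needed to know
  that the choice in the definition of \<open>J_fun\<close> is not arbitrary.
\<close>
definition J_branch :: "complex \<Rightarrow> complex" where
  "J_branch w = (if 0 \<le> Im w then K w powr of_real (- (1 / real m))
     else cnj (K (cnj w) powr of_real (- (1 / real m))))"

lemma J_branch_props:
  shows "continuous_on (- \<real>\<^sub>\<le>\<^sub>0) J_branch"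
    and "J_branch ` (- \<real>\<^sub>\<le>\<^sub>0) \<subseteq> sector m"
    and "Im z < 0 \<Longrightarrow> J_branch z \<in> sector m \<and> Im (J_branch z) > 0 \<and> I_fun m S \<beta> (J_branch z) = z"
    and "Im z > 0 \<Longrightarrow> J_branch z = cnj (J_branch (cnj z))"
proof -
  let ?r = "\<lambda>w. K w powr of_real (- (1 / real m))"
  have Ks: "K w \<notin> \<real>\<^sub>\<le>\<^sub>0" if "w \<in> slit_upper" for w
    using K(1)[OF that] by (simp add: slit_upper_def)
  have r_cont: "continuous_on slit_upper ?r"
  proof (intro continuous_on_powr_complex continuous_on_K continuous_on_const)
    show "slit_upper \<subseteq> {w. 0 \<le> Re (K w) \<or> Im (K w) \<noteq> 0}"
      using Ks by (force simp: complex_nonpos_Reals_iff)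
    show "0 < Re (complex_of_real (- (1 / real m)))" if "w \<in> slit_upper" "K w = 0" for w
      using Ks[OF that(1)] that(2) by simp
  qed
  note sec_cnj = sector_cnj
  have sec: "?r w \<in> sector m" if "w \<in> slit_upper" for w
    using Ks[OF that] by (rule root_mem_sector)
  have slit_cnj: "cnj w \<in> slit_upper" if "w \<notin> \<real>\<^sub>\<le>\<^sub>0" "Im w \<le> 0" for w
    using that by (auto simp: slit_upper_iff complex_nonpos_Reals_iff)
  have slit: "w \<in> slit_upper" if "w \<notin> \<real>\<^sub>\<le>\<^sub>0" "0 \<le> Im w" for w
    using that by (auto simp: slit_upper_iff complex_nonpos_Reals_iff)
  show "J_branch ` (- \<real>\<^sub>\<le>\<^sub>0) \<subseteq> sector m"
    using sec sec_cnj slit slit_cnj by (auto simp: J_branch_def)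
  have agree: "?r w = cnj (?r (cnj w))" if "w \<notin> \<real>\<^sub>\<le>\<^sub>0" "Im w = 0" for w
  proof -
    have "0 < Re w" "w = of_real (Re w)" using that by (auto simp: complex_nonpos_Reals_iff complex_eq_iff)
    moreover from this obtain x where "0 < x" "K (of_real (Re w)) = of_real x" using K_pos by blast
    ultimately obtain x where x: "0 < x" "K w = of_real x" by metis
    have "cnj w = w" using that by (simp add: complex_eq_iff)
    then show ?thesis using x powr_of_real[of x "- (1 / real m)"] by simp
  qed
  have "continuous_on ({w. 0 \<le> Im w} - \<real>\<^sub>\<le>\<^sub>0 \<union> ({w. Im w \<le> 0} - \<real>\<^sub>\<le>\<^sub>0))
     (\<lambda>w. if 0 \<le> Im w then ?r w else cnj (?r (cnj w)))"
  proof (rule continuous_on_cases_local)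
    let ?A = "{w. 0 \<le> Im w} - \<real>\<^sub>\<le>\<^sub>0" and ?B = "{w. Im w \<le> 0} - \<real>\<^sub>\<le>\<^sub>0"
    have "?A = (?A \<union> ?B) \<inter> {w. 0 \<le> Im w}" by auto
    then show "closedin (top_of_set (?A \<union> ?B)) ?A"
      using closed_halfspace_Im_ge[of 0] by (metis closedin_closed_Int)
    have "?B = (?A \<union> ?B) \<inter> {w. Im w \<le> 0}"
    proof (intro equalityI subsetI)
      fix w assume "w \<in> (?A \<union> ?B) \<inter> {w. Im w \<le> 0}"
      then show "w \<in> ?B" by blast
    qed blast
    then show "closedin (top_of_set (?A \<union> ?B)) ?B"
      using closed_halfspace_Im_le[of 0] by (metis closedin_closed_Int)
    show "continuous_on ?A ?r"
      by (rule continuous_on_subset[OF r_cont]) (use slit in auto)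
    show "continuous_on ?B (\<lambda>w. cnj (?r (cnj w)))"
      by (intro continuous_on_cnj continuous_on_compose2[OF r_cont] continuous_on_id) (use slit_cnj in auto)
    show "\<And>w. w \<in> ?A \<and> \<not> 0 \<le> Im w \<or> w \<in> ?B \<and> 0 \<le> Im w \<Longrightarrow> ?r w = cnj (?r (cnj w))"
      using agree by auto
  qed
  moreover have "{w. 0 \<le> Im w} - \<real>\<^sub>\<le>\<^sub>0 \<union> ({w. Im w \<le> 0} - \<real>\<^sub>\<le>\<^sub>0) = - \<real>\<^sub>\<le>\<^sub>0" by auto
  ultimately show "continuous_on (- \<real>\<^sub>\<le>\<^sub>0) J_branch"
    by (simp only: J_branch_def[abs_def])
  show "Im z < 0 \<Longrightarrow> J_branch z \<in> sector m \<and> Im (J_branch z) > 0 \<and> I_fun m S \<beta> (J_branch z) = z"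
  proof -
    assume z: "Im z < 0"
    have sz: "cnj z \<in> slit_upper" using z by (simp add: slit_upper_iff)
    have Kz: "0 < Im (K (cnj z))" using z by (intro K_upper) simp
    let ?u = "?r (cnj z)"
    have u: "?u \<in> sector m" "Im ?u < 0" using sec[OF sz] Im_root_neg[OF Kz] by auto
    have "I_fun m S \<beta> ?u = \<Psi> (inverse (?u ^ m))" by (rule I_fun_eq[OF u])
    also have "inverse (?u ^ m) = K (cnj z)" by (rule inverse_power_root) (use Kz in auto)
    also have "\<Psi> (K (cnj z)) = cnj z" by (rule K(2)[OF sz])
    finally have "I_fun m S \<beta> (cnj ?u) = z" using I_fun_cnj[OF u] by simp
    then show ?thesis using z u sec_cnj[OF u(1)] by (simp add: J_branch_def)
  qed
  show "Im z > 0 \<Longrightarrow> J_branch z = cnj (J_branch (cnj z))"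
    by (simp add: J_branch_def)
qed

lemma J_fun_props:
  shows "Im z < 0 \<Longrightarrow> J_fun m S \<beta> z \<in> sector m \<and> Im (J_fun m S \<beta> z) > 0 \<and> I_fun m S \<beta> (J_fun m S \<beta> z) = z"
    and "Im z > 0 \<Longrightarrow> J_fun m S \<beta> z = cnj (J_fun m S \<beta> (cnj z))"
proof -
  have "\<exists>J. continuous_on (- \<real>\<^sub>\<le>\<^sub>0) J \<and> J ` (- \<real>\<^sub>\<le>\<^sub>0) \<subseteq> sector m \<and>
     (\<forall>z. Im z < 0 \<longrightarrow> J z \<in> sector m \<and> Im (J z) > 0 \<and> I_fun m S \<beta> (J z) = z) \<and>
     (\<forall>z. Im z > 0 \<longrightarrow> J z = cnj (J (cnj z)))"
    using J_branch_props by (intro exI[of _ J_branch]) blast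
  from someI_ex[OF this]
  show "Im z < 0 \<Longrightarrow> J_fun m S \<beta> z \<in> sector m \<and> Im (J_fun m S \<beta> z) > 0 \<and> I_fun m S \<beta> (J_fun m S \<beta> z) = z"
    and "Im z > 0 \<Longrightarrow> J_fun m S \<beta> z = cnj (J_fun m S \<beta> (cnj z))"
    unfolding J_fun_def by blast+
qed

text \<open>
  The defining conditions fix the value of \<open>J_fun\<close> in the open half-planes, by
  injectivity of \<open>\<Psi>\<close>.
\<close>
theorem J_fun_eq_root_K:
  assumes "0 < Im w"
  shows "J_fun m S \<beta> w = K w powr of_real (- (1 / real m))"
proof -
  let ?z = "J_fun m S \<beta> (cnj w)"
  have z: "?z \<in> sector m" "0 < Im ?z" "I_fun m S \<beta> ?z = cnj w"
    using J_fun_props(1)[of "cnj w"] assms by auto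
  let ?u = "cnj ?z"
  have u: "?u \<in> sector m" "Im ?u < 0"
    using z sector_cnj by auto
  have "I_fun m S \<beta> ?u = w" using I_fun_cnj[OF u] z(3) by (metis complex_cnj_cnj)
  then have "\<Psi> (inverse (?u ^ m)) = w" using I_fun_eq[OF u] by simp
  moreover have "inverse (?u ^ m) \<in> slit_upper"
    using Im_inverse_power_pos[OF u] by (simp only: slit_upper_iff simp_thms)
  ultimately have "K w = inverse (?u ^ m)" using K_\<Psi> by metis
  then have "K w powr of_real (- (1 / real m)) = ?u" using root_inverse_power[OF u(1)] by simp
  then show ?thesis using J_fun_props(2)[OF assms] by simp
qed

end

section \<open>Expansions of the map at zero and at infinity\<close>

lemma gbinomial_of_real: "(of_real x gchoose n :: complex) = of_real (x gchoose n)"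
  by (simp add: gbinomial_prod_rev)

lemma gbinomial_eq_signed_pochhammer:
  fixes x :: real
  shows "(x gchoose n) * (- 1) ^ n = pochhammer (- x) n / fact n"
proof -
  have "((- 1) ^ n * (- 1) ^ n :: real) = 1" by (simp flip: power_mult_distrib)
  then show ?thesis by (simp add: gbinomial_pochhammer)
qed

text \<open>
  From the second one on, the terms \<open>(x gchoose n) * (- 1) ^ n\<close> are
  nonpositive, and their partial sums have the closed form
  \<open>gbinomial_sum_lower_neg\<close>, which is nonnegative.
\<close>
lemma summable_abs_gbinomial:
  fixes x :: real
  assumes "0 < x" "x < 1"
  shows "summable (\<lambda>n. \<bar>x gchoose n\<bar>)"
proof (rule summableI_nonneg_bounded)
  fix N
  have neg: "(x gchoose Suc k) * (- 1) ^ Suc k \<le> 0" for k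
    unfolding gbinomial_eq_signed_pochhammer pochhammer_rec
  proof (intro divide_nonpos_pos mult_nonpos_nonneg)
    show "0 \<le> pochhammer (- x + 1) k" using assms by (intro less_imp_le pochhammer_pos) simp
  qed (use assms in simp_all)
  have abs: "\<bar>x gchoose Suc k\<bar> = - ((x gchoose Suc k) * (- 1) ^ Suc k)" for k
  proof -
    have "\<bar>(- 1) ^ Suc k :: real\<bar> = 1" by (simp only: power_abs abs_minus_cancel abs_one power_one)
    then have "\<bar>x gchoose Suc k\<bar> = \<bar>(x gchoose Suc k) * (- 1) ^ Suc k\<bar>" by (simp only: abs_mult mult_1_right)
    then show ?thesis unfolding abs_of_nonpos[OF neg] .
  qed
  have A: "(\<Sum>k\<le>N. \<bar>x gchoose k\<bar>) = 2 - (\<Sum>k\<le>N. (x gchoose k) * (- 1) ^ k)" for N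
    by (induction N) (simp_all add: abs del: power_Suc gbinomial_Suc)
  have B: "0 \<le> (\<Sum>k\<le>N. (x gchoose k) * (- 1) ^ k)" for N
  proof -
    have "(\<Sum>k\<le>N. (x gchoose k) * (- 1) ^ k) = (x - 1 gchoose N) * (- 1) ^ N"
      by (simp add: gbinomial_sum_lower_neg)
    also have "\<dots> \<ge> 0"
      unfolding gbinomial_eq_signed_pochhammer using assms pochhammer_pos[of "1 - x" N] by simp
    finally show ?thesis .
  qed
  have le: "(\<Sum>k\<le>N. \<bar>x gchoose k\<bar>) \<le> 2" for N using A[of N] B[of N] by linarith
  have "(\<Sum>k<N. \<bar>x gchoose k\<bar>) \<le> (\<Sum>k\<le>N. \<bar>x gchoose k\<bar>)"
    by (intro sum_mono2) auto
  with le[of N] show "(\<Sum>k<N. \<bar>x gchoose k\<bar>) \<le> 2" by linarith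
qed simp

context sector_map
begin

definition coef :: "real \<Rightarrow> nat \<Rightarrow> real" where
  "coef r n = (p gchoose n) / (real m * real n + r)"

text \<open>
  Up to a power of \<open>s\<close>, this is a primitive of a power of \<open>s\<close> times
  the binomial series of \<open>(1 + s) powr p\<close>: for
  \<open>r = m + \<gamma>\<close> it belongs to the expansion of \<open>\<Psi>\<close> at
  \<open>0\<close>, and for \<open>r = - S\<close> to the expansion at
  \<open>\<infinity>\<close>.
\<close>
definition binom_series :: "real \<Rightarrow> complex \<Rightarrow> complex" where
  "binom_series r s = (\<Sum>n. of_real (coef r n) * s ^ n)"

lemma p_less_1: "p < 1"
  using pq_less q_pos by simp

lemma summable_coef:
  assumes "\<And>n. 1 \<le> \<bar>real m * real n + r\<bar>"
  shows "summable (\<lambda>n. \<bar>coef r n\<bar>)"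
proof (rule summable_comparison_test'[OF summable_abs_gbinomial[OF p_pos p_less_1]])
  fix n
  have "\<bar>p gchoose n\<bar> / \<bar>real m * real n + r\<bar> \<le> \<bar>p gchoose n\<bar> / 1"
    using assms[of n] by (intro divide_left_mono) auto
  then show "norm \<bar>coef r n\<bar> \<le> \<bar>p gchoose n\<bar>"
    by (simp add: coef_def abs_divide)
qed

context
  fixes r :: real
  assumes r: "\<And>n. 1 \<le> \<bar>real m * real n + r\<bar>"
begin

lemma summable_binom_series:
  assumes "cmod s \<le> 1"
  shows "summable (\<lambda>n. of_real (coef r n) * s ^ n)"
proof (rule summable_comparison_test'[OF summable_coef[OF r]])
  fix n
  have "cmod s ^ n \<le> 1" using assms by (intro power_le_one) auto
  then show "cmod (of_real (coef r n) * s ^ n) \<le> \<bar>coef r n\<bar>"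
    by (simp add: norm_mult norm_power mult_left_le)
qed

lemma continuous_on_binom_series: "continuous_on (cball 0 1) (binom_series r)"
proof (rule uniform_limit_theorem)
  show "uniform_limit (cball 0 1) (\<lambda>N s. \<Sum>n<N. of_real (coef r n) * s ^ n) (binom_series r) sequentially"
    unfolding binom_series_def[abs_def]
  proof (rule Weierstrass_m_test[OF _ summable_coef[OF r]])
    fix n and s :: complex assume "s \<in> cball 0 1"
    then have "cmod s ^ n \<le> 1" by (intro power_le_one) (auto simp: dist_norm)
    then show "cmod (of_real (coef r n) * s ^ n) \<le> \<bar>coef r n\<bar>"
      by (simp add: norm_mult norm_power mult_left_le)
  qed
qed (auto intro!: always_eventually continuous_intros)

text \<open>
  The denominator \<open>m n + r\<close> is the symbol of the operator
  \<open>m s d/ds + r\<close>.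
\<close>
lemma binom_series_deriv:
  assumes s: "cmod s < 1"
  obtains D where "(binom_series r has_field_derivative D) (at s)"
    "of_nat m * s * D + of_real r * binom_series r s = (1 + s) powr of_real p"
proof -
  let ?c = "\<lambda>n. complex_of_real (coef r n)"
  let ?D = "\<Sum>n. diffs ?c n * s ^ n"
  have sm: "summable (\<lambda>n. ?c n * z ^ n)" if "cmod z < 1" for z
    using summable_binom_series[of z] that by simp
  have "((\<lambda>s. \<Sum>n. ?c n * s ^ n) has_field_derivative ?D) (at s)"
    by (rule termdiffs_strong'[of 1]) (use sm s in auto)
  then have D: "(binom_series r has_field_derivative ?D) (at s)"
    by (simp add: binom_series_def[abs_def])
  have "summable (\<lambda>n. diffs ?c n * s ^ n)"
    by (rule termdiff_converges[of s 1]) (use sm s in auto)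
  from diffs_equiv[OF this]
  have "(\<lambda>n. of_nat m * s * (of_nat n * ?c n * s ^ (n - Suc 0))) sums (of_nat m * s * ?D)"
    by (rule sums_mult)
  moreover have "of_nat m * s * (of_nat n * ?c n * s ^ (n - Suc 0)) = of_nat m * of_nat n * ?c n * s ^ n" for n
    by (cases n) simp_all
  moreover have "(\<lambda>n. of_real r * (?c n * s ^ n)) sums (of_real r * binom_series r s)"
    unfolding binom_series_def using sm[OF s] by (intro sums_mult summable_sums)
  ultimately have "(\<lambda>n. of_nat m * of_nat n * ?c n * s ^ n + of_real r * (?c n * s ^ n)) sums (of_nat m * s * ?D + of_real r * binom_series r s)"
    by (intro sums_add) simp_all
  moreover have "of_nat m * of_nat n * ?c n * s ^ n + of_real r * (?c n * s ^ n) = (of_real p gchoose n) * s ^ n" for n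
  proof -
    have "real m * real n + r \<noteq> 0" using r[of n] by auto
    then have "(real m * real n + r) * coef r n = (p gchoose n)" by (simp add: coef_def)
    then have "complex_of_real (real m * real n + r) * ?c n = of_real (p gchoose n)"
      by (simp only: of_real_mult[symmetric])
    moreover have "of_nat m * of_nat n * ?c n * s ^ n + of_real r * (?c n * s ^ n) = complex_of_real (real m * real n + r) * ?c n * s ^ n"
      by (simp add: algebra_simps)
    ultimately show ?thesis
      unfolding gbinomial_of_real by (simp only:)
  qed
  ultimately have "(\<lambda>n. (of_real p gchoose n) * s ^ n) sums (of_nat m * s * ?D + of_real r * binom_series r s)"
    by simp
  moreover have "(\<lambda>n. (of_real p gchoose n) * s ^ n) sums (1 + s) powr of_real p"
    by (rule gen_binomial_complex[OF s])
  ultimately show ?thesis using that[OF D] sums_unique2 by blast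
qed

lemma binom_series_quadratic:
  obtains A where "\<And>s. cmod s \<le> 1 \<Longrightarrow> cmod (binom_series r s - (of_real (coef r 0) + of_real (coef r 1) * s)) \<le> A * (cmod s)\<^sup>2"
proof
  fix s :: complex assume s: "cmod s \<le> 1"
  let ?c = "\<lambda>n. complex_of_real (coef r n)"
  have sm2: "summable (\<lambda>n. \<bar>coef r (n + 2)\<bar>)"
    using summable_coef[OF r] by (rule summable_ignore_initial_segment)
  have le: "cmod (?c (n + 2) * s ^ n) \<le> \<bar>coef r (n + 2)\<bar>" for n
  proof -
    have "cmod s ^ n \<le> 1" using s by (intro power_le_one) auto
    then show ?thesis by (simp add: norm_mult norm_power mult_left_le)
  qed
  have smn: "summable (\<lambda>n. cmod (?c (n + 2) * s ^ n))"
    by (rule summable_comparison_test'[OF sm2]) (use le in auto)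
  have "binom_series r s = (\<Sum>n. ?c (n + 2) * s ^ (n + 2)) + (\<Sum>n<2. ?c n * s ^ n)"
    unfolding binom_series_def by (rule suminf_split_initial_segment[OF summable_binom_series[OF s]])
  moreover have "(\<Sum>n<2. ?c n * s ^ n) = ?c 0 + ?c 1 * s"
    by (simp add: eval_nat_numeral)
  moreover have "?c (n + 2) * s ^ (n + 2) = s\<^sup>2 * (?c (n + 2) * s ^ n)" for n
    by (simp only: power_add mult_ac)
  ultimately have "binom_series r s - (?c 0 + ?c 1 * s) = (\<Sum>n. s\<^sup>2 * (?c (n + 2) * s ^ n))"
    by (simp only: add_diff_cancel_right')
  also have "\<dots> = s\<^sup>2 * (\<Sum>n. ?c (n + 2) * s ^ n)"
    by (rule suminf_mult[OF summable_norm_cancel[OF smn]])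
  finally have eq: "cmod (binom_series r s - (?c 0 + ?c 1 * s)) = (cmod s)\<^sup>2 * cmod (\<Sum>n. ?c (n + 2) * s ^ n)"
    by (simp add: norm_mult norm_power)
  have le2: "cmod (\<Sum>n. ?c (n + 2) * s ^ n) \<le> (\<Sum>n. \<bar>coef r (n + 2)\<bar>)"
    by (rule order_trans[OF summable_norm[OF smn] suminf_le[OF le smn sm2]])
  show "cmod (binom_series r s - (?c 0 + ?c 1 * s)) \<le> (\<Sum>n. \<bar>coef r (n + 2)\<bar>) * (cmod s)\<^sup>2"
    unfolding eq mult.commute[of "(cmod s)\<^sup>2"] by (rule mult_right_mono[OF le2 zero_le_power2])
qed

end

lemma r_zero: "1 \<le> \<bar>real m * real n + real (m + \<gamma>)\<bar>"
proof -
  have "1 \<le> real m" using m_pos by simp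
  moreover have "0 \<le> real m * real n" by simp
  ultimately show ?thesis unfolding of_nat_add by linarith
qed

text \<open>
  The integer \<open>S\<close> is strictly between \<open>m\<close> and \<open>2 m\<close>,
  hence not a multiple of \<open>m\<close>.
\<close>
lemma r_infinity: "1 \<le> \<bar>real m * real n + - real S\<bar>"
proof -
  have "m * n \<noteq> S"
  proof
    assume "m * n = S"
    moreover have "m * 1 < S" using sum_eq \<beta>_pos by simp
    ultimately have "m * 1 < m * n" "m * n < m * 2" using S_lt by simp_all
    then have "1 < n" "n < 2" using mult_less_cancel1 by blast+
    then show False by simp
  qed
  then have "int (m * n) - int S \<noteq> 0" by linarith
  then have "1 \<le> \<bar>int (m * n) - int S\<bar>" by linarith
  then have "1 \<le> \<bar>real_of_int (int (m * n) - int S)\<bar>" by linarith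
  then show ?thesis by simp
qed

definition \<Psi>_const :: complex where
  "\<Psi>_const = binom_series (real (m + \<gamma>)) 1 + binom_series (- real S) 1"

lemma \<Psi>_const_eq: "\<Psi>_const = of_real (C0 m S \<beta>)"
proof -
  have sm: "summable (\<lambda>n. coef (real (m + \<gamma>)) n)" "summable (\<lambda>n. coef (- real S) n)"
    using summable_coef[of "real (m + \<gamma>)", OF r_zero] summable_coef[of "- real S", OF r_infinity] summable_rabs_cancel by auto
  have "C0 m S \<beta> = (\<Sum>n. coef (real (m + \<gamma>)) n + coef (- real S) n)"
    unfolding C0_def
  proof (rule arg_cong[where f = suminf], rule ext)
    fix n
    have "real S - real \<beta> = real (m + \<gamma>)" using sum_eq by linarith
    then have "real S - real \<beta> + real m * real n = real m * real n + real (m + \<gamma>)" by simp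
    then show "(real \<beta> / real m gchoose n) * (1 / (real S - real \<beta> + real m * real n) + 1 / (real m * real n - real S)) =
       coef (real (m + \<gamma>)) n + coef (- real S) n"
      by (simp only: coef_def p_def) (simp add: distrib_left)
  qed
  also have "\<dots> = (\<Sum>n. coef (real (m + \<gamma>)) n) + (\<Sum>n. coef (- real S) n)"
    by (rule suminf_add[OF sm, symmetric])
  finally show ?thesis
    using sm by (simp add: \<Psi>_const_def binom_series_def suminf_of_real)
qed

lemma convex_half_disc:
  "convex ({s. 0 < Im s} \<inter> ball 0 1)" "convex ({s. Im s < 0} \<inter> ball 0 1)"
  by (intro convex_Int convex_ball convex_halfspace_Im_gt convex_halfspace_Im_lt)+

text \<open>
  Both sides have the derivative \<open>\<psi>\<close> in the upper half-disc and tend to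
  \<open>0\<close> at the origin.
\<close>
lemma \<Psi>_series_zero:
  assumes "0 < Im s" "cmod s < 1"
  shows "\<Psi> s = s powr of_real (q + 1) * binom_series (real (m + \<gamma>)) s"
proof -
  let ?L = "binom_series (real (m + \<gamma>))" and ?D = "{s. 0 < Im s} \<inter> ball 0 1"
  let ?f = "\<lambda>s. \<Psi> s - s powr of_real (q + 1) * ?L s"
  have r: "real (m + \<gamma>) = real m * (q + 1)" using m_pos by (simp add: q_def field_simps)
  have "(?f has_field_derivative 0) (at s within ?D)" if "s \<in> ?D" for s
  proof -
    have s: "0 < Im s" "cmod s < 1" "s \<noteq> 0" "s \<notin> \<real>\<^sub>\<le>\<^sub>0"
      using that by (auto simp: dist_norm complex_nonpos_Reals_iff)
    obtain D where D: "(?L has_field_derivative D) (at s)"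
      "of_nat m * s * D + of_real (real (m + \<gamma>)) * ?L s = (1 + s) powr of_real p"
      by (rule binom_series_deriv[OF r_zero s(2)])
    have pw: "((\<lambda>s. s powr of_real (q + 1)) has_field_derivative (of_real (q + 1) * s powr of_real q)) (at s)"
      using has_field_derivative_powr[OF s(4), of "of_real (q + 1)"] by simp
    have s1: "s powr of_real (q + 1) = s powr of_real q * s"
      using s(3) by (simp add: powr_add)
    have "(?f has_field_derivative (\<psi> s - (s powr of_real (q + 1) * D + of_real (q + 1) * s powr of_real q * ?L s))) (at s)"
      using DERIV_diff[OF \<Psi>_deriv_at[OF s(1)] DERIV_mult[OF pw D(1)]] by (simp add: add.commute mult.commute)
    moreover have "\<psi> s = s powr of_real (q + 1) * D + of_real (q + 1) * s powr of_real q * ?L s"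
      unfolding \<psi>_def D(2)[symmetric] r s1 using m_pos by (simp add: field_simps)
    ultimately show ?thesis by (simp add: has_field_derivative_at_within)
  qed
  then obtain C where C: "\<And>s. s \<in> ?D \<Longrightarrow> ?f s = C"
    using has_field_derivative_zero_constant[OF convex_half_disc(1), of ?f] by blast
  let ?z = "\<lambda>n. complex_of_real (1 / (real n + 2)) * \<i>"
  have z0: "?z \<longlonglongrightarrow> 0"
  proof -
    have "(\<lambda>n. 1 / (real n + 2)) \<longlonglongrightarrow> 0" by real_asymp
    then have "?z \<longlonglongrightarrow> of_real 0 * \<i>" by (intro tendsto_intros)
    then show ?thesis by simp
  qed
  have zD: "?z n \<in> ?D" for n
  proof -
    have "cmod (?z n) = 1 / (real n + 2)" unfolding norm_mult norm_of_real norm_ii by simp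
    also have "\<dots> < 1" by simp
    finally show ?thesis by (simp only: Int_iff mem_Collect_eq mem_ball dist_0_norm) simp
  qed
  have "(\<lambda>n. \<Psi> (?z n)) \<longlonglongrightarrow> \<Psi> 0"
    by (rule continuous_on_tendsto_compose[OF continuous_on_\<Psi> z0]) (use zD in \<open>auto simp: upper_def intro!: always_eventually\<close>)
  moreover have "(\<lambda>n. ?L (?z n)) \<longlonglongrightarrow> ?L 0"
    by (rule continuous_on_tendsto_compose[OF continuous_on_binom_series[OF r_zero] z0])
      (use zD in \<open>auto simp: dist_norm less_imp_le intro!: always_eventually\<close>)
  moreover have "(\<lambda>n. ?z n powr of_real (q + 1)) \<longlonglongrightarrow> 0 powr of_real (q + 1)"
    by (rule continuous_on_tendsto_compose[OF continuous_on_powr_upper z0]) (use zD q_pos in \<open>auto simp: upper_def intro!: always_eventually\<close>)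
  ultimately have "(\<lambda>n. ?f (?z n)) \<longlonglongrightarrow> \<Psi> 0 - 0 powr of_real (q + 1) * ?L 0"
    by (intro tendsto_diff tendsto_mult)
  then have "(\<lambda>n. C) \<longlonglongrightarrow> 0" unfolding C[OF zD] by simp
  then have "C = 0" by (simp add: LIMSEQ_const_iff)
  moreover have "s \<in> ?D" using assms by (simp add: dist_norm)
  ultimately show ?thesis using C by force
qed

text \<open>
  In the variable \<open>\<sigma> = 1/v\<close>, which runs through a lower half-disc, the two
  sides have the same derivative, so they differ by a constant. At the common boundary point
  \<open>v = \<sigma> = 1\<close> of the two discs the expansion at \<open>0\<close> gives
  \<open>\<Psi> 1\<close>, and the constant is the sum of the two series at \<open>1\<close>.
\<close>
theorem \<Psi>_series_infinity:
  assumes "Im \<sigma> < 0" "cmod \<sigma> < 1"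
  shows "\<Psi> (inverse \<sigma>) = of_real (C0 m S \<beta>) - inverse \<sigma> powr of_real (real S / real m) * binom_series (- real S) \<sigma>"
proof -
  let ?L = "binom_series (- real S)" and ?D = "{s. Im s < 0} \<inter> ball 0 1"
  let ?f = "\<lambda>\<sigma>. \<Psi> (inverse \<sigma>) + inverse \<sigma> powr of_real (p + q + 1) * ?L \<sigma>"
  have r: "real S = real m * (p + q + 1)" unfolding S_over_m[symmetric] using m_pos by simp
  have inv_up: "0 < Im (inverse \<sigma>)" if "Im \<sigma> < 0" for \<sigma>
    using that by (simp only: Im_inverse_pos_iff)
  have "(?f has_field_derivative 0) (at \<sigma> within ?D)" if "\<sigma> \<in> ?D" for \<sigma>
  proof -
    have s: "Im \<sigma> < 0" "cmod \<sigma> < 1" "\<sigma> \<noteq> 0"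
      using that by (auto simp: dist_norm)
    let ?v = "inverse \<sigma>"
    have v: "0 < Im ?v" by (rule inv_up[OF s(1)])
    then have v': "?v \<notin> \<real>\<^sub>\<le>\<^sub>0" "?v \<noteq> 0" by (auto simp: complex_nonpos_Reals_iff simp del: inverse_complex.sel)
    obtain D where D: "(?L has_field_derivative D) (at \<sigma>)"
      "of_nat m * \<sigma> * D + of_real (- real S) * ?L \<sigma> = (1 + \<sigma>) powr of_real p"
      by (rule binom_series_deriv[OF r_infinity s(2)])
    have inv: "(inverse has_field_derivative - (?v * ?v)) (at \<sigma>)"
      using DERIV_inverse[OF s(3)] by (simp add: power2_eq_square)
    have P: "((\<lambda>\<sigma>. \<Psi> (inverse \<sigma>)) has_field_derivative \<psi> ?v * - (?v * ?v)) (at \<sigma>)"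
      by (rule DERIV_chain2[OF \<Psi>_deriv_at[OF v] inv])
    have "((\<lambda>v. v powr of_real (p + q + 1)) has_field_derivative (of_real (p + q + 1) * ?v powr of_real (p + q))) (at ?v)"
      using has_field_derivative_powr[OF v'(1), of "of_real (p + q + 1)"] by simp
    from DERIV_chain2[OF this inv]
    have pw: "((\<lambda>\<sigma>. inverse \<sigma> powr of_real (p + q + 1)) has_field_derivative
       of_real (p + q + 1) * ?v powr of_real (p + q) * - (?v * ?v)) (at \<sigma>)" .
    have v1: "?v powr of_real (p + q + 1) = ?v powr of_real (p + q) * ?v"
      using v'(2) by (simp add: powr_add)
    have "(?f has_field_derivative (\<psi> ?v * - (?v * ?v) + (of_real (p + q + 1) * ?v powr of_real (p + q) * - (?v * ?v) * ?L \<sigma> + D * ?v powr of_real (p + q + 1)))) (at \<sigma>)"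
      by (rule DERIV_add[OF P DERIV_mult[OF pw D(1)]])
    moreover have "\<psi> ?v * - (?v * ?v) + (of_real (p + q + 1) * ?v powr of_real (p + q) * - (?v * ?v) * ?L \<sigma> + D * ?v powr of_real (p + q + 1)) = 0"
    proof -
      have d: "(1 + \<sigma>) powr of_real p / of_nat m = \<sigma> * D - of_real (p + q + 1) * ?L \<sigma>"
        unfolding D(2)[symmetric] of_real_minus unfolding r using m_pos by (simp add: field_simps)
      have "\<psi> ?v = ?v powr of_real (p + q) * ((1 + \<sigma>) powr of_real p / of_nat m)"
        unfolding \<psi>_def shifted_powr[OF v] using v'(2) by (simp add: powr_add)
      then have psi: "\<psi> ?v = ?v powr of_real (p + q) * (\<sigma> * D - of_real (p + q + 1) * ?L \<sigma>)"
        unfolding d .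
      have cancel: "X * (\<sigma> * D) * (?v * ?v) = D * (X * ?v)" for X
      proof -
        have "X * (\<sigma> * D) * (?v * ?v) = (\<sigma> * ?v) * (D * (X * ?v))" by (simp only: mult_ac)
        also have "\<sigma> * ?v = 1" using s(3) by simp
        finally show ?thesis by simp
      qed
      have "X * (\<sigma> * D - Z * l) * - (w * w) + (Z * X * - (w * w) * l + D * (X * w)) = D * (X * w) - X * (\<sigma> * D) * (w * w)" for X Z l w
        by (simp add: algebra_simps)
      then show ?thesis unfolding psi v1 by (simp only: cancel diff_self)
    qed
    ultimately show ?thesis by (simp add: has_field_derivative_at_within)
  qed
  then obtain C where C: "\<And>s. s \<in> ?D \<Longrightarrow> ?f s = C"
    using has_field_derivative_zero_constant[OF convex_half_disc(2), of ?f] by blast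
  \<comment> \<open>A sequence in the upper half-disc with limit \<open>1\<close>: the real part
    leaves the gap \<open>e\<close> to the circle, and the imaginary part \<open>e\<^sup>2\<close>
    is smaller.\<close>
  let ?e = "\<lambda>n. 1 / (real n + 2)"
  let ?z = "\<lambda>n. complex_of_real (1 - ?e n) + of_real ((?e n)\<^sup>2) * \<i>"
  have z1: "?z \<longlonglongrightarrow> 1"
  proof -
    have "?e \<longlonglongrightarrow> 0" by real_asymp
    then have "?z \<longlonglongrightarrow> of_real (1 - 0) + of_real (0\<^sup>2) * \<i>" by (intro tendsto_intros)
    then show ?thesis by simp
  qed
  have zn: "cmod (?z n) < 1" for n
  proof -
    have e: "0 < ?e n" "?e n \<le> 1 / 2" by (auto intro!: divide_left_mono)
    have "cmod (?z n) \<le> cmod (complex_of_real (1 - ?e n)) + cmod (of_real ((?e n)\<^sup>2) * \<i>)"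
      by (rule norm_triangle_ineq)
    also have "\<dots> = (1 - ?e n) + (?e n)\<^sup>2"
      unfolding norm_mult norm_of_real norm_ii using e by simp
    also have "\<dots> < 1"
    proof -
      have "?e n * ?e n < ?e n * 1" using e by (intro mult_strict_left_mono) auto
      then show ?thesis unfolding power2_eq_square by linarith
    qed
    finally show ?thesis .
  qed
  have zIm: "0 < Im (?z n)" for n by simp
  have zc: "cnj (?z n) \<in> ?D" for n
    using zn[of n] zIm[of n] by (simp only: Int_iff mem_Collect_eq cnj.sel mem_ball dist_0_norm complex_mod_cnj neg_less_0_iff_less)
  have zc1: "(\<lambda>n. cnj (?z n)) \<longlonglongrightarrow> 1"
    using tendsto_cnj[OF z1] by simp
  have zi1: "(\<lambda>n. inverse (cnj (?z n))) \<longlonglongrightarrow> 1"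
    using tendsto_inverse[OF zc1] by simp
  have ziup: "inverse (cnj (?z n)) \<in> upper" for n
  proof -
    have "Im (cnj (?z n)) < 0" using zc[of n] by blast
    then show ?thesis using inv_up[of "cnj (?z n)"] by (simp only: upper_def mem_Collect_eq less_imp_le)
  qed
  have one_up: "1 \<in> upper" by (simp add: upper_def)
  have "(\<lambda>n. \<Psi> (?z n)) \<longlonglongrightarrow> \<Psi> 1"
    by (rule continuous_on_tendsto_compose[OF continuous_on_\<Psi> z1 one_up]) (use zIm in \<open>auto simp: upper_def intro!: always_eventually less_imp_le\<close>)
  moreover have "(\<lambda>n. ?z n powr of_real (q + 1) * binom_series (real (m + \<gamma>)) (?z n)) \<longlonglongrightarrow> 1 powr of_real (q + 1) * binom_series (real (m + \<gamma>)) 1"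
  proof (intro tendsto_mult)
    show "(\<lambda>n. ?z n powr of_real (q + 1)) \<longlonglongrightarrow> 1 powr of_real (q + 1)"
      by (rule continuous_on_tendsto_compose[OF continuous_on_powr_upper z1 one_up]) (use zIm q_pos in \<open>auto simp: upper_def intro!: always_eventually less_imp_le\<close>)
    show "(\<lambda>n. binom_series (real (m + \<gamma>)) (?z n)) \<longlonglongrightarrow> binom_series (real (m + \<gamma>)) 1"
      by (rule continuous_on_tendsto_compose[OF continuous_on_binom_series[OF r_zero] z1])
        (use zn in \<open>simp_all only: mem_cball dist_0_norm norm_one order_refl less_imp_le eventually_True\<close>)
  qed
  ultimately have Psi1: "\<Psi> 1 = binom_series (real (m + \<gamma>)) 1"
    unfolding \<Psi>_series_zero[OF zIm zn] using LIMSEQ_unique by fastforce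
  have "(\<lambda>n. \<Psi> (inverse (cnj (?z n)))) \<longlonglongrightarrow> \<Psi> 1"
    by (rule continuous_on_tendsto_compose[OF continuous_on_\<Psi> zi1 one_up]) (use ziup in \<open>blast intro: always_eventually\<close>)
  moreover have "(\<lambda>n. inverse (cnj (?z n)) powr of_real (p + q + 1)) \<longlonglongrightarrow> 1 powr of_real (p + q + 1)"
  proof (rule continuous_on_tendsto_compose[OF continuous_on_powr_upper zi1 one_up])
    show "0 < p + q + 1" using p_pos q_pos by simp
  qed (use ziup in \<open>blast intro: always_eventually\<close>)
  moreover have "(\<lambda>n. ?L (cnj (?z n))) \<longlonglongrightarrow> ?L 1"
  proof (rule continuous_on_tendsto_compose[OF continuous_on_binom_series[OF r_infinity] zc1])
    show "\<forall>\<^sub>F n in sequentially. cnj (?z n) \<in> cball 0 1"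
      using zc by (intro always_eventually allI) (meson Int_iff ball_subset_cball subsetD)
  qed simp
  ultimately have "(\<lambda>n. ?f (cnj (?z n))) \<longlonglongrightarrow> \<Psi> 1 + 1 powr of_real (p + q + 1) * ?L 1"
    by (intro tendsto_add tendsto_mult)
  then have "(\<lambda>n. C) \<longlonglongrightarrow> \<Psi> 1 + ?L 1" unfolding C[OF zc] by simp
  then have "C = \<Psi> 1 + ?L 1" by (simp add: LIMSEQ_const_iff)
  then have Cc: "C = of_real (C0 m S \<beta>)" unfolding Psi1 \<Psi>_const_eq[symmetric] \<Psi>_const_def .
  have "\<sigma> \<in> ?D" using assms by (simp add: dist_norm)
  from C[OF this] have "\<Psi> (inverse \<sigma>) + inverse \<sigma> powr of_real (real S / real m) * ?L \<sigma> = C"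
    unfolding S_over_m .
  then show ?thesis unfolding Cc by (simp add: algebra_simps)
qed

end

section \<open>Solutions of the system on the positive axis\<close>

text \<open>
  The expansion at \<open>0\<close> from the right, up to an error of second order, of functions
  with value \<open>1\<close> at \<open>0\<close>.
\<close>
definition first_order :: "complex \<Rightarrow> (real \<Rightarrow> complex) \<Rightarrow> bool" where
  "first_order k f \<longleftrightarrow> (\<exists>A. \<forall>\<^sub>F x in at_right 0. cmod (f x - (1 + k * of_real x)) \<le> A * x\<^sup>2)"

lemma first_order_tendsto:
  assumes "first_order k f"
  shows "(f \<longlongrightarrow> 1) (at_right 0)"
proof -
  obtain A where A: "\<forall>\<^sub>F x in at_right 0. cmod (f x - (1 + k * of_real x)) \<le> A * x\<^sup>2"
    using assms by (auto simp: first_order_def)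
  have "((\<lambda>x. A * x\<^sup>2) \<longlongrightarrow> A * 0\<^sup>2) (at_right (0::real))"
    by (intro tendsto_intros)
  then have "((\<lambda>x. A * x\<^sup>2) \<longlongrightarrow> 0) (at_right (0::real))" by simp
  with A have "((\<lambda>x. f x - (1 + k * of_real x)) \<longlongrightarrow> 0) (at_right 0)"
    by (rule Lim_null_comparison)
  moreover have "((\<lambda>x. 1 + k * complex_of_real x) \<longlongrightarrow> 1 + k * of_real 0) (at_right 0)"
    by (intro tendsto_intros)
  ultimately have "((\<lambda>x. (f x - (1 + k * of_real x)) + (1 + k * of_real x)) \<longlongrightarrow> 0 + (1 + k * of_real 0)) (at_right 0)"
    by (rule tendsto_add)
  then show ?thesis by simp
qed

lemma first_order_bigo:
  assumes "first_order k f"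
  shows "(\<lambda>x. f x - (1 + k * of_real x)) \<in> O[at_right 0](\<lambda>x. (of_real x)\<^sup>2)"
proof -
  obtain A where "\<forall>\<^sub>F x in at_right 0. cmod (f x - (1 + k * of_real x)) \<le> A * x\<^sup>2"
    using assms by (auto simp: first_order_def)
  then show ?thesis by (intro bigoI[of _ A]) (simp add: norm_power)
qed

lemma first_order_bigo_linear:
  assumes "first_order k f"
  shows "(\<lambda>x. f x - 1) \<in> O[at_right 0](\<lambda>x. of_real x)"
proof -
  have "(\<lambda>x. complex_of_real x) \<in> O[at_right 0](\<lambda>_. 1)"
  proof (rule bigoI[of _ 1])
    have "\<forall>\<^sub>F x in at_right 0. 0 < x \<and> x < (1::real)"
      by (intro eventually_at_rightI[of 0 1]) auto
    then show "\<forall>\<^sub>F x in at_right 0. cmod (of_real x) \<le> 1 * cmod 1"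
      by eventually_elim simp
  qed
  then have "(\<lambda>x. complex_of_real x * of_real x) \<in> O[at_right 0](\<lambda>x. 1 * of_real x)"
    by (rule landau_o.big_mult) simp
  then have "(\<lambda>x. (complex_of_real x)\<^sup>2) \<in> O[at_right 0](\<lambda>x. of_real x)"
    by (simp add: power2_eq_square)
  with first_order_bigo[OF assms] have "(\<lambda>x. f x - (1 + k * of_real x)) \<in> O[at_right 0](\<lambda>x. of_real x)"
    by (rule landau_o.big_trans)
  moreover have "(\<lambda>x. k * complex_of_real x) \<in> O[at_right 0](\<lambda>x. of_real x)"
    by simp
  ultimately have "(\<lambda>x. (f x - (1 + k * of_real x)) + k * of_real x) \<in> O[at_right 0](\<lambda>x. of_real x)"
    by (rule sum_in_bigo)
  then show ?thesis by simp
qed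

lemma first_order_mult:
  assumes "first_order k f" "first_order l g"
  shows "first_order (k + l) (\<lambda>x. f x * g x)"
proof -
  obtain A where A: "\<forall>\<^sub>F x in at_right 0. cmod (f x - (1 + k * of_real x)) \<le> A * x\<^sup>2"
    using assms by (auto simp: first_order_def)
  obtain B where B: "\<forall>\<^sub>F x in at_right 0. cmod (g x - (1 + l * of_real x)) \<le> B * x\<^sup>2"
    using assms by (auto simp: first_order_def)
  have "\<forall>\<^sub>F x in at_right 0. cmod (g x - 1) < 1"
    using tendstoD[OF first_order_tendsto[OF assms(2)], of 1] by (simp add: dist_norm)
  then have g: "\<forall>\<^sub>F x in at_right 0. cmod (g x) \<le> 2"
  proof eventually_elim
    case (elim x)
    have "cmod (g x) \<le> cmod (g x - 1) + cmod 1" using norm_triangle_ineq[of "g x - 1" 1] by simp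
    then show ?case using elim by simp
  qed
  have "\<forall>\<^sub>F x in at_right 0. 0 < x \<and> x < (1::real)"
    by (intro eventually_at_rightI[of 0 1]) auto
  then have "\<forall>\<^sub>F x in at_right 0. cmod (f x * g x - (1 + (k + l) * of_real x)) \<le> (\<bar>A\<bar> * 2 + (1 + cmod k) * \<bar>B\<bar> + cmod (k * l)) * x\<^sup>2"
    using A B g
  proof eventually_elim
    case (elim x)
    have "f x * g x - (1 + (k + l) * of_real x) =
        (f x - (1 + k * of_real x)) * g x + (1 + k * of_real x) * (g x - (1 + l * of_real x)) + k * l * of_real (x\<^sup>2)"
      by (simp add: algebra_simps power2_eq_square)
    then have "cmod (f x * g x - (1 + (k + l) * of_real x)) \<le>
        cmod ((f x - (1 + k * of_real x)) * g x) + cmod ((1 + k * of_real x) * (g x - (1 + l * of_real x))) + cmod (k * l * of_real (x\<^sup>2))"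
      by (metis norm_triangle_le add_mono norm_triangle_ineq order_refl)
    moreover have "cmod ((f x - (1 + k * of_real x)) * g x) \<le> (\<bar>A\<bar> * x\<^sup>2) * 2"
    proof -
      have "A * x\<^sup>2 \<le> \<bar>A\<bar> * x\<^sup>2" by (intro mult_right_mono) auto
      with elim(2) have "cmod (f x - (1 + k * of_real x)) \<le> \<bar>A\<bar> * x\<^sup>2" by linarith
      then show ?thesis unfolding norm_mult using elim(4) by (intro mult_mono) auto
    qed
    moreover have "cmod ((1 + k * of_real x) * (g x - (1 + l * of_real x))) \<le> (1 + cmod k) * (\<bar>B\<bar> * x\<^sup>2)"
    proof -
      have "B * x\<^sup>2 \<le> \<bar>B\<bar> * x\<^sup>2" by (intro mult_right_mono) auto
      with elim(3) have "cmod (g x - (1 + l * of_real x)) \<le> \<bar>B\<bar> * x\<^sup>2" by linarith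
      moreover have "cmod (1 + k * of_real x) \<le> 1 + cmod k"
      proof -
        have "cmod (1 + k * of_real x) \<le> 1 + cmod k * x"
          using norm_triangle_ineq[of 1 "k * of_real x"] elim by (simp add: norm_mult)
        also have "cmod k * x \<le> cmod k" using elim by (simp add: mult_left_le)
        finally show ?thesis by simp
      qed
      ultimately show ?thesis unfolding norm_mult by (intro mult_mono) auto
    qed
    moreover have "cmod (k * l * of_real (x\<^sup>2)) = cmod (k * l) * x\<^sup>2"
      unfolding norm_mult norm_of_real by simp
    ultimately show ?case by (simp add: algebra_simps)
  qed
  then show ?thesis unfolding first_order_def by blast
qed

lemma first_order_power:
  assumes "first_order k f"
  shows "first_order (of_nat n * k) (\<lambda>x. f x ^ n)"
proof (induction n)
  case 0
  show ?case by (auto simp: first_order_def intro!: exI[of _ 0])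
next
  case (Suc n)
  show ?case using first_order_mult[OF assms Suc] by (simp add: algebra_simps)
qed

text \<open>
  The equation \<open>f' = f g\<close> makes \<open>f * exp (- A)\<close> constant for a
  primitive \<open>A\<close> of \<open>g\<close>.
\<close>
lemma linear_ode_nonzero:
  fixes f g :: "real \<Rightarrow> complex"
  assumes f': "\<And>x. 0 < x \<Longrightarrow> (f has_vector_derivative f x * g x) (at x)"
    and g: "continuous_on {0<..} g" and lim: "(f \<longlongrightarrow> 1) (at_right 0)" and x: "0 < x"
  shows "f x \<noteq> 0"
proof
  assume fx: "f x = 0"
  have "\<forall>\<^sub>F t in at_right 0. f t \<noteq> 0"
    using lim by (rule tendsto_imp_eventually_ne) simp
  moreover have "\<forall>\<^sub>F t in at_right 0. 0 < t \<and> t < x"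
    using x by (intro eventually_at_rightI[of 0 x]) auto
  ultimately have "\<forall>\<^sub>F t in at_right (0::real). f t \<noteq> 0 \<and> 0 < t \<and> t < x"
    by eventually_elim auto
  from eventually_happens[OF this] obtain \<epsilon> where e: "f \<epsilon> \<noteq> 0" "0 < \<epsilon>" "\<epsilon> < x"
    by (auto simp: trivial_limit_at_right_real)
  have "continuous_on {\<epsilon>..x} g" by (rule continuous_on_subset[OF g]) (use e in auto)
  from antiderivative_continuous[OF this] obtain A where
    A: "\<And>t. t \<in> {\<epsilon>..x} \<Longrightarrow> (A has_vector_derivative g t) (at t within {\<epsilon>..x})" by blast
  let ?h = "\<lambda>t. f t * exp (- A t)"
  have "(?h has_vector_derivative 0) (at t within {\<epsilon>..x})" if t: "t \<in> {\<epsilon>..x}" for t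
  proof -
    have "((\<lambda>t. - A t) has_vector_derivative - g t) (at t within {\<epsilon>..x})"
      using A[OF t] by (rule has_vector_derivative_minus)
    moreover have "(exp has_field_derivative exp (- A t)) (at (- A t) within (\<lambda>t. - A t) ` {\<epsilon>..x})"
      by (rule has_field_derivative_at_within[OF DERIV_exp])
    ultimately have "((\<lambda>t. exp (- A t)) has_vector_derivative - g t * exp (- A t)) (at t within {\<epsilon>..x})"
      by (rule field_vector_diff_chain_within[of "\<lambda>t. - A t", unfolded o_def])
    moreover have "(f has_vector_derivative f t * g t) (at t within {\<epsilon>..x})"
      using t e by (intro has_vector_derivative_at_within[OF f']) auto
    ultimately have "(?h has_vector_derivative f t * (- g t * exp (- A t)) + f t * g t * exp (- A t)) (at t within {\<epsilon>..x})"
      by (intro has_vector_derivative_mult)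
    then show ?thesis by (simp add: algebra_simps)
  qed
  from has_vector_derivative_zero_constant[OF _ this] obtain C where "\<And>t. t \<in> {\<epsilon>..x} \<Longrightarrow> ?h t = C"
    by (metis convex_closed_interval(1) convex_real_interval(5))
  from this[of \<epsilon>] this[of x] have "?h \<epsilon> = ?h x" using e by auto
  then show False using fx e by simp
qed

text \<open>
  The quotient is continuous with values in a finite set, hence constant.
\<close>
lemma root_of_unity_branch:
  fixes u w :: "real \<Rightarrow> complex"
  assumes m: "0 < m" and u: "continuous_on {0<..<s} u" and w: "continuous_on {0<..<s} w"
    and pow: "\<And>x. x \<in> {0<..<s} \<Longrightarrow> u x ^ m = w x ^ m" and nz: "\<And>x. x \<in> {0<..<s} \<Longrightarrow> w x \<noteq> 0"
    and near: "\<forall>\<^sub>F x in at_right 0. u x = w x" and x: "x \<in> {0<..<s}"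
  shows "u x = w x"
proof -
  let ?r = "\<lambda>x. u x / w x"
  have "?r constant_on {0<..<s}"
  proof (rule continuous_finite_range_constant)
    show "connected {0<..<s}" by (rule connected_Ioo)
    show "continuous_on {0<..<s} ?r" using nz by (intro continuous_on_divide u w) auto
    have "?r ` {0<..<s} \<subseteq> {z. z ^ m = 1}" using pow nz by (auto simp: power_divide)
    moreover have "finite {z :: complex. z ^ m = 1}" using m by (intro finite_roots_unity) simp
    ultimately show "finite (?r ` {0<..<s})" by (rule finite_subset)
  qed
  then obtain C where C: "\<And>x. x \<in> {0<..<s} \<Longrightarrow> ?r x = C" by (auto simp: constant_on_def)
  have "\<forall>\<^sub>F t in at_right 0. 0 < t \<and> t < s" using x by (intro eventually_at_rightI[of 0 s]) auto
  with near have "\<forall>\<^sub>F t in at_right (0::real). u t = w t \<and> 0 < t \<and> t < s"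
    by eventually_elim auto
  from eventually_happens[OF this] obtain t where "u t = w t" "t \<in> {0<..<s}"
    by (auto simp: trivial_limit_at_right_real)
  then have "C = 1" using C[of t] nz[of t] by simp
  then show ?thesis using C[OF x] nz[OF x] by simp
qed

text \<open>
  A solution of the system on the positive axis. Here \<open>P\<close> is the component whose
  formula is derived (it plays the role of \<open>G\<close> for \<open>\<beta> = c\<close> and
  \<open>\<gamma> = b\<close>), and \<open>Q\<close> is the one that is eliminated.
\<close>
locale urn_ode = sector_map +
  fixes P Q :: "real \<Rightarrow> complex" and \<kappa> :: real
  assumes P': "\<And>x. 0 < x \<Longrightarrow> (P has_vector_derivative (P x ^ (m + \<gamma> + 1) * Q x ^ \<beta> - P x) / (of_nat m * of_real x)) (at x)"
    and Q': "\<And>x. 0 < x \<Longrightarrow> (Q has_vector_derivative (Q x ^ (m + \<beta> + 1) * P x ^ \<gamma> - Q x) / (of_nat m * of_real x)) (at x)"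
    and P_0: "first_order (- \<i> * (of_nat \<beta> / of_nat S)) P"
    and Q_0: "first_order (\<i> * (of_nat \<gamma> / of_nat S)) Q"
    and \<kappa>_pos: "0 < \<kappa>" and \<kappa>_power: "\<kappa> ^ m = real S / (real m * (real S - real m))"
begin

lemma continuous_P: "continuous_on {0<..} P" and continuous_Q: "continuous_on {0<..} Q"
  using P' Q' by (auto intro!: continuous_at_imp_continuous_on has_vector_derivative_continuous)

lemma P_nonzero: "0 < x \<Longrightarrow> P x \<noteq> 0"
proof (rule linear_ode_nonzero[where g = "\<lambda>x. (P x ^ (m + \<gamma>) * Q x ^ \<beta> - 1) / (of_nat m * of_real x)"])
  show "continuous_on {0<..} (\<lambda>x. (P x ^ (m + \<gamma>) * Q x ^ \<beta> - 1) / (of_nat m * of_real x))"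
    using m_pos by (intro continuous_intros continuous_P continuous_Q) auto
  show "(P has_vector_derivative P x * ((P x ^ (m + \<gamma>) * Q x ^ \<beta> - 1) / (of_nat m * of_real x))) (at x)" if "0 < x" for x
    using P'[OF that] by (simp add: algebra_simps)
qed (rule first_order_tendsto[OF P_0])

lemma Q_nonzero: "0 < x \<Longrightarrow> Q x \<noteq> 0"
proof (rule linear_ode_nonzero[where g = "\<lambda>x. (Q x ^ (m + \<beta>) * P x ^ \<gamma> - 1) / (of_nat m * of_real x)"])
  show "continuous_on {0<..} (\<lambda>x. (Q x ^ (m + \<beta>) * P x ^ \<gamma> - 1) / (of_nat m * of_real x))"
    using m_pos by (intro continuous_intros continuous_P continuous_Q) auto
  show "(Q has_vector_derivative Q x * ((Q x ^ (m + \<beta>) * P x ^ \<gamma> - 1) / (of_nat m * of_real x))) (at x)" if "0 < x" for x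
    using Q'[OF that] by (simp add: algebra_simps)
qed (rule first_order_tendsto[OF Q_0])

lemma inverse_power_deriv:
  fixes f h :: "real \<Rightarrow> complex"
  assumes f: "(f has_vector_derivative (f x ^ (m + i + 1) * h x ^ j - f x) / (of_nat m * of_real x)) (at x)"
    and nz: "f x \<noteq> 0" and x: "0 < x"
  shows "((\<lambda>x. inverse (f x ^ m)) has_vector_derivative (inverse (f x ^ m) - f x ^ i * h x ^ j) / of_real x) (at x)"
proof -
  obtain k where k: "m = Suc k" using m_pos by (cases m) auto
  have "((\<lambda>z. z ^ m) has_field_derivative (1 + of_nat k) * (1 * f x ^ k)) (at (f x))"
    unfolding k by (rule DERIV_power_Suc) (rule DERIV_ident)
  from DERIV_inverse'[OF this] nz
  have "((\<lambda>z. inverse (z ^ m)) has_field_derivative - (inverse (f x ^ m) * ((1 + of_nat k) * (1 * f x ^ k)) * inverse (f x ^ m))) (at (f x))"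
    by simp
  from field_vector_diff_chain_at[OF f this]
  have "((\<lambda>x. inverse (f x ^ m)) has_vector_derivative ((f x ^ (m + i + 1) * h x ^ j - f x) / (of_nat m * of_real x)) *
      - (inverse (f x ^ m) * ((1 + of_nat k) * (1 * f x ^ k)) * inverse (f x ^ m))) (at x)"
    by (simp only: o_def)
  moreover have "((f x ^ (m + i + 1) * h x ^ j - f x) / (of_nat m * of_real x)) *
      - (inverse (f x ^ m) * ((1 + of_nat k) * (1 * f x ^ k)) * inverse (f x ^ m)) = (inverse (f x ^ m) - f x ^ i * h x ^ j) / of_real x"
  proof -
    have m1: "(1 + of_nat k :: complex) = of_nat m" by (simp add: k)
    have fk: "f x ^ m = f x * f x ^ k" by (simp add: k)
    have pw: "f x ^ (m + i + 1) = f x ^ m * f x ^ i * f x" by (simp add: power_add)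
    have "((M * I * f' * H - f') / (c * r)) * - (inverse M * (c * (1 * K)) * inverse M) = (inverse M - I * H) / r"
      if "M = f' * K" "M \<noteq> 0" "c \<noteq> 0" "r \<noteq> 0" for M I f' H c r K :: complex
      using that by (simp add: field_simps)
    from this[OF fk, of "of_nat m" "of_real x" "f x ^ i" "h x ^ j"] show ?thesis
      using nz x m_pos unfolding m1 pw by simp
  qed
  ultimately show ?thesis by (simp only:)
qed

lemma kappa_complex: "complex_of_real \<kappa> ^ m = of_nat S / (of_nat m * (of_nat \<beta> + of_nat \<gamma>))"
proof -
  have "real S - real m = real \<beta> + real \<gamma>" using sum_eq by linarith
  then have "\<kappa> ^ m = real S / (real m * (real \<beta> + real \<gamma>))" using \<kappa>_power by simp
  then have "complex_of_real (\<kappa> ^ m) = of_real (real S / (real m * (real \<beta> + real \<gamma>)))" by (rule arg_cong)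
  then show ?thesis by simp
qed

text \<open>
  The functions \<open>P powr (-m)\<close> and \<open>Q powr (-m)\<close> satisfy linear
  equations with the same inhomogeneity
  \<open>- P\<^sup>\<gamma> Q\<^sup>\<beta> / x\<close>, so their difference is a multiple
  of \<open>x\<close>. The factor is the limit at \<open>0\<close>.
\<close>
lemma first_integral:
  assumes "0 < x"
  shows "inverse (P x ^ m) - inverse (Q x ^ m) = \<i> / of_real \<kappa> ^ m * of_real x"
proof -
  let ?D = "\<lambda>x. inverse (P x ^ m) - inverse (Q x ^ m)"
  let ?c = "\<lambda>x. ?D x * complex_of_real (1 / x)"
  have "(?c has_vector_derivative 0) (at x within {0<..})" if x: "x \<in> {0<..}" for x
  proof -
    have x0: "0 < x" using x by simp
    have "(?D has_vector_derivative (inverse (P x ^ m) - P x ^ \<gamma> * Q x ^ \<beta>) / of_real x - (inverse (Q x ^ m) - Q x ^ \<beta> * P x ^ \<gamma>) / of_real x) (at x)"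
      by (intro has_vector_derivative_diff inverse_power_deriv P' Q' P_nonzero Q_nonzero x0)
    moreover have "((\<lambda>x. complex_of_real (1 / x)) has_vector_derivative of_real (- (1 / x\<^sup>2))) (at x)"
      by (rule has_vector_derivative_of_real) (use x0 in \<open>auto intro!: derivative_eq_intros simp: power2_eq_square\<close>)
    ultimately have "(?c has_vector_derivative (?D x * of_real (- (1 / x\<^sup>2)) +
       ((inverse (P x ^ m) - P x ^ \<gamma> * Q x ^ \<beta>) / of_real x - (inverse (Q x ^ m) - Q x ^ \<beta> * P x ^ \<gamma>) / of_real x) * of_real (1 / x))) (at x)"
      by (rule has_vector_derivative_mult)
    moreover have "?D x * of_real (- (1 / x\<^sup>2)) +
       ((inverse (P x ^ m) - P x ^ \<gamma> * Q x ^ \<beta>) / of_real x - (inverse (Q x ^ m) - Q x ^ \<beta> * P x ^ \<gamma>) / of_real x) * of_real (1 / x) = 0"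
      using x0 by (simp add: divide_simps power2_eq_square) (simp add: algebra_simps)
    ultimately show ?thesis by (simp add: has_vector_derivative_at_within)
  qed
  from has_vector_derivative_zero_constant[OF _ this] obtain C where C: "\<And>x. 0 < x \<Longrightarrow> ?c x = C"
    by (metis convex_real_interval(3) greaterThan_iff)
  have Pm: "first_order (of_nat m * (- \<i> * (of_nat \<beta> / of_nat S))) (\<lambda>x. P x ^ m)"
    by (rule first_order_power[OF P_0])
  have Qm: "first_order (of_nat m * (\<i> * (of_nat \<gamma> / of_nat S))) (\<lambda>x. Q x ^ m)"
    by (rule first_order_power[OF Q_0])
  \<comment> \<open>The limit of \<open>(Q x ^ m - P x ^ m) / x\<close> at
    \<open>0\<close>.\<close>
  let ?l = "of_nat m * (\<i> * (of_nat \<gamma> / of_nat S)) - of_nat m * (- \<i> * (of_nat \<beta> / of_nat S))"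
  obtain A where A: "\<forall>\<^sub>F x in at_right 0. cmod (P x ^ m - (1 + of_nat m * (- \<i> * (of_nat \<beta> / of_nat S)) * of_real x)) \<le> A * x\<^sup>2"
    using Pm unfolding first_order_def by blast
  obtain B where B: "\<forall>\<^sub>F x in at_right 0. cmod (Q x ^ m - (1 + of_nat m * (\<i> * (of_nat \<gamma> / of_nat S)) * of_real x)) \<le> B * x\<^sup>2"
    using Qm unfolding first_order_def by blast
  have "((\<lambda>x. (Q x ^ m - P x ^ m) / of_real x - ?l) \<longlongrightarrow> 0) (at_right 0)"
  proof (rule Lim_null_comparison)
    have "((\<lambda>x. (A + B) * x) \<longlongrightarrow> (A + B) * 0) (at_right 0)" by (intro tendsto_intros)
    then show "((\<lambda>x. (A + B) * x) \<longlongrightarrow> 0) (at_right 0)" by simp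
    show "\<forall>\<^sub>F x in at_right 0. cmod ((Q x ^ m - P x ^ m) / of_real x - ?l) \<le> (A + B) * x"
      using A B eventually_at_right_less[of 0]
    proof eventually_elim
      case (elim x)
      have "(Q x ^ m - P x ^ m) / of_real x - ?l =
         ((Q x ^ m - (1 + of_nat m * (\<i> * (of_nat \<gamma> / of_nat S)) * of_real x)) - (P x ^ m - (1 + of_nat m * (- \<i> * (of_nat \<beta> / of_nat S)) * of_real x))) / of_real x"
        using elim(3) by (simp add: field_simps)
      also have "cmod \<dots> = cmod ((Q x ^ m - (1 + of_nat m * (\<i> * (of_nat \<gamma> / of_nat S)) * of_real x)) - (P x ^ m - (1 + of_nat m * (- \<i> * (of_nat \<beta> / of_nat S)) * of_real x))) / x"
        unfolding norm_divide norm_of_real using elim(3) by simp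
      also have "\<dots> \<le> (B * x\<^sup>2 + A * x\<^sup>2) / x"
        by (intro divide_right_mono order_trans[OF norm_triangle_ineq4] add_mono elim(1,2)) (use elim(3) in simp)
      also have "\<dots> = (A + B) * x" using elim(3) by (simp add: field_simps power2_eq_square)
      finally show ?case .
    qed
  qed
  then have "((\<lambda>x. (Q x ^ m - P x ^ m) / of_real x) \<longlongrightarrow> ?l) (at_right 0)"
    by (simp add: LIM_zero_iff)
  then have "((\<lambda>x. (Q x ^ m - P x ^ m) / of_real x / (P x ^ m * Q x ^ m)) \<longlongrightarrow> ?l / (1 * 1)) (at_right 0)"
    by (intro tendsto_divide tendsto_mult first_order_tendsto[OF Pm] first_order_tendsto[OF Qm]) auto
  moreover have "\<forall>\<^sub>F x in at_right 0. (Q x ^ m - P x ^ m) / of_real x / (P x ^ m * Q x ^ m) = C"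
    using eventually_at_right_less[of 0]
  proof eventually_elim
    case (elim x)
    have "(Q x ^ m - P x ^ m) / of_real x / (P x ^ m * Q x ^ m) = ?c x"
      using P_nonzero[OF elim] Q_nonzero[OF elim] elim by (simp add: field_simps)
    then show ?case using C[OF elim] by simp
  qed
  ultimately have "((\<lambda>x::real. C) \<longlongrightarrow> ?l / (1 * 1)) (at_right 0)"
    by (rule Lim_transform_eventually)
  then have "C = ?l" by (simp add: tendsto_const_iff)
  also have "?l = \<i> / of_real \<kappa> ^ m"
  proof -
    have "(of_nat \<beta> + of_nat \<gamma> :: complex) \<noteq> 0" using \<beta>_pos by (metis add_gr_0 less_numeral_extra(3) of_nat_add of_nat_eq_0_iff)
    moreover have "of_nat S \<noteq> (0::complex)" using sum_eq \<beta>_pos by simp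
    ultimately show ?thesis unfolding kappa_complex using m_pos by (simp add: field_simps)
  qed
  finally have "?c x = \<i> / of_real \<kappa> ^ m" using C[OF assms] by simp
  then show ?thesis using assms by (simp add: field_simps)
qed

text \<open>
  The factor for which \<open>e x * P x\<close> and \<open>e x * Q x\<close> become the
  roots of order \<open>-m\<close> of \<open>v x\<close> and \<open>1 + v x\<close>.
\<close>
definition e :: "real \<Rightarrow> complex" where
  "e x = cis (- (pi / (2 * real m))) * of_real (x powr (1 / real m) / \<kappa>)"

definition v :: "real \<Rightarrow> complex" where
  "v x = inverse ((e x * P x) ^ m)"

lemma e_nonzero: "0 < x \<Longrightarrow> e x \<noteq> 0"
  using \<kappa>_pos by (simp add: e_def)

lemma e_power: "0 < x \<Longrightarrow> e x ^ n = cis (- (pi * real n / (2 * real m))) * of_real (x powr (real n / real m) / \<kappa> ^ n)"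
proof -
  assume x: "0 < x"
  have "(x powr (1 / real m)) ^ n = x powr (real n / real m)"
    using x by (simp add: powr_powr flip: powr_realpow)
  moreover have "cis (- (pi / (2 * real m))) ^ n = cis (- (pi * real n / (2 * real m)))"
    unfolding Complex.DeMoivre by (rule arg_cong[where f = cis]) simp
  ultimately show ?thesis unfolding e_def power_mult_distrib of_real_power[symmetric] power_divide by simp
qed

lemma e_power_m: "0 < x \<Longrightarrow> e x ^ m = - \<i> * of_real x / of_real \<kappa> ^ m"
  using e_power[of x m] m_pos \<kappa>_pos by (simp add: cis_conv_exp[symmetric] complex_eq_iff)

lemma inverse_minus_i_mult: "inverse (- \<i> * r / k * z) = \<i> * k * (inverse z * inverse r)"
  by (simp add: divide_inverse mult_ac)

lemma v_eq: "0 < x \<Longrightarrow> v x = \<i> * of_real \<kappa> ^ m * (inverse (P x ^ m) * of_real (1 / x))"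
  unfolding v_def power_mult_distrib by (simp only: e_power_m inverse_minus_i_mult) (simp add: divide_inverse)

text \<open>
  This is the first integral.
\<close>
lemma one_plus_v: 
  assumes "0 < x"
  shows "1 + v x = inverse ((e x * Q x) ^ m)"
proof -
  have k0: "complex_of_real \<kappa> ^ m \<noteq> 0" using \<kappa>_pos by simp
  have "inverse (P x ^ m) = inverse (Q x ^ m) + \<i> / of_real \<kappa> ^ m * of_real x"
    using first_integral[OF assms] by (simp add: algebra_simps)
  then have "v x = \<i> * of_real \<kappa> ^ m * ((inverse (Q x ^ m) + \<i> / of_real \<kappa> ^ m * of_real x) * of_real (1 / x))"
    unfolding v_eq[OF assms] by simp
  also have "\<dots> = \<i> * of_real \<kappa> ^ m * (inverse (Q x ^ m) * of_real (1 / x)) - 1"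
    using k0 assms by (simp add: field_simps)
  also have "\<i> * of_real \<kappa> ^ m * (inverse (Q x ^ m) * of_real (1 / x)) = inverse ((e x * Q x) ^ m)"
    unfolding power_mult_distrib e_power_m[OF assms] inverse_minus_i_mult by (simp add: divide_inverse)
  finally show ?thesis by simp
qed

lemma v_deriv:
  assumes "0 < x"
  shows "(v has_vector_derivative - (v x * P x ^ (m + \<gamma>) * Q x ^ \<beta> / of_real x)) (at x)"
proof -
  have "((\<lambda>x. inverse (P x ^ m)) has_vector_derivative (inverse (P x ^ m) - P x ^ \<gamma> * Q x ^ \<beta>) / of_real x) (at x)"
    by (intro inverse_power_deriv P' P_nonzero assms)
  moreover have "((\<lambda>x. complex_of_real (1 / x)) has_vector_derivative of_real (- (1 / x\<^sup>2))) (at x)"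
    by (rule has_vector_derivative_of_real) (use assms in \<open>auto intro!: derivative_eq_intros simp: power2_eq_square\<close>)
  ultimately have "((\<lambda>x. inverse (P x ^ m) * of_real (1 / x)) has_vector_derivative
     (inverse (P x ^ m) * of_real (- (1 / x\<^sup>2)) + (inverse (P x ^ m) - P x ^ \<gamma> * Q x ^ \<beta>) / of_real x * of_real (1 / x))) (at x)"
    by (rule has_vector_derivative_mult)
  then have "((\<lambda>x. \<i> * of_real \<kappa> ^ m * (inverse (P x ^ m) * of_real (1 / x))) has_vector_derivative
     \<i> * of_real \<kappa> ^ m * (inverse (P x ^ m) * of_real (- (1 / x\<^sup>2)) + (inverse (P x ^ m) - P x ^ \<gamma> * Q x ^ \<beta>) / of_real x * of_real (1 / x))) (at x)"
    by (rule has_vector_derivative_mult_right)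
  moreover have "inverse (P x ^ m) * of_real (- (1 / x\<^sup>2)) + (inverse (P x ^ m) - P x ^ \<gamma> * Q x ^ \<beta>) / of_real x * of_real (1 / x)
     = - (inverse (P x ^ m) * of_real (1 / x) * P x ^ (m + \<gamma>) * Q x ^ \<beta> / of_real x)"
    using assms P_nonzero[OF assms] by (simp add: field_simps power2_eq_square power_add)
  ultimately have "((\<lambda>x. \<i> * of_real \<kappa> ^ m * (inverse (P x ^ m) * of_real (1 / x))) has_vector_derivative
     - (v x * P x ^ (m + \<gamma>) * Q x ^ \<beta> / of_real x)) (at x)"
    unfolding v_eq[OF assms] by (simp only: mult_minus_right) (simp only: mult_ac times_divide_eq_right)
  then show ?thesis
    by (rule has_vector_derivative_transform_within_open[where S = "{0<..}"]) (use assms v_eq in auto)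
qed

lemma continuous_v: "continuous_on {0<..} v"
  using v_deriv by (auto intro!: continuous_at_imp_continuous_on has_vector_derivative_continuous)

lemma continuous_e: "continuous_on {0<..} e"
  unfolding e_def[abs_def] using \<kappa>_pos by (intro continuous_intros) auto

text \<open>
  Near \<open>0\<close> the argument of \<open>e x * f x\<close> is close to
  \<open>- \<pi> / (2 m)\<close>.
\<close>
lemma eventually_in_sector:
  assumes f: "(f \<longlongrightarrow> 1) (at_right 0)"
  shows "\<forall>\<^sub>F x in at_right 0. e x * f x \<in> sector m"
proof -
  let ?a = "cis (- (pi / (2 * real m)))"
  have m1: "1 \<le> real m" using m_pos by simp
  then have am: "pi / (2 * real m) \<le> pi / 2" by (intro divide_left_mono) auto
  have "Arg ?a = - (pi / (2 * real m))"
  proof (rule Arg_cis)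
    have "0 \<le> pi / (2 * real m)" by simp
    then show "- (pi / (2 * real m)) \<in> {- pi<..pi}"
      unfolding greaterThanAtMost_iff using am pi_gt_zero by linarith
  qed
  have cosa: "0 \<le> cos (pi / (2 * real m))" using am m_pos by (intro cos_ge_zero) (auto intro: order_trans[of _ 0])
  have "0 < pi / (2 * real m)" using m_pos by simp
  then have sina: "0 < sin (pi / (2 * real m))" using am pi_gt_zero by (intro sin_gt_zero) linarith+
  have an: "?a \<notin> \<real>\<^sub>\<le>\<^sub>0" using sina by (auto simp: complex_nonpos_Reals_iff)
  have "((\<lambda>x. ?a * f x) \<longlongrightarrow> ?a * 1) (at_right 0)" by (intro tendsto_intros f)
  then have "((\<lambda>x. Arg (?a * f x)) \<longlongrightarrow> Arg ?a) (at_right 0)"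
    using isCont_tendsto_compose[OF continuous_at_Arg[OF an]] by simp
  then have A: "((\<lambda>x. Arg (?a * f x)) \<longlongrightarrow> - (pi / (2 * real m))) (at_right 0)"
    using \<open>Arg ?a = _\<close> by simp
  have "- (pi / real m) < - (pi / (2 * real m))" "- (pi / (2 * real m)) < pi / real m"
    using m_pos by (simp_all add: field_simps)
  with A have "\<forall>\<^sub>F x in at_right 0. - (pi / real m) < Arg (?a * f x)" "\<forall>\<^sub>F x in at_right 0. Arg (?a * f x) < pi / real m"
    by (auto intro: order_tendstoD)
  moreover have "\<forall>\<^sub>F x in at_right 0. f x \<noteq> 0" using f by (rule tendsto_imp_eventually_ne) simp
  ultimately show ?thesis using eventually_at_right_less[of 0]
  proof eventually_elim
    case (elim x)
    have s: "0 < x powr (1 / real m) / \<kappa>" using elim \<kappa>_pos by simp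
    have "e x * f x = of_real (x powr (1 / real m) / \<kappa>) * (?a * f x)" by (simp add: e_def)
    then have "Arg (e x * f x) = Arg (?a * f x)" using s by (simp only: Arg_times_of_real)
    then show ?case using elim e_nonzero[of x] by (simp add: sector_def)
  qed
qed

text \<open>
  The identity holds up to a root of unity, and exactly near \<open>0\<close>.
\<close>
lemma unit_multiple_eq_root:
  assumes x: "x \<in> {0<..<s}" and H: "continuous_on {0<..} H" "(H \<longlongrightarrow> 1) (at_right 0)"
    and W: "continuous_on {0<..} W" and up: "\<And>x. x \<in> {0<..<s} \<Longrightarrow> 0 < Im (W x)"
    and W_eq: "\<And>x. 0 < x \<Longrightarrow> W x = inverse ((e x * H x) ^ m)"
  shows "e x * H x = W x powr of_real (- (1 / real m))"
proof (rule root_of_unity_branch[of m s "\<lambda>x. e x * H x" "\<lambda>x. W x powr of_real (- (1 / real m))", OF _ _ _ _ _ _ x])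
  show "0 < m" using m_pos by simp
  show "continuous_on {0<..<s} (\<lambda>x. e x * H x)"
    by (intro continuous_on_mult continuous_on_subset[OF continuous_e] continuous_on_subset[OF H(1)]) auto
  show "continuous_on {0<..<s} (\<lambda>x. W x powr of_real (- (1 / real m)))"
    by (intro continuous_on_powr_complex continuous_on_subset[OF W] continuous_on_const) (use up in force)+
  show "(e x * H x) ^ m = (W x powr of_real (- (1 / real m))) ^ m" if "x \<in> {0<..<s}" for x
  proof -
    have "W x \<noteq> 0" using up[OF that] by auto
    then have "inverse ((W x powr of_real (- (1 / real m))) ^ m) = W x" by (rule inverse_power_root)
    also have "W x = inverse ((e x * H x) ^ m)" using that by (intro W_eq) simp
    finally show ?thesis by (rule inverse_eq_imp_eq[symmetric])
  qed
  show "W x powr of_real (- (1 / real m)) \<noteq> 0" if "x \<in> {0<..<s}" for x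
    using up[OF that] by (auto simp: powr_def)
  show "\<forall>\<^sub>F x in at_right 0. e x * H x = W x powr of_real (- (1 / real m))"
    using eventually_in_sector[OF H(2)] eventually_at_right_less[of 0]
    by eventually_elim (simp only: W_eq root_inverse_power)
qed

lemma eventually_v_upper: "\<forall>\<^sub>F x in at_right 0. 0 < Im (v x)"
proof -
  have "((\<lambda>x. Re (P x ^ m)) \<longlongrightarrow> Re 1) (at_right 0)"
    by (intro tendsto_Re first_order_tendsto[OF first_order_power[OF P_0]])
  then have "\<forall>\<^sub>F x in at_right 0. 0 < Re (P x ^ m)" by (intro order_tendstoD(1)) auto
  then show ?thesis using eventually_at_right_less[of 0]
  proof eventually_elim
    case (elim x)
    have "(e x * P x) ^ m = of_real (x / \<kappa> ^ m) * (- \<i> * P x ^ m)"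
      unfolding power_mult_distrib by (simp add: e_power_m[OF elim(2)])
    then have "Im ((e x * P x) ^ m) = (x / \<kappa> ^ m) * - Re (P x ^ m)"
      by (simp only: times_complex.sel Re_complex_of_real Im_complex_of_real) simp
    moreover have "0 < x / \<kappa> ^ m" using elim \<kappa>_pos by simp
    then have "(x / \<kappa> ^ m) * - Re (P x ^ m) < 0" using elim by (intro mult_pos_neg) auto
    ultimately show ?case unfolding v_def Im_inverse_pos_iff by simp
  qed
qed

text \<open>
  The half-line on which \<open>\<Psi> (v x)\<close> moves.
\<close>
definition w :: "real \<Rightarrow> complex" where
  "w x = of_real (C0 m S \<beta>) + inverse (e x ^ S) / of_nat S"

lemma S_over_2m: "pi / 2 < pi * real S / (2 * real m)" "pi * real S / (2 * real m) < pi"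
proof -
  have "real m < real S" "real S < 2 * real m" using sum_eq S_lt \<beta>_pos by linarith+
  then show "pi / 2 < pi * real S / (2 * real m)" "pi * real S / (2 * real m) < pi"
    using m_pos by (simp_all add: field_simps)
qed

lemma inverse_e_power:
  assumes "0 < x"
  shows "inverse (e x ^ S) = of_real (\<kappa> ^ S) * cis (pi * real S / (2 * real m)) * of_real (x powr (- (real S / real m)))"
  unfolding e_power[OF assms] using \<kappa>_pos by (simp add: powr_minus field_simps cis_inverse flip: cis_inverse)

text \<open>
  Since \<open>m < S < 2 m\<close>, the direction \<open>\<pi> S / (2 m)\<close> of the
  half-line lies between \<open>\<pi> / 2\<close> and \<open>\<pi>\<close>.
\<close>
lemma w_upper:
  assumes "0 < x"
  shows "0 < Im (w x)"
proof -
  have "0 < sin (pi * real S / (2 * real m))" using S_over_2m pi_gt_zero by (intro sin_gt_zero) linarith+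
  moreover have c: "0 < \<kappa> ^ S * x powr (- (real S / real m)) / real S"
    using \<kappa>_pos assms sum_eq m_pos by (intro divide_pos_pos mult_pos_pos) auto
  moreover have "w x = of_real (C0 m S \<beta>) + of_real (\<kappa> ^ S * x powr (- (real S / real m)) / real S) * cis (pi * real S / (2 * real m))"
    unfolding w_def inverse_e_power[OF assms] by simp
  ultimately have "Im (w x) = \<kappa> ^ S * x powr (- (real S / real m)) / real S * sin (pi * real S / (2 * real m))"
    by (simp only: plus_complex.sel times_complex.sel Re_complex_of_real Im_complex_of_real cis.sel)
  then show ?thesis using mult_pos_pos[OF c \<open>0 < sin _\<close>] by simp
qed

context
  fixes s :: real
  assumes up: "\<And>x. x \<in> {0<..<s} \<Longrightarrow> 0 < Im (v x)" and s: "0 < s"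
begin

lemma eP_eq_root: "x \<in> {0<..<s} \<Longrightarrow> e x * P x = v x powr of_real (- (1 / real m))"
  by (rule unit_multiple_eq_root[OF _ continuous_P first_order_tendsto[OF P_0] continuous_v])
    (use up v_def in auto)

lemma eQ_eq_root: "x \<in> {0<..<s} \<Longrightarrow> e x * Q x = (1 + v x) powr of_real (- (1 / real m))"
  by (rule unit_multiple_eq_root[OF _ continuous_Q first_order_tendsto[OF Q_0]])
    (use up one_plus_v in \<open>auto intro!: continuous_intros continuous_v\<close>)

lemma powr_eq_inverse_root_power:
  fixes u :: complex
  assumes "u \<noteq> 0"
  shows "u powr of_real (real n / real m) = inverse ((u powr of_real (- (1 / real m))) ^ n)"
proof -
  have "(u powr of_real (- (1 / real m))) ^ n = exp (of_nat n * (of_real (- (1 / real m)) * Ln u))"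
    by (simp only: powr_def assms if_False exp_of_nat_mult)
  also have "of_nat n * (of_real (- (1 / real m)) * Ln u) = - (of_real (real n / real m) * Ln u)"
    by simp
  finally show ?thesis using assms by (simp add: powr_def exp_minus)
qed

text \<open>
  The powers of \<open>P\<close> and \<open>Q\<close> in the derivative of \<open>v\<close>
  cancel against those in \<open>\<psi> (v x)\<close>, because \<open>v x\<close> and
  \<open>1 + v x\<close> are powers of \<open>e x * P x\<close> and
  \<open>e x * Q x\<close>. Only a power of \<open>x\<close> remains.
\<close>
lemma \<Psi>_v_deriv:
  assumes "x \<in> {0<..<s}"
  shows "((\<lambda>x. \<Psi> (v x) - w x) has_vector_derivative 0) (at x)"
proof -
  have x: "0 < x" using assms by simp
  have v0: "v x \<noteq> 0" "1 + v x \<noteq> 0" using up[OF assms] by (auto simp: complex_eq_iff)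
  have nz: "P x \<noteq> 0" "Q x \<noteq> 0" "e x \<noteq> 0" using P_nonzero Q_nonzero e_nonzero x by auto
  have psi: "\<psi> (v x) = inverse ((e x * Q x) ^ \<beta>) * inverse ((e x * P x) ^ \<gamma>) / of_nat m"
    unfolding \<psi>_def p_def q_def powr_eq_inverse_root_power[OF v0(1)] powr_eq_inverse_root_power[OF v0(2)]
      eP_eq_root[OF assms] eQ_eq_root[OF assms] ..
  have "((\<lambda>x. \<Psi> (v x)) has_vector_derivative (- (v x * P x ^ (m + \<gamma>) * Q x ^ \<beta> / of_real x)) * \<psi> (v x)) (at x)"
    using v_deriv[OF x] \<Psi>_deriv_at[OF up[OF assms]] by (rule field_vector_diff_chain_at[unfolded o_def])
  moreover have "(- (v x * P x ^ (m + \<gamma>) * Q x ^ \<beta> / of_real x)) * \<psi> (v x) = - (inverse (e x ^ S) / (of_nat m * of_real x))"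
    unfolding psi unfolding v_def sum_eq[symmetric] using nz x m_pos by (simp add: field_simps power_add)
  ultimately have 1: "((\<lambda>x. \<Psi> (v x)) has_vector_derivative - (inverse (e x ^ S) / (of_nat m * of_real x))) (at x)"
    by (simp only:)
  let ?c = "of_real (C0 m S \<beta>)" and ?k = "of_real (\<kappa> ^ S) * cis (pi * real S / (2 * real m))"
  have "((\<lambda>x. complex_of_real (x powr (- (real S / real m)))) has_vector_derivative of_real (- (real S / real m) * x powr (- (real S / real m) - 1))) (at x)"
    by (rule has_vector_derivative_of_real) (use x in \<open>auto intro!: derivative_eq_intros\<close>)
  then have "((\<lambda>x. ?c + ?k * of_real (x powr (- (real S / real m))) / of_nat S) has_vector_derivative
     0 + ?k * of_real (- (real S / real m) * x powr (- (real S / real m) - 1)) / of_nat S) (at x)"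
    by (intro has_vector_derivative_add has_vector_derivative_const has_vector_derivative_divide has_vector_derivative_mult_right)
  moreover have "?k * of_real (- (real S / real m) * x powr (- (real S / real m) - 1)) / of_nat S = - (inverse (e x ^ S) / (of_nat m * of_real x))"
  proof -
    define y where "y = x powr (- (real S / real m))"
    have y: "x powr (- (real S / real m) - 1) = y / x"
      using x by (simp add: powr_diff y_def)
    have "complex_of_nat S \<noteq> 0" using sum_eq m_pos by simp
    then show ?thesis unfolding inverse_e_power[OF x] y y_def[symmetric] using x m_pos by (simp add: field_simps)
  qed
  ultimately have "((\<lambda>x. ?c + ?k * of_real (x powr (- (real S / real m))) / of_nat S) has_vector_derivative - (inverse (e x ^ S) / (of_nat m * of_real x))) (at x)"
    by simp
  then have "(w has_vector_derivative - (inverse (e x ^ S) / (of_nat m * of_real x))) (at x)"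
    by (rule has_vector_derivative_transform_within_open[where S = "{0<..}"]) (use x inverse_e_power in \<open>auto simp: w_def\<close>)
  from has_vector_derivative_diff[OF 1 this] show ?thesis by simp
qed

text \<open>
  Insert the expansion of \<open>\<Psi>\<close> at infinity. Up to a factor bounded by a
  multiple of \<open>x powr (- S / m)\<close>, the difference is the function
  \<open>?T\<close>. Its terms of order \<open>0\<close> and \<open>1\<close> cancel, and
  \<open>S / m < 2\<close> makes the remainder of second order negligible.
\<close>
lemma \<Psi>_v_tendsto: "((\<lambda>x. \<Psi> (v x) - w x) \<longlongrightarrow> 0) (at_right 0)"
proof -
  let ?L = "binom_series (- real S)" and ?\<sigma> = "\<lambda>x. (e x * P x) ^ m"
  let ?c0 = "complex_of_real (coef (- real S) 0)" and ?c1 = "complex_of_real (coef (- real S) 1)"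
  have S0: "real S \<noteq> 0" using sum_eq m_pos by simp
  obtain A where A: "\<And>s. cmod s \<le> 1 \<Longrightarrow> cmod (?L s - (?c0 + ?c1 * s)) \<le> A * (cmod s)\<^sup>2"
    using binom_series_quadratic[of "- real S", OF r_infinity] by blast
  have Pm: "first_order (of_nat m * (- \<i> * (of_nat \<beta> / of_nat S))) (\<lambda>x. P x ^ m)"
    by (rule first_order_power[OF P_0])
  have PS: "first_order (of_nat S * (- \<i> * (of_nat \<beta> / of_nat S))) (\<lambda>x. P x ^ S)"
    by (rule first_order_power[OF P_0])
  have \<sigma>: "?\<sigma> x = - \<i> / of_real (\<kappa> ^ m) * of_real x * P x ^ m" if "0 < x" for x
    unfolding power_mult_distrib e_power_m[OF that] by simp
  have pos: "\<forall>\<^sub>F x in at_right (0::real). 0 < x" by (rule eventually_at_right_less)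
  have Pb: "\<forall>\<^sub>F x in at_right 0. cmod (P x ^ m) < 2"
    using order_tendstoD(2)[OF tendsto_norm[OF first_order_tendsto[OF Pm]], of 2] by simp
  have k: "cmod (- \<i> / of_real (\<kappa> ^ m)) = 1 / \<kappa> ^ m"
    using \<kappa>_pos unfolding norm_divide norm_of_real by simp
  have \<sigma>_le: "\<forall>\<^sub>F x in at_right 0. cmod (?\<sigma> x) \<le> 1 / \<kappa> ^ m * 2 * x"
    using Pb pos
  proof eventually_elim
    case (elim x)
    have "cmod (?\<sigma> x) = 1 / \<kappa> ^ m * x * cmod (P x ^ m)"
      unfolding \<sigma>[OF elim(2)] norm_mult k norm_of_real using elim(2) by simp
    also have "\<dots> \<le> 1 / \<kappa> ^ m * x * 2"
      using elim \<kappa>_pos by (intro mult_left_mono) auto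
    finally show ?case by (simp only: mult_ac)
  qed
  have \<sigma>_bigo: "?\<sigma> \<in> O[at_right 0](\<lambda>x. of_real x)"
    by (rule bigoI[of _ "1 / \<kappa> ^ m * 2"]) (use \<sigma>_le pos in eventually_elim, simp)
  have \<sigma>_lim: "(?\<sigma> \<longlongrightarrow> 0) (at_right 0)"
  proof (rule Lim_null_comparison[OF \<sigma>_le])
    have "((\<lambda>x. 1 / \<kappa> ^ m * 2 * x) \<longlongrightarrow> 1 / \<kappa> ^ m * 2 * 0) (at_right 0)"
      by (intro tendsto_intros)
    then show "((\<lambda>x. 1 / \<kappa> ^ m * 2 * x) \<longlongrightarrow> 0) (at_right 0)" by simp
  qed
  have \<sigma>_small: "\<forall>\<^sub>F x in at_right 0. cmod (?\<sigma> x) < 1"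
    using order_tendstoD(2)[OF tendsto_norm[OF \<sigma>_lim], of 1] by simp
  let ?R1 = "\<lambda>x. ?L (?\<sigma> x) - (?c0 + ?c1 * ?\<sigma> x)"
  let ?R2 = "\<lambda>x. P x ^ S - (1 + of_nat S * (- \<i> * (of_nat \<beta> / of_nat S)) * of_real x)"
  let ?T = "\<lambda>x. ?L (?\<sigma> x) + P x ^ S / of_nat S"
  have "?R1 \<in> O[at_right 0](\<lambda>x. (?\<sigma> x)\<^sup>2)"
  proof (rule bigoI[of _ A])
    show "\<forall>\<^sub>F x in at_right 0. cmod (?R1 x) \<le> A * cmod ((?\<sigma> x)\<^sup>2)"
      using \<sigma>_small
    proof eventually_elim
      case (elim x)
      show ?case using A[OF less_imp_le[OF elim]] by (simp only: norm_power)
    qed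
  qed
  also have "(\<lambda>x. (?\<sigma> x)\<^sup>2) \<in> O[at_right 0](\<lambda>x. (of_real x)\<^sup>2)"
    by (rule landau_o.big_power[OF \<sigma>_bigo])
  finally have R1: "?R1 \<in> O[at_right 0](\<lambda>x. (of_real x)\<^sup>2)" .
  have "(\<lambda>x. complex_of_real x * (P x ^ m - 1)) \<in> O[at_right 0](\<lambda>x. of_real x * of_real x)"
    by (intro landau_o.big_mult first_order_bigo_linear[OF Pm]) simp
  then have R3: "(\<lambda>x. \<i> * (of_nat \<beta> / of_nat S) * (of_real x * (P x ^ m - 1))) \<in> O[at_right 0](\<lambda>x. (of_real x)\<^sup>2)"
  proof -
    assume *: "(\<lambda>x. complex_of_real x * (P x ^ m - 1)) \<in> O[at_right 0](\<lambda>x. of_real x * of_real x)"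
    have "(\<lambda>_::real. \<i> * (of_nat \<beta> / of_nat S)) \<in> O[at_right 0](\<lambda>_. 1 :: complex)" by simp
    from landau_o.big_mult[OF this *] show ?thesis by (simp only: power2_eq_square mult_1_left)
  qed
  have R2: "(\<lambda>x. ?R2 x / of_nat S) \<in> O[at_right 0](\<lambda>x. (of_real x)\<^sup>2)"
    using first_order_bigo[OF PS] S0 by simp
  have c0: "?c0 = - (1 / of_nat S)" by (simp add: coef_def)
  have cancel: "?c1 * (- \<i> / of_real (\<kappa> ^ m)) = \<i> * (of_nat \<beta> / of_nat S)"
  proof -
    have ks: "complex_of_real (\<kappa> ^ m) = of_nat S / (of_nat m * (of_nat \<beta> + of_nat \<gamma>))"
      using kappa_complex by simp
    have d: "real m * real 1 + - real S = - (real \<beta> + real \<gamma>)" using sum_eq by linarith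
    have "coef (- real S) 1 = - (real \<beta> / (real m * (real \<beta> + real \<gamma>)))"
      unfolding coef_def p_def d divide_minus_right by simp
    then have c1: "?c1 = - (of_nat \<beta> / (of_nat m * (of_nat \<beta> + of_nat \<gamma>)))" by simp
    have "(of_nat \<beta> + of_nat \<gamma> :: complex) \<noteq> 0"
      using \<beta>_pos by (metis add_gr_0 less_numeral_extra(3) of_nat_add of_nat_eq_0_iff)
    moreover have "- (b / (M * g)) * (- \<i> / (r / (M * g))) = \<i> * (b / r)" if "M \<noteq> 0" "g \<noteq> 0" "r \<noteq> 0" for b M g r :: complex
      using that by simp
    moreover have "of_nat m \<noteq> (0::complex)" "of_nat S \<noteq> (0::complex)" using m_pos S0 by simp_all
    ultimately show ?thesis unfolding ks c1 by blast
  qed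
  have T_eq: "?T x = ?R1 x + \<i> * (of_nat \<beta> / of_nat S) * (of_real x * (P x ^ m - 1)) + ?R2 x / of_nat S" if "0 < x" for x
  proof -
    have "?c1 * ?\<sigma> x = ?c1 * (- \<i> / of_real (\<kappa> ^ m)) * of_real x * P x ^ m"
      unfolding \<sigma>[OF that] by (simp only: mult.assoc)
    then have cs: "?c1 * ?\<sigma> x = \<i> * (of_nat \<beta> / of_nat S) * of_real x * P x ^ m"
      unfolding cancel .
    show ?thesis unfolding cs c0 using S0 by (simp add: field_simps)
  qed
  have "(\<lambda>x. ?R1 x + \<i> * (of_nat \<beta> / of_nat S) * (of_real x * (P x ^ m - 1)) + ?R2 x / of_nat S) \<in> O[at_right 0](\<lambda>x. (of_real x)\<^sup>2)"
    by (intro sum_in_bigo R1 R2 R3)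
  then obtain C where C: "\<forall>\<^sub>F x in at_right 0. cmod (?R1 x + \<i> * (of_nat \<beta> / of_nat S) * (of_real x * (P x ^ m - 1)) + ?R2 x / of_nat S) \<le> C * cmod ((of_real x)\<^sup>2)"
    by (auto elim!: landau_o.bigE)
  have "((\<lambda>x. cmod (inverse (P x ^ S))) \<longlongrightarrow> cmod (inverse 1)) (at_right 0)"
    by (intro tendsto_intros first_order_tendsto[OF PS]) simp
  then have Pinv: "\<forall>\<^sub>F x in at_right 0. cmod (inverse (P x ^ S)) < 2"
    by (rule order_tendstoD) simp
  have small: "\<forall>\<^sub>F x in at_right (0::real). x < s"
    using s by (intro eventually_at_rightI[of 0 s]) auto
  have "\<forall>\<^sub>F x in at_right 0. cmod (\<Psi> (v x) - w x) \<le> \<kappa> ^ S * \<bar>C\<bar> * 2 * x powr (2 - real S / real m)"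
    using C Pinv \<sigma>_small pos small
  proof eventually_elim
    case (elim x)
    have x: "x \<in> {0<..<s}" using elim by simp
    have v0: "v x \<noteq> 0" using up[OF x] by auto
    have nz: "P x \<noteq> 0" "e x \<noteq> 0" using P_nonzero e_nonzero elim by auto
    have iv: "inverse (?\<sigma> x) = v x" by (simp add: v_def)
    have "Im (?\<sigma> x) < 0" using up[OF x] unfolding v_def Im_inverse_pos_iff .
    from \<Psi>_series_infinity[OF this elim(3)]
    have "\<Psi> (v x) = of_real (C0 m S \<beta>) - inverse ((e x * P x) ^ S) * ?L (?\<sigma> x)"
      unfolding iv powr_eq_inverse_root_power[OF v0] eP_eq_root[OF x, symmetric] .
    moreover have "(c - inverse (E * Z) * l) - (c + inverse E / r) = - (inverse E * inverse Z * (l + Z / r))"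
      if "E \<noteq> 0" "Z \<noteq> 0" "r \<noteq> 0" for c E Z l r :: complex
      using that by (simp add: field_simps)
    moreover have "e x ^ S \<noteq> 0" "P x ^ S \<noteq> 0" "of_nat S \<noteq> (0::complex)" using nz S0 by simp_all
    ultimately have "\<Psi> (v x) - w x = - (inverse (e x ^ S) * inverse (P x ^ S) * ?T x)"
      unfolding w_def power_mult_distrib[of "e x" "P x" S] by metis
    then have "cmod (\<Psi> (v x) - w x) = cmod (inverse (e x ^ S)) * cmod (inverse (P x ^ S)) * cmod (?T x)"
      by (simp only: norm_minus_cancel norm_mult)
    also have "\<dots> \<le> (\<kappa> ^ S * x powr (- (real S / real m))) * 2 * (\<bar>C\<bar> * x\<^sup>2)"
    proof (intro mult_mono)
      show "cmod (inverse (e x ^ S)) \<le> \<kappa> ^ S * x powr (- (real S / real m))"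
        unfolding inverse_e_power[OF elim(4)] norm_mult norm_of_real norm_cis using \<kappa>_pos by simp
      have "C * x\<^sup>2 \<le> \<bar>C\<bar> * x\<^sup>2" by (intro mult_right_mono) auto
      moreover have "cmod (?T x) \<le> C * x\<^sup>2"
        unfolding T_eq[OF elim(4)] using elim(1) by (simp only: norm_power norm_of_real power2_abs)
      ultimately show "cmod (?T x) \<le> \<bar>C\<bar> * x\<^sup>2" by linarith
    qed (use elim \<kappa>_pos in auto)
    also have "\<dots> = \<kappa> ^ S * \<bar>C\<bar> * 2 * (x powr (- (real S / real m)) * x\<^sup>2)" by simp
    also have "x powr (- (real S / real m)) * x\<^sup>2 = x powr (2 - real S / real m)"
    proof -
      have "x\<^sup>2 = x powr 2" using elim(4) by simp
      then show ?thesis by (simp only: powr_add[symmetric]) simp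
    qed
    finally show ?case .
  qed
  moreover have "((\<lambda>x. \<kappa> ^ S * \<bar>C\<bar> * 2 * x powr (2 - real S / real m)) \<longlongrightarrow> \<kappa> ^ S * \<bar>C\<bar> * 2 * 0) (at_right 0)"
  proof (intro tendsto_intros)
    have "0 < 2 - real S / real m" using S_over_m pq_less by simp
    then show "((\<lambda>x. x powr (2 - real S / real m)) \<longlongrightarrow> 0) (at_right 0)" by real_asymp
  qed
  then have "((\<lambda>x. \<kappa> ^ S * \<bar>C\<bar> * 2 * x powr (2 - real S / real m)) \<longlongrightarrow> 0) (at_right 0)"
    by (simp only: mult_zero_right)
  ultimately show ?thesis by (rule Lim_null_comparison)
qed

lemma \<Psi>_v_eq:
  assumes x: "x \<in> {0<..<s}"
  shows "\<Psi> (v x) = w x"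
proof -
  have "((\<lambda>x. \<Psi> (v x) - w x) has_vector_derivative 0) (at t within {0<..<s})" if "t \<in> {0<..<s}" for t
    by (rule has_vector_derivative_at_within[OF \<Psi>_v_deriv[OF that]])
  from has_vector_derivative_zero_constant[OF _ this] obtain C where C: "\<And>t. t \<in> {0<..<s} \<Longrightarrow> \<Psi> (v t) - w t = C"
    by (metis convex_real_interval(8))
  have "\<forall>\<^sub>F t in at_right 0. \<Psi> (v t) - w t = C"
    using s C by (intro eventually_at_rightI[of 0 s]) auto
  then have "((\<lambda>x::real. C) \<longlongrightarrow> 0) (at_right 0)"
    by (rule Lim_transform_eventually[OF \<Psi>_v_tendsto])
  then have "C = 0" by (simp add: tendsto_const_iff)
  then show ?thesis using C[OF x] by simp
qed

lemma v_eq_K: "x \<in> {0<..<s} \<Longrightarrow> v x = K (w x)"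
  using \<Psi>_v_eq[of x] K_\<Psi>[of "v x"] up[of x] by (simp add: slit_upper_iff)

end

text \<open>
  First exit: at the first point \<open>s\<close> outside the half-plane, \<open>v s\<close>
  would be the limit of \<open>v t = K (w t)\<close> as \<open>t \<rightarrow> s\<close>,
  which is \<open>K (w s)\<close>, a point of the open half-plane.
\<close>
lemma v_upper:
  assumes "0 < x"
  shows "0 < Im (v x)"
proof (rule ccontr)
  assume nx: "\<not> 0 < Im (v x)"
  obtain \<epsilon> where e: "0 < \<epsilon>" "\<And>t. 0 < t \<Longrightarrow> t < \<epsilon> \<Longrightarrow> 0 < Im (v t)"
    using eventually_v_upper unfolding eventually_at_right_field by auto
  \<comment> \<open>The interval starts at \<open>\<epsilon> / 2\<close> because
    \<open>v\<close> is unbounded near \<open>0\<close>.\<close>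
  let ?B = "{t \<in> {\<epsilon> / 2..x}. Im (v t) \<le> 0}"
  have ex: "\<epsilon> \<le> x" using e nx assms by (metis not_le)
  have cv: "continuous_on {\<epsilon> / 2..x} (\<lambda>t. Im (v t))"
    by (intro continuous_on_Im continuous_on_subset[OF continuous_v]) (use e in auto)
  have "compact ?B"
  proof -
    have "closed ({\<epsilon> / 2..x} \<inter> (\<lambda>t. Im (v t)) -` {..0})"
      by (intro continuous_closed_preimage cv) auto
    moreover have "{\<epsilon> / 2..x} \<inter> (\<lambda>t. Im (v t)) -` {..0} = ?B" by auto
    ultimately have cl: "closed ?B" by (simp only:)
    have "compact ({\<epsilon> / 2..x} \<inter> ?B)" by (rule compact_Int_closed[OF compact_Icc cl])
    moreover have "{\<epsilon> / 2..x} \<inter> ?B = ?B" by auto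
    ultimately show ?thesis by (simp only:)
  qed
  moreover have "x \<in> ?B" using nx ex e by auto
  then have "?B \<noteq> {}" by blast
  ultimately obtain s where s: "s \<in> ?B" "\<And>t. t \<in> ?B \<Longrightarrow> s \<le> t"
    using compact_attains_inf[of ?B] by blast
  have s0: "0 < s" using s(1) e by auto
  have up: "0 < Im (v t)" if "t \<in> {0<..<s}" for t
  proof (cases "t < \<epsilon>")
    case True
    then show ?thesis using e that by auto
  next
    case False
    then have "t \<notin> ?B" using s(2)[of t] that by auto
    then show ?thesis using False that s(1) e by auto
  qed
  have eq: "v t = K (w t)" if "t \<in> {0<..<s}" for t
    using up s0 that by (rule v_eq_K)
  have left: "at s within {0<..<s} \<noteq> bot"
  proof -
    have "{0<..<s} - {s} = {0<..<s}" by auto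
    then show ?thesis using s0 by (simp add: at_within_eq_bot_iff)
  qed
  have "(v \<longlongrightarrow> v s) (at s within {0<..<s})"
    using continuous_v s0 by (auto simp: continuous_on_def intro: tendsto_within_subset)
  moreover have "((\<lambda>t. K (w t)) \<longlongrightarrow> K (w s)) (at s within {0<..<s})"
  proof (rule continuous_on_tendsto_compose[OF continuous_on_K])
    have "continuous_on {0<..} w"
      unfolding w_def[abs_def] using sum_eq m_pos e_nonzero
      by (intro continuous_intros continuous_e) auto
    then show "(w \<longlongrightarrow> w s) (at s within {0<..<s})"
      using s0 by (auto simp: continuous_on_def intro: tendsto_within_subset)
    show "w s \<in> slit_upper" using w_upper[OF s0] by (simp add: slit_upper_iff)
    show "\<forall>\<^sub>F t in at s within {0<..<s}. w t \<in> slit_upper"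
      unfolding eventually_at_filter using w_upper by (intro always_eventually) (auto simp: slit_upper_iff)
  qed
  then have "(v \<longlongrightarrow> K (w s)) (at s within {0<..<s})"
    by (rule Lim_transform_eventually) (use eq in \<open>auto simp: eventually_at_filter\<close>)
  ultimately have "v s = K (w s)" using left tendsto_unique by blast
  then have "0 < Im (v s)" using K_upper[OF w_upper[OF s0]] by simp
  then show False using s(1) by auto
qed

theorem P_formula:
  assumes "0 < x"
  shows "P x = of_real \<kappa> * cis (pi / (2 * real m)) * of_real (x powr (- (1 / real m))) * J_fun m S \<beta> (w x)"
proof -
  have up: "0 < Im (v t)" if "t \<in> {0<..<x + 1}" for t using v_upper that by auto
  have x: "x \<in> {0<..<x + 1}" "0 < x + 1" using assms by auto
  have "J_fun m S \<beta> (w x) = K (w x) powr of_real (- (1 / real m))"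
    by (rule J_fun_eq_root_K[OF w_upper[OF assms]])
  also have "K (w x) = v x" using v_eq_K[OF up x(2,1)] by simp
  also have "v x powr of_real (- (1 / real m)) = e x * P x" using eP_eq_root[OF up x(2,1)] by simp
  finally have J: "J_fun m S \<beta> (w x) = e x * P x" .
  have c: "cis (pi / (2 * real m)) * cis (- (pi / (2 * real m))) = 1" by (simp add: cis_mult)
  have r: "\<kappa> * x powr (- (1 / real m)) * (x powr (1 / real m) / \<kappa>) = 1"
    using assms \<kappa>_pos by (simp add: powr_minus field_simps)
  have "of_real \<kappa> * cis (pi / (2 * real m)) * of_real (x powr (- (1 / real m))) * (e x * P x) =
     of_real (\<kappa> * x powr (- (1 / real m)) * (x powr (1 / real m) / \<kappa>)) * (cis (pi / (2 * real m)) * cis (- (pi / (2 * real m)))) * P x"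
    unfolding e_def by (simp only: of_real_mult mult_ac)
  also have "\<dots> = P x" unfolding c r by simp
  finally show ?thesis unfolding J ..
qed

end

section \<open>Symmetries of the system and the main result\<close>

lemma urn_system_solution_derivs:
  assumes "urn_system_solution m S a b c d F G" "0 < m" "x \<noteq> 0"
  shows "(F has_vector_derivative (F x ^ (a + 1) * G x ^ b - F x) / (of_nat m * of_real x)) (at x)"
    and "(G has_vector_derivative (F x ^ c * G x ^ (d + 1) - G x) / (of_nat m * of_real x)) (at x)"
proof -
  have F: "(F has_vector_derivative vector_derivative F (at x)) (at x)"
    and G: "(G has_vector_derivative vector_derivative G (at x)) (at x)"
    using assms(1) by (simp_all add: urn_system_solution_def vector_derivative_works)
  have eqs: "F x + of_nat m * of_real x * vector_derivative F (at x) = F x ^ (a + 1) * G x ^ b"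
    "G x + of_nat m * of_real x * vector_derivative G (at x) = F x ^ c * G x ^ (d + 1)"
    using assms(1) unfolding urn_system_solution_def by blast+
  have nz: "of_nat m * complex_of_real x \<noteq> 0" using assms(2,3) by simp
  have "vector_derivative F (at x) = (F x ^ (a + 1) * G x ^ b - F x) / (of_nat m * of_real x)"
    "vector_derivative G (at x) = (F x ^ c * G x ^ (d + 1) - G x) / (of_nat m * of_real x)"
    unfolding eqs[symmetric] using nz by simp_all
  with F G show "(F has_vector_derivative (F x ^ (a + 1) * G x ^ b - F x) / (of_nat m * of_real x)) (at x)"
    and "(G has_vector_derivative (F x ^ c * G x ^ (d + 1) - G x) / (of_nat m * of_real x)) (at x)"
    by (simp_all only:)
qed

lemma urn_system_solutionI:
  assumes "\<And>x. (F has_vector_derivative F' x) (at x)" "\<And>x. (G has_vector_derivative G' x) (at x)"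
    and "\<And>x. F x + of_nat m * of_real x * F' x = F x ^ (a + 1) * G x ^ b"
    and "\<And>x. G x + of_nat m * of_real x * G' x = F x ^ c * G x ^ (d + 1)"
    and "(\<lambda>x. F x - (1 + \<i> * (of_nat b / of_nat S) * of_real x)) \<in> O[at 0](\<lambda>x. of_real (x ^ 2))"
    and "(\<lambda>x. G x - (1 - \<i> * (of_nat c / of_nat S) * of_real x)) \<in> O[at 0](\<lambda>x. of_real (x ^ 2))"
  shows "urn_system_solution m S a b c d F G"
  unfolding urn_system_solution_def
  using assms by (auto intro: differentiableI_vector simp: vector_derivative_at[OF assms(1)] vector_derivative_at[OF assms(2)])

lemma bigo_cnj: "f \<in> O[F](g) \<Longrightarrow> (\<lambda>x. cnj (f x)) \<in> O[F](g)"
  by (elim landau_o.bigE) (auto intro!: bigoI)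

lemma has_vector_derivative_cnj':
  "(f has_vector_derivative D) (at x) \<Longrightarrow> ((\<lambda>x. cnj (f x)) has_vector_derivative cnj D) (at x)"
  by (rule bounded_linear.has_vector_derivative[OF bounded_linear_cnj])

text \<open>
  Exchanging the two colours changes the sign of the first order terms; conjugation restores it.
\<close>
lemma urn_system_solution_swap:
  assumes sol: "urn_system_solution m S a b c d F G"
  shows "urn_system_solution m S d c b a (\<lambda>x. cnj (G x)) (\<lambda>x. cnj (F x))"
proof (rule urn_system_solutionI)
  fix x
  have d: "(F has_vector_derivative vector_derivative F (at x)) (at x)"
    "(G has_vector_derivative vector_derivative G (at x)) (at x)"
    using sol by (simp_all add: urn_system_solution_def vector_derivative_works)
  show "((\<lambda>x. cnj (G x)) has_vector_derivative cnj (vector_derivative G (at x))) (at x)"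
    "((\<lambda>x. cnj (F x)) has_vector_derivative cnj (vector_derivative F (at x))) (at x)"
    by (rule has_vector_derivative_cnj'[OF d(2)] has_vector_derivative_cnj'[OF d(1)])+
  have eqs: "F x + of_nat m * of_real x * vector_derivative F (at x) = F x ^ (a + 1) * G x ^ b"
    "G x + of_nat m * of_real x * vector_derivative G (at x) = F x ^ c * G x ^ (d + 1)"
    using sol unfolding urn_system_solution_def by blast+
  show "cnj (G x) + of_nat m * of_real x * cnj (vector_derivative G (at x)) = cnj (G x) ^ (d + 1) * cnj (F x) ^ c"
    using arg_cong[OF eqs(2), of cnj] by (simp add: mult.commute)
  show "cnj (F x) + of_nat m * of_real x * cnj (vector_derivative F (at x)) = cnj (G x) ^ b * cnj (F x) ^ (a + 1)"
    using arg_cong[OF eqs(1), of cnj] by (simp add: mult.commute)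
next
  have bF: "(\<lambda>x. F x - (1 + \<i> * (of_nat b / of_nat S) * of_real x)) \<in> O[at 0](\<lambda>x. of_real (x ^ 2))"
    and bG: "(\<lambda>x. G x - (1 - \<i> * (of_nat c / of_nat S) * of_real x)) \<in> O[at 0](\<lambda>x. of_real (x ^ 2))"
    using sol unfolding urn_system_solution_def by blast+
  show "(\<lambda>x. cnj (G x) - (1 + \<i> * (of_nat c / of_nat S) * of_real x)) \<in> O[at 0](\<lambda>x. of_real (x ^ 2))"
    using bigo_cnj[OF bG] by simp
  show "(\<lambda>x. cnj (F x) - (1 - \<i> * (of_nat b / of_nat S) * of_real x)) \<in> O[at 0](\<lambda>x. of_real (x ^ 2))"
    using bigo_cnj[OF bF] by simp
qed

lemma urn_system_solution_reflect:
  assumes sol: "urn_system_solution m S a b c d F G"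
  shows "urn_system_solution m S a b c d (\<lambda>x. cnj (F (- x))) (\<lambda>x. cnj (G (- x)))"
proof (rule urn_system_solutionI)
  fix x
  have d: "(F has_vector_derivative vector_derivative F (at (- x))) (at (- x))"
    "(G has_vector_derivative vector_derivative G (at (- x))) (at (- x))"
    using sol by (simp_all add: urn_system_solution_def vector_derivative_works)
  have u: "(uminus has_vector_derivative - 1) (at x)" for x :: real
    by (auto intro!: derivative_eq_intros)
  show "((\<lambda>x. cnj (F (- x))) has_vector_derivative cnj (- vector_derivative F (at (- x)))) (at x)"
    "((\<lambda>x. cnj (G (- x))) has_vector_derivative cnj (- vector_derivative G (at (- x)))) (at x)"
    using has_vector_derivative_cnj'[OF vector_diff_chain_at[OF u d(1)]]
      has_vector_derivative_cnj'[OF vector_diff_chain_at[OF u d(2)]] by (simp_all add: o_def)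
  have eqs: "F (- x) + of_nat m * of_real (- x) * vector_derivative F (at (- x)) = F (- x) ^ (a + 1) * G (- x) ^ b"
    "G (- x) + of_nat m * of_real (- x) * vector_derivative G (at (- x)) = F (- x) ^ c * G (- x) ^ (d + 1)"
    using sol unfolding urn_system_solution_def by blast+
  show "cnj (F (- x)) + of_nat m * of_real x * cnj (- vector_derivative F (at (- x))) = cnj (F (- x)) ^ (a + 1) * cnj (G (- x)) ^ b"
    using arg_cong[OF eqs(1), of cnj] by simp
  show "cnj (G (- x)) + of_nat m * of_real x * cnj (- vector_derivative G (at (- x))) = cnj (F (- x)) ^ c * cnj (G (- x)) ^ (d + 1)"
    using arg_cong[OF eqs(2), of cnj] by simp
next
  have bF: "(\<lambda>x. F x - (1 + \<i> * (of_nat b / of_nat S) * of_real x)) \<in> O[at 0](\<lambda>x. of_real (x ^ 2))"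
    and bG: "(\<lambda>x. G x - (1 - \<i> * (of_nat c / of_nat S) * of_real x)) \<in> O[at 0](\<lambda>x. of_real (x ^ 2))"
    using sol unfolding urn_system_solution_def by blast+
  have "((\<lambda>x. - x) \<longlongrightarrow> - 0) (at (0::real))" by (intro tendsto_intros)
  then have lim: "filterlim uminus (at (0::real)) (at 0)"
    by (intro filterlim_atI) (auto simp: eventually_at_filter)
  show "(\<lambda>x. cnj (F (- x)) - (1 + \<i> * (of_nat b / of_nat S) * of_real x)) \<in> O[at 0](\<lambda>x. of_real (x ^ 2))"
    using bigo_cnj[OF landau_o.big.compose[OF bF lim]] by simp
  show "(\<lambda>x. cnj (G (- x)) - (1 - \<i> * (of_nat c / of_nat S) * of_real x)) \<in> O[at 0](\<lambda>x. of_real (x ^ 2))"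
    using bigo_cnj[OF landau_o.big.compose[OF bG lim]] by simp
qed

lemma bigo_imp_first_order:
  assumes "(\<lambda>x. f x - (1 + k * of_real x)) \<in> O[at 0](\<lambda>x. of_real (x ^ 2))"
  shows "first_order k f"
proof -
  obtain A where A: "\<forall>\<^sub>F x in at 0. cmod (f x - (1 + k * of_real x)) \<le> A * cmod (of_real (x ^ 2))"
    using assms by (auto elim!: landau_o.bigE)
  have "\<forall>\<^sub>F x in at_right 0. cmod (f x - (1 + k * of_real x)) \<le> A * cmod (of_real (x ^ 2))"
    by (rule filter_leD[OF at_le A]) simp
  then have "\<forall>\<^sub>F x in at_right 0. cmod (f x - (1 + k * of_real x)) \<le> A * x\<^sup>2"
    by (simp only: norm_of_real abs_power2)
  then show ?thesis unfolding first_order_def by blast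
qed

lemma urn_system_solution_formula:
  fixes \<kappa> :: real
  assumes bounds: "m + 2 \<le> S" "S + 1 \<le> 2 * m" "1 \<le> b" "b + m + 1 \<le> S"
    and a: "a = S - b" and c: "c = S - m - b" and d: "d = m + b"
    and \<kappa>: "\<kappa> = (real S / (real m * (real S - real m))) powr (1 / real m)"
    and sol: "urn_system_solution m S a b c d F G" and x: "0 < x"
  defines "z \<equiv> of_real (C0 m S c) + of_real (\<kappa> ^ S) * exp (\<i> * of_real pi * of_nat S / (2 * of_nat m)) / of_nat S *
           of_real (x powr (- (real S / real m)))"
  shows "0 < Im z"
    and "G x = of_real \<kappa> * exp (\<i> * of_real pi / (2 * of_nat m)) * of_real (x powr (- (1 / real m))) * J_fun m S c z"
proof -
  have m: "0 < m" using bounds by simp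
  have pos: "0 < real S / (real m * (real S - real m))" using bounds by simp
  have \<kappa>_pos: "0 < \<kappa>" unfolding \<kappa> powr_gt_zero using pos by linarith
  interpret urn_ode m S c b G F \<kappa>
  proof
    show "0 < c" "0 < b" "c + b + m = S" "S < 2 * m" using bounds c by auto
    have am: "a + 1 = m + c + 1" and dm: "d + 1 = m + b + 1" using bounds a c d by auto
    show "(G has_vector_derivative (G t ^ (m + b + 1) * F t ^ c - G t) / (of_nat m * of_real t)) (at t)" if "0 < t" for t
      using urn_system_solution_derivs(2)[OF sol m, of t] that unfolding dm by (simp add: mult.commute)
    show "(F has_vector_derivative (F t ^ (m + c + 1) * G t ^ b - F t) / (of_nat m * of_real t)) (at t)" if "0 < t" for t
      using urn_system_solution_derivs(1)[OF sol m, of t] that unfolding am by simp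
    show "first_order (- \<i> * (of_nat c / of_nat S)) G"
      by (rule bigo_imp_first_order) (use sol in \<open>simp add: urn_system_solution_def\<close>)
    show "first_order (\<i> * (of_nat b / of_nat S)) F"
      by (rule bigo_imp_first_order) (use sol in \<open>simp add: urn_system_solution_def\<close>)
    show "0 < \<kappa>" by (rule \<kappa>_pos)
    have "\<kappa> ^ m = \<kappa> powr real m" by (rule powr_realpow[OF \<kappa>_pos, symmetric])
    also have "\<dots> = real S / (real m * (real S - real m))"
    proof -
      have "1 / real m * real m = 1" using m by simp
      then show ?thesis unfolding \<kappa> powr_powr by (simp only: powr_one[OF less_imp_le[OF pos]])
    qed
    finally show "\<kappa> ^ m = real S / (real m * (real S - real m))" .
  qed
  have c: "cis (pi / (2 * real m)) = exp (\<i> * of_real pi / (2 * of_nat m))"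
    "cis (pi * real S / (2 * real m)) = exp (\<i> * of_real pi * of_nat S / (2 * of_nat m))"
    by (simp_all add: cis_conv_exp mult.assoc)
  have z: "w x = z"
    unfolding z_def w_def inverse_e_power[OF x] c by simp
  show "0 < Im z" using w_upper[OF x] unfolding z .
  show "G x = of_real \<kappa> * exp (\<i> * of_real pi / (2 * of_nat m)) * of_real (x powr (- (1 / real m))) * J_fun m S c z"
    using P_formula[OF x] unfolding z c .
qed

theorem theorem6p7:
  fixes m S a b c d :: nat
    and M :: "'w measure" and U :: "real \<Rightarrow> 'w \<Rightarrow> nat \<times> nat" and X :: "'w \<Rightarrow> real"
    and N :: "'v measure" and V :: "real \<Rightarrow> 'v \<Rightarrow> nat \<times> nat" and Y :: "'v \<Rightarrow> real"
    and F G :: "real \<Rightarrow> complex" and \<kappa> :: real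
  assumes S_bounds: "m + 2 \<le> S" "S + 1 \<le> 2 * m"
    and b_bounds: "1 \<le> b" "b + m + 1 \<le> S"
    and a: "a = S - b" and c: "c = S - m - b" and d: "d = m + b"
    and U: "markov_jump_process M (urn_rate a b c d) (1, 0) U"
    and V: "markov_jump_process N (urn_rate a b c d) (0, 1) V"
    and X: "X \<in> borel_measurable M"
      "AE \<omega> in M. ((\<lambda>t. exp (- (real m * t)) * u2 S b c (U t \<omega>)) \<longlongrightarrow> X \<omega>) at_top"
    and Y: "Y \<in> borel_measurable N"
      "AE \<omega> in N. ((\<lambda>t. exp (- (real m * t)) * u2 S b c (V t \<omega>)) \<longlongrightarrow> Y \<omega>) at_top"
    and F: "F = char (distr M borel X)"
    and G: "G = char (distr N borel Y)"
    and \<kappa>: "\<kappa> = (real S / (real m * (real S - real m))) powr (1 / real m)"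
  shows "urn_system_solution m S a b c d F G \<and>
    (\<forall>F' G'. urn_system_solution m S a b c d F' G' \<longrightarrow> F' = F \<and> G' = G) \<and>
    (\<forall>x>0.
       F x = of_real \<kappa> * exp (- (\<i> * of_real pi / (2 * of_nat m))) * of_real (x powr (- (1 / real m))) *
         J_fun m S b (of_real (C0 m S b) +
           of_real (\<kappa> ^ S) * exp (- (\<i> * of_real pi * of_nat S / (2 * of_nat m))) / of_nat S *
           of_real (x powr (- (real S / real m)))) \<and>
       G x = of_real \<kappa> * exp (\<i> * of_real pi / (2 * of_nat m)) * of_real (x powr (- (1 / real m))) *
         J_fun m S c (of_real (C0 m S c) +
           of_real (\<kappa> ^ S) * exp (\<i> * of_real pi * of_nat S / (2 * of_nat m)) / of_nat S *
           of_real (x powr (- (real S / real m))))) \<and>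
    (\<forall>x. F (- x) = cnj (F x) \<and> G (- x) = cnj (G x))"
proof -
  have lu: "large_urn a b c d S m"
    by unfold_locales (use S_bounds b_bounds a c d in auto)
  have sol: "urn_system_solution m S a b c d F G"
    unfolding F G by (rule char_urn_system_solution[OF lu U V X Y])
  let ?wF = "\<lambda>x. of_real (C0 m S b) + of_real (\<kappa> ^ S) * exp (- (\<i> * of_real pi * of_nat S / (2 * of_nat m))) / of_nat S *
           complex_of_real (x powr (- (real S / real m)))"
  let ?F = "\<lambda>x. of_real \<kappa> * exp (- (\<i> * of_real pi / (2 * of_nat m))) * of_real (x powr (- (1 / real m))) * J_fun m S b (?wF x)"
  let ?G = "\<lambda>x. of_real \<kappa> * exp (\<i> * of_real pi / (2 * of_nat m)) * of_real (x powr (- (1 / real m))) *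
         J_fun m S c (of_real (C0 m S c) + of_real (\<kappa> ^ S) * exp (\<i> * of_real pi * of_nat S / (2 * of_nat m)) / of_nat S *
           of_real (x powr (- (real S / real m))))"
  interpret sector_map m S b c
    by unfold_locales (use S_bounds b_bounds c in auto)
  have formula: "F' x = ?F x" "G' x = ?G x"
    if sol': "urn_system_solution m S a b c d F' G'" and x: "0 < x" for F' G' x
  proof -
    show "G' x = ?G x"
      by (rule urn_system_solution_formula(2)[OF S_bounds b_bounds a c d \<kappa> sol' x])
    have c_bounds: "1 \<le> c" "c + m + 1 \<le> S" and swap: "d = S - c" "b = S - m - c" "a = m + c"
      using S_bounds b_bounds a c d by auto
    let ?w = "of_real (C0 m S b) + of_real (\<kappa> ^ S) * exp (\<i> * of_real pi * of_nat S / (2 * of_nat m)) / of_nat S *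
           complex_of_real (x powr (- (real S / real m)))"
    have "cnj (F' x) = of_real \<kappa> * exp (\<i> * of_real pi / (2 * of_nat m)) * of_real (x powr (- (1 / real m))) * J_fun m S b ?w"
      by (rule urn_system_solution_formula(2)[OF S_bounds c_bounds swap \<kappa> urn_system_solution_swap[OF sol'] x])
    then have F'x: "F' x = cnj (of_real \<kappa> * exp (\<i> * of_real pi / (2 * of_nat m)) * of_real (x powr (- (1 / real m))) * J_fun m S b ?w)"
      by (metis complex_cnj_cnj)
    have w_cnj: "cnj ?w = ?wF x" by (simp add: exp_cnj)
    have "0 < Im ?w"
      by (rule urn_system_solution_formula(1)[OF S_bounds c_bounds swap \<kappa> urn_system_solution_swap[OF sol'] x])
    from J_fun_props(2)[OF this] have "cnj (J_fun m S b ?w) = J_fun m S b (?wF x)"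
      unfolding w_cnj by (metis complex_cnj_cnj)
    then show "F' x = ?F x" unfolding F'x by (simp add: exp_cnj)
  qed
  have reflect: "F' (- x) = cnj (F' x)" "G' (- x) = cnj (G' x)"
    if sol': "urn_system_solution m S a b c d F' G'" and x: "0 < x" for F' G' x
  proof -
    note r = urn_system_solution_reflect[OF sol']
    have "cnj (F' (- x)) = F' x" "cnj (G' (- x)) = G' x"
      using formula[OF sol' x] formula[OF r x] by simp_all
    then show "F' (- x) = cnj (F' x)" "G' (- x) = cnj (G' x)" by (metis complex_cnj_cnj)+
  qed
  have zero: "F' 0 = 1" "G' 0 = 1" if sol': "urn_system_solution m S a b c d F' G'" for F' G'
  proof -
    have one: "H 0 = 1" if "first_order k H" "H differentiable at 0" for H :: "real \<Rightarrow> complex" and k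
    proof -
      have "(H \<longlongrightarrow> H 0) (at_right 0)"
        using differentiable_imp_continuous_within[OF that(2)] by (auto simp: continuous_within filterlim_at_split)
      then show ?thesis using first_order_tendsto[OF that(1)] tendsto_unique trivial_limit_at_right_real by blast
    qed
    have "first_order (\<i> * (of_nat b / of_nat S)) F'" "first_order (- \<i> * (of_nat c / of_nat S)) G'"
      by (rule bigo_imp_first_order; use sol' in \<open>simp add: urn_system_solution_def\<close>)+
    moreover have "F' differentiable at 0" "G' differentiable at 0"
      using sol' by (auto simp: urn_system_solution_def)
    ultimately show "F' 0 = 1" "G' 0 = 1" using one by blast+
  qed
  have unique: "F' = F \<and> G' = G" if sol': "urn_system_solution m S a b c d F' G'" for F' G'
  proof -
    have "F' x = F x \<and> G' x = G x" for x
    proof -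
      consider "x = 0" | "0 < x" | "0 < - x" by linarith
      then show ?thesis
      proof cases
        case 1
        then show ?thesis using zero[OF sol] zero[OF sol'] by simp
      next
        case 2
        then show ?thesis using formula[OF sol 2] formula[OF sol' 2] by simp
      next
        case 3
        then show ?thesis
          using reflect[OF sol 3] reflect[OF sol' 3] formula[OF sol 3] formula[OF sol' 3] by simp
      qed
    qed
    then show ?thesis by (simp add: fun_eq_iff)
  qed
  have conj: "F (- x) = cnj (F x) \<and> G (- x) = cnj (G x)" for x
  proof -
    consider "x = 0" | "0 < x" | "0 < - x" by linarith
    then show ?thesis
    proof cases
      case 3
      then show ?thesis using reflect[OF sol 3] by (metis complex_cnj_cnj minus_minus)
    qed (use zero[OF sol] reflect[OF sol] in simp_all)
  qed
  show ?thesis using sol unique formula[OF sol] conj by blast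
qed

end
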